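(* Let $n\ge 2$, let $r\in\{2,3,\dots\}\cup\{\infty,\omega\}$, and let $\nabla$ be an affine connection (not necessarily torsion-free) on an $n$-dimensional manifold $M$, given in a coordinate chart $(U,x)$, $x=(x^1,\dots,x^n)$, by components $\Gamma^h_{ij}(x)\in C^r(U)$, $h,i,j=1,\dots,n$. Then for every point $p\in U$ there exist an open neighbourhood $U'\subset U$ of $p$ and a coordinate transformation $x'=f(x)$ on $U'$ of class $C^{r}$ such that the components $\Gamma'^h_{ij}(x')$ of $\nabla$ in the new coordinates $(U',x')$ satisfy $$\Gamma'^h_{11}(x')=0,\qquad h=1,\dots,n,$$ i.e. the coordinates $(U',x')$ are pre-semigeodesic, and $\Gamma'^h_{ij}(x')\in C^{r-2}(U')$ for all $h,i,j$.
   Context: The differentiability classes are $C^r$ with $r\in\{0,1,2,\dots,\infty,\omega\}$, where $C^0$, $C^\infty$, $C^\omega$ denote continuous, infinitely differentiable and real analytic functions, respectively; $\infty-2=\infty$ and $\omega-2=\omega$. A coordinate transformation $x'=f(x)$ is required to be regular, i.e. invertible onto its image with nonvanishing Jacobian determinant. Under a coordinate transformation $x\mapsto x'$ the components of an affine connection change by (summation over repeated indices) $$\Gamma'^h_{ij}(x')=\left(\Gamma^\gamma_{\alpha\beta}(x(x'))\,\frac{\partial x^\alpha}{\partial x'^i}\frac{\partial x^\beta}{\partial x'^j}+\frac{\partial^2 x^\gamma}{\partial x'^i\,\partial x'^j}\right)\frac{\partial x'^h}{\partial x^\gamma}.$$ A curve $x^h=x^h(\tau)$ is a geodesic of $\nabla$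 with natural (affine) parameter $\tau$ if $\frac{d^2x^h}{d\tau^2}+\Gamma^h_{ij}(x(\tau))\frac{dx^i}{d\tau}\frac{dx^j}{d\tau}=0$ for $h=1,\dots,n$. Coordinates $(U,x)$ are called pre-semigeodesic if one system of coordinate lines (here the $x^1$-lines $\tau\mapsto(\tau,a_2,\dots,a_n)$, with $a_2,\dots,a_n$ constant) consists of geodesics and the corresponding coordinate (here $x^1$) is their natural parameter; this is equivalent to $\Gamma^h_{11}(x)=0$ for $h=1,\dots,n$. *)

theory Defs
  imports "HOL-Analysis.Analysis"
begin

section \<open>Differentiability classes\<close>

datatype diff_class = C_fin nat | C_infty | C_omega

definition partial :: "'n::finite \<Rightarrow> (real^'n \<Rightarrow> real) \<Rightarrow> real^'n \<Rightarrow> real" where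
  "partial i f x = frechet_derivative f (at x) (axis i 1)"

text \<open>The notions below are meant for open sets \<open>S\<close>. Differentiability at every point forces
  the lower-order partial derivatives to be continuous, so only those of top order are
  explicitly required to be.\<close>

primrec Ck_on :: "nat \<Rightarrow> (real^'n::finite) set \<Rightarrow> (real^'n \<Rightarrow> real) \<Rightarrow> bool" where
  "Ck_on 0 S f \<longleftrightarrow> continuous_on S f"
| "Ck_on (Suc k) S f \<longleftrightarrow>
     (\<forall>x\<in>S. f differentiable (at x)) \<and> (\<forall>i. Ck_on k S (partial i f))"

text \<open>The sum ranges over all multi-indices \<open>\<alpha>\<close>; \<open>has_sum\<close> is unconditional, that is,
  absolute, convergence.\<close>

definition real_analytic_on :: "(real^'n::finite) set \<Rightarrow> (real^'n \<Rightarrow> real) \<Rightarrow> bool" where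
  "real_analytic_on S f \<longleftrightarrow>
     (\<forall>p\<in>S. \<exists>\<epsilon>>0. \<exists>a :: ('n \<Rightarrow> nat) \<Rightarrow> real. \<forall>x\<in>ball p \<epsilon>.
        ((\<lambda>\<alpha>. a \<alpha> * (\<Prod>i\<in>UNIV. (x $ i - p $ i) ^ \<alpha> i)) has_sum f x) UNIV)"

fun of_class :: "diff_class \<Rightarrow> (real^'n::finite) set \<Rightarrow> (real^'n \<Rightarrow> real) \<Rightarrow> bool" where
  "of_class (C_fin k) S f \<longleftrightarrow> Ck_on k S f"
| "of_class C_infty S f \<longleftrightarrow> (\<forall>k. Ck_on k S f)"
| "of_class C_omega S f \<longleftrightarrow> real_analytic_on S f"

fun class_at_least_2 :: "diff_class \<Rightarrow> bool" where
  "class_at_least_2 (C_fin k) \<longleftrightarrow> 2 \<le> k"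
| "class_at_least_2 C_infty \<longleftrightarrow> True"
| "class_at_least_2 C_omega \<longleftrightarrow> True"

fun class_minus_2 :: "diff_class \<Rightarrow> diff_class" where
  "class_minus_2 (C_fin k) = C_fin (k - 2)"
| "class_minus_2 C_infty = C_infty"
| "class_minus_2 C_omega = C_omega"


section \<open>Coordinate transformations, charts and manifolds\<close>

definition coord_transformation ::
    "diff_class \<Rightarrow> (real^'n::finite) set \<Rightarrow> (real^'n \<Rightarrow> real^'n) \<Rightarrow> bool" where
  "coord_transformation r S f \<longleftrightarrow>
     (\<forall>h. of_class r S (\<lambda>x. f x $ h)) \<and> inj_on f S \<and> (\<forall>x\<in>S. det (jacobian f (at x)) \<noteq> 0)"

text \<open>A chart is a pair of its domain and its coordinate map; the values of the map outside
  the domain are irrelevant.\<close>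

type_synonym ('m, 'n) chart = "'m set \<times> ('m \<Rightarrow> real^'n)"

definition is_chart :: "'m topology \<Rightarrow> ('m, 'n::finite) chart \<Rightarrow> bool" where
  "is_chart M c \<longleftrightarrow> (case c of (U, x) \<Rightarrow>
     openin M U \<and> open (x ` U) \<and>
     homeomorphic_map (subtopology M U) (top_of_set (x ` U)) x)"

definition transition :: "('m, 'n::finite) chart \<Rightarrow> ('m, 'n) chart \<Rightarrow> real^'n \<Rightarrow> real^'n" where
  "transition c c' = snd c' \<circ> inv_into (fst c) (snd c)"

definition compatible :: "('m, 'n::finite) chart \<Rightarrow> ('m, 'n) chart \<Rightarrow> bool" where
  "compatible c c' \<longleftrightarrow>
     coord_transformation (C_fin 2) (snd c ` (fst c \<inter> fst c')) (transition c c') \<and>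
     coord_transformation (C_fin 2) (snd c' ` (fst c \<inter> fst c')) (transition c' c)"

text \<open>Manifolds carry a maximal atlas of class \<open>C\<^sup>2\<close>, the least regularity for which the
  transformation law of connection components makes sense. It also contains the new
  coordinates obtained by transformations that are merely of some finite class \<open>C\<^sup>r\<close>, which the
  maximal \<open>C\<^sup>\<infinity>\<close> atlas of a smooth manifold need not do.\<close>

definition manifold :: "'m topology \<Rightarrow> ('m, 'n::finite) chart set \<Rightarrow> bool" where
  "manifold M \<A> \<longleftrightarrow>
     Hausdorff_space M \<and> second_countable M \<and>
     (\<forall>c\<in>\<A>. is_chart M c) \<and> \<Union>(fst ` \<A>) = topspace M \<and>
     (\<forall>c\<in>\<A>. \<forall>c'\<in>\<A>. compatible c c') \<and>
     (\<forall>c. is_chart M c \<and> (\<forall>c'\<in>\<A>. compatible c c') \<longrightarrow> c \<in> \<A>)"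


section \<open>Affine connections\<close>

text \<open>\<open>\<Gamma> h i j\<close> stands for \<open>\<Gamma>\<^sup>h\<^sub>i\<^sub>j\<close>, as a function of the coordinates.\<close>

type_synonym 'n components = "'n \<Rightarrow> 'n \<Rightarrow> 'n \<Rightarrow> real^'n \<Rightarrow> real"

text \<open>Here \<open>f\<close> is the coordinate change from \<open>x\<close> to \<open>x'\<close>, \<open>g\<close> is its inverse, and the result is
  evaluated at \<open>x' = y\<close>.\<close>

definition transform_components ::
    "(real^'n::finite \<Rightarrow> real^'n) \<Rightarrow> (real^'n \<Rightarrow> real^'n) \<Rightarrow> 'n components \<Rightarrow> 'n components" where
  "transform_components f g \<Gamma> h i j y =
     (\<Sum>\<gamma>\<in>UNIV.
        ((\<Sum>\<alpha>\<in>UNIV. \<Sum>\<beta>\<in>UNIV.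
            \<Gamma> \<gamma> \<alpha> \<beta> (g y) * partial i (\<lambda>z. g z $ \<alpha>) y * partial j (\<lambda>z. g z $ \<beta>) y)
          + partial i (partial j (\<lambda>z. g z $ \<gamma>)) y)
        * partial \<gamma> (\<lambda>z. f z $ h) (g y))"

text \<open>A connection assigns components to each chart of the atlas. No symmetry in the lower
  indices is required, so torsion is allowed.\<close>

definition affine_connection ::
    "('m, 'n::finite) chart set \<Rightarrow> (('m, 'n) chart \<Rightarrow> 'n components) \<Rightarrow> bool" where
  "affine_connection \<A> conn \<longleftrightarrow>
     (\<forall>c\<in>\<A>. \<forall>c'\<in>\<A>. \<forall>q\<in>fst c \<inter> fst c'. \<forall>h i j.
        conn c' h i j (snd c' q) =
          transform_components (transition c c') (transition c' c) (conn c) h i j (snd c' q))"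

definition geodesic :: "'n::finite components \<Rightarrow> real set \<Rightarrow> (real \<Rightarrow> real^'n) \<Rightarrow> bool" where
  "geodesic \<Gamma> T c \<longleftrightarrow>
     (\<exists>c' c''. \<forall>\<tau>\<in>T.
        (c has_vector_derivative c' \<tau>) (at \<tau>) \<and>
        (c' has_vector_derivative c'' \<tau>) (at \<tau>) \<and>
        (\<forall>h. c'' \<tau> $ h + (\<Sum>i\<in>UNIV. \<Sum>j\<in>UNIV. \<Gamma> h i j (c \<tau>) * c' \<tau> $ i * c' \<tau> $ j) = 0))"

text \<open>Here \<open>e\<close> is the index of the distinguished coordinate, and \<open>V\<close> is the open range of the
  coordinates.\<close>

definition pre_semigeodesic :: "'n::finite \<Rightarrow> (real^'n) set \<Rightarrow> 'n components \<Rightarrow> bool" where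
  "pre_semigeodesic e V \<Gamma> \<longleftrightarrow>
     (\<forall>a. let l = (\<lambda>\<tau>. \<chi> i. if i = e then \<tau> else a $ i) in geodesic \<Gamma> {\<tau>. l \<tau> \<in> V} l)"

end

theory Submission
  imports Defs
begin

text \<open>Write the coordinate change as \<open>x = g(y)\<close> with inverse \<open>y = f(x)\<close>. In the transformation law
  the bracket of \<open>\<Gamma>'\<^sup>h\<^sub>1\<^sub>1\<close> is \<open>\<Gamma>\<^sup>c\<^sub>a\<^sub>b(g) \<partial>\<^sub>1g\<^sup>a \<partial>\<^sub>1g\<^sup>b + \<partial>\<^sub>1\<partial>\<^sub>1g\<^sup>c\<close>, so \<open>\<Gamma>'\<^sup>h\<^sub>1\<^sub>1\<close> vanishes as soon as
  every curve \<open>t \<mapsto> g(t, y\<^sub>2, \<dots>, y\<^sub>n)\<close> is a geodesic with parameter \<open>t\<close>. Hence one shoots geodesics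
  off a coordinate hyperplane through the given point \<open>q\<close>, with initial velocity the first unit
  vector \<open>e\<close>. If \<open>I\<close> denotes integration in the first coordinate from \<open>0\<close> and \<open>w\<close> is the
  acceleration, then \<open>g(y) = q + y + IIw\<close>, the velocity is \<open>e + Iw\<close>, and the geodesic equation is the
  fixed point equation \<open>w = - \<Gamma>(q + y + IIw)(e + Iw, e + Iw)\<close>. The Jacobian matrix of \<open>g\<close> at the
  origin is the identity, so \<open>g\<close> has a local inverse \<open>f\<close>. Both maps are of class \<open>C\<^sup>r\<close>; the
  transformation law contains second derivatives of \<open>g\<close>, which is where two orders of
  differentiability are lost. The new chart belongs to the atlas because the atlas is maximal
  and \<open>f\<close> and \<open>g\<close> are at least \<open>C\<^sup>2\<close>.

  The substance is that \<open>g\<close> is as regular as \<open>\<Gamma>\<close>. On a small cube the right-hand side of the fixed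
  point equation is a contraction for every norm in which products, the operator \<open>I\<close> and
  substitution into \<open>\<Gamma>\<close> behave as expected (locale \<open>geodesic_contraction\<close>). Two norms are used.

  With the weighted \<open>l\<^sup>1\<close> norm of Taylor coefficients (\<open>analytic_norm_le\<close>) the fixed point is
  itself a power series, which settles the class \<open>C\<^sup>\<omega>\<close> (\<open>analytic_geodesic_acceleration\<close>). The inverse
  map solves the equation \<open>f(q + z) = z - (IIw)(f(q + z))\<close> and is analytic by a second contraction
  in the same norm (\<open>analytic_local_inverse\<close>).

  With the supremum norm the Picard iterates converge uniformly. Differentiating the iteration
  shows that the partial derivatives of the next iterate depend affinely on those of the present
  one, with the contraction factor that the iteration itself has. Therefore the derivatives of all
  orders up to \<open>k\<close> converge as well if \<open>\<Gamma>\<close> is \<open>C\<^sup>k\<close> (\<open>affine_recursion_Ck_convergent\<close>,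
  \<open>picard_Ck_convergent\<close>), on a cube whose size depends on \<open>\<Gamma>\<close> and its first derivatives only. So the
  same cube serves all \<open>k\<close>, which yields the class \<open>C\<^sup>\<infinity>\<close>. Here \<open>f\<close> inherits its regularity from \<open>g\<close>
  through Cramer's rule for the inverse Jacobian matrix (\<open>Ck_on_inverse_function\<close>).\<close>

section \<open>Partial derivatives\<close>

lemma partial_cong:
  assumes "open S" "x \<in> S" "\<And>z. z \<in> S \<Longrightarrow> f z = g z"
  shows "partial i f x = partial i g x"
proof -
  have "(f has_derivative D) (at x) \<longleftrightarrow> (g has_derivative D) (at x)" for D
    using has_derivative_transform_within_open[of f D x UNIV S g]
      has_derivative_transform_within_open[of g D x UNIV S f] assms by fastforce
  then show ?thesis
    by (simp add: partial_def frechet_derivative_def)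
qed

lemma partial_eqI: "(f has_derivative D) (at x) \<Longrightarrow> partial i f x = D (axis i 1)"
  by (metis frechet_derivative_at partial_def)

text \<open>Partial derivatives determine the total derivative: a linear functional is known on the unit
  vectors.\<close>

lemma linear_sum_axis:
  fixes D :: "real^'n::finite \<Rightarrow> real"
  assumes "linear D"
  shows "D h = (\<Sum>i\<in>UNIV. D (axis i 1) * h $ i)"
proof -
  have "D h = D (\<Sum>i\<in>UNIV. h $ i *\<^sub>R axis i 1)"
    by (simp flip: scalar_mult_eq_scaleR add: basis_expansion)
  also have "\<dots> = (\<Sum>i\<in>UNIV. D (axis i 1) * h $ i)"
    by (simp add: linear_sum[OF assms] linear_scale[OF assms] mult.commute)
  finally show ?thesis .
qed

lemma has_derivative_partials:
  fixes f :: "real^'n::finite \<Rightarrow> real"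
  assumes "f differentiable (at x)"
  shows "(f has_derivative (\<lambda>h. \<Sum>i\<in>UNIV. partial i f x * h $ i)) (at x)"
proof -
  have D: "(f has_derivative frechet_derivative f (at x)) (at x)"
    using assms frechet_derivative_works by blast
  have "frechet_derivative f (at x) = (\<lambda>h. \<Sum>i\<in>UNIV. partial i f x * h $ i)"
    using linear_sum_axis[OF has_derivative_linear[OF D]] unfolding partial_def by blast
  with D show ?thesis by simp
qed

lemma partial_const [simp]: "partial i (\<lambda>_. c) x = 0"
  by (rule partial_eqI[OF has_derivative_const, THEN trans]) simp

lemma has_derivative_nth: "((\<lambda>z::real^'n. z $ a) has_derivative (\<lambda>h. h $ a)) (at x)"
  by (rule bounded_linear_imp_has_derivative) (rule bounded_linear_vec_nth)

lemma partial_nth: "partial i (\<lambda>z. z $ a) x = (if i = a then 1 else 0)"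
  by (rule partial_eqI[OF has_derivative_nth, THEN trans]) (simp add: axis_def)

lemma partial_add:
  assumes "f differentiable (at x)" "g differentiable (at x)"
  shows "partial i (\<lambda>z. f z + g z) x = partial i f x + partial i g x"
  by (rule partial_eqI[OF has_derivative_add, THEN trans])
     (use assms frechet_derivative_works in \<open>auto simp: partial_def\<close>)

lemma partial_mult:
  assumes "f differentiable (at x)" "g differentiable (at x)"
  shows "partial i (\<lambda>z. f z * g z) x = f x * partial i g x + partial i f x * g x"
  by (rule partial_eqI[OF has_derivative_mult, THEN trans])
     (use assms frechet_derivative_works in \<open>auto simp: partial_def\<close>)

lemma partial_sum:
  assumes "\<And>a. a \<in> A \<Longrightarrow> f a differentiable (at x)"
  shows "partial i (\<lambda>z. \<Sum>a\<in>A. f a z) x = (\<Sum>a\<in>A. partial i (f a) x)"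
proof -
  have "((\<lambda>z. \<Sum>a\<in>A. f a z) has_derivative (\<lambda>h. \<Sum>a\<in>A. frechet_derivative (f a) (at x) h)) (at x)"
    by (rule has_derivative_sum) (use assms frechet_derivative_works in blast)
  from partial_eqI[OF this] show ?thesis by (simp add: partial_def)
qed

lemma partial_const_add: "partial i (\<lambda>z. c + f z) x = partial i f x"
proof -
  have "((\<lambda>z. c + f z) has_derivative D) (at x) \<longleftrightarrow> (f has_derivative D) (at x)" for D
  proof
    assume "((\<lambda>z. c + f z) has_derivative D) (at x)"
    from has_derivative_add[OF has_derivative_const[of "-c"] this]
    show "(f has_derivative D) (at x)" by simp
  next
    assume "(f has_derivative D) (at x)"
    from has_derivative_add[OF has_derivative_const[of c] this]
    show "((\<lambda>z. c + f z) has_derivative D) (at x)" by simp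
  qed
  then show ?thesis by (simp add: partial_def frechet_derivative_def)
qed

lemma has_derivative_translate:
  "((\<lambda>z. f (p + z)) has_derivative D) (at x) \<longleftrightarrow> (f has_derivative D) (at (p + x))"
proof
  have "((\<lambda>y. y - p) has_derivative (\<lambda>h. h)) (at (p + x))"
    by (auto intro!: derivative_eq_intros)
  moreover assume "((\<lambda>z. f (p + z)) has_derivative D) (at x)"
  then have "((\<lambda>z. f (p + z)) has_derivative D) (at (p + x - p))" by simp
  ultimately have "((\<lambda>y. f (p + (y - p))) has_derivative (\<lambda>h. D h)) (at (p + x))"
    by (rule has_derivative_compose[where f = "\<lambda>y. y - p" and g = "\<lambda>z. f (p + z)"])
  then show "(f has_derivative D) (at (p + x))" by simp
next
  have "((\<lambda>z. p + z) has_derivative (\<lambda>h. h)) (at x)"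
    by (auto intro!: derivative_eq_intros)
  moreover assume "(f has_derivative D) (at (p + x))"
  ultimately have "((\<lambda>z. f (p + z)) has_derivative (\<lambda>h. D h)) (at x)"
    by (rule has_derivative_compose[where f = "\<lambda>z. p + z" and g = f])
  then show "((\<lambda>z. f (p + z)) has_derivative D) (at x)" by simp
qed

lemma partial_translate: "partial i (\<lambda>z. f (p + z)) x = partial i f (p + x)"
  by (simp add: partial_def frechet_derivative_def has_derivative_translate)

lemma has_derivative_vec_components:
  fixes g :: "real^'a::finite \<Rightarrow> real^'b::finite"
  assumes "\<And>a. (\<lambda>z. g z $ a) differentiable (at x)"
  shows "(g has_derivative (\<lambda>h. \<chi> a. \<Sum>i\<in>UNIV. partial i (\<lambda>z. g z $ a) x * h $ i)) (at x)"
proof (subst has_derivative_componentwise_within, intro ballI)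
  fix b :: "real^'b" assume "b \<in> Basis"
  then obtain a where b: "b = axis a 1"
    by (auto simp: Basis_vec_def)
  show "((\<lambda>z. g z \<bullet> b) has_derivative (\<lambda>h. (\<chi> a. \<Sum>i\<in>UNIV. partial i (\<lambda>z. g z $ a) x * h $ i) \<bullet> b)) (at x)"
    using has_derivative_partials[OF assms, of a] by (simp add: b inner_axis)
qed

lemma differentiable_components:
  fixes f :: "real^'a::finite \<Rightarrow> real^'b::finite"
  assumes "\<And>a. (\<lambda>x. f x $ a) differentiable (at x)"
  shows "f differentiable (at x)"
  using has_derivative_vec_components[OF assms] unfolding differentiable_def by blast

lemma has_derivative_comp_partials:
  fixes g :: "real^'a::finite \<Rightarrow> real^'b::finite" and F :: "real^'b \<Rightarrow> real"
  assumes "F differentiable (at (g x))" "\<And>a. (\<lambda>z. g z $ a) differentiable (at x)"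
  shows "((\<lambda>z. F (g z)) has_derivative
           (\<lambda>h. \<Sum>a\<in>UNIV. partial a F (g x) * (\<Sum>i\<in>UNIV. partial i (\<lambda>z. g z $ a) x * h $ i))) (at x)"
  using has_derivative_compose[OF has_derivative_vec_components[OF assms(2)] has_derivative_partials[OF assms(1)]]
  by simp

lemma partial_chain:
  fixes g :: "real^'a::finite \<Rightarrow> real^'b::finite" and F :: "real^'b \<Rightarrow> real"
  assumes "F differentiable (at (g x))" "\<And>a. (\<lambda>z. g z $ a) differentiable (at x)"
  shows "partial i (\<lambda>z. F (g z)) x = (\<Sum>a\<in>UNIV. partial a F (g x) * partial i (\<lambda>z. g z $ a) x)"
  by (rule partial_eqI[OF has_derivative_comp_partials[OF assms], THEN trans])
     (simp add: axis_def if_distrib cong: if_cong)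

section \<open>Sequences that converge together with their derivatives\<close>

text \<open>Continuous convergence: \<open>f\<^sub>m(y) \<longlongrightarrow> l(x)\<close> as \<open>m \<longlongrightarrow> \<infinity>\<close> and \<open>y \<longlongrightarrow> x\<close> simultaneously. On open subsets of
  Euclidean space this is locally uniform convergence to a continuous limit. In this form sums,
  products and compositions are instances of the usual limit theorems.\<close>

definition converges_continuously ::
    "'a::topological_space set \<Rightarrow> (nat \<Rightarrow> 'a \<Rightarrow> 'b::topological_space) \<Rightarrow> ('a \<Rightarrow> 'b) \<Rightarrow> bool" where
  "converges_continuously S f l \<longleftrightarrow>
     (\<forall>x\<in>S. ((\<lambda>(m, y). f m y) \<longlongrightarrow> l x) (sequentially \<times>\<^sub>F nhds x))"

text \<open>The same recursion as for \<open>Ck_on\<close>, so that a constant sequence is \<open>Ck_convergent\<close> if and only if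
  its member is of class \<open>C\<^sup>k\<close> (\<open>Ck_convergent_const_iff\<close>). Closure properties of the classes \<open>C\<^sup>k\<close>
  are thereby the special case of constant sequences.\<close>

primrec Ck_convergent :: "nat \<Rightarrow> (real^'n::finite) set \<Rightarrow> (nat \<Rightarrow> real^'n \<Rightarrow> real) \<Rightarrow> bool" where
  "Ck_convergent 0 S f \<longleftrightarrow>
     (\<forall>m. continuous_on S (f m)) \<and> (\<exists>l. converges_continuously S f l)"
| "Ck_convergent (Suc k) S f \<longleftrightarrow>
     (\<forall>m. \<forall>x\<in>S. f m differentiable (at x)) \<and> (\<exists>l. converges_continuously S f l) \<and>
     (\<forall>i. Ck_convergent k S (\<lambda>m. partial i (f m)))"

lemma converges_continuously_tendsto:
  assumes "converges_continuously S f l" "x \<in> S"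
  shows "(\<lambda>m. f m x) \<longlonglongrightarrow> l x"
proof -
  have "filterlim (\<lambda>m. (m, x)) (sequentially \<times>\<^sub>F nhds x) sequentially"
    by (intro filterlim_Pair filterlim_ident tendsto_const)
  moreover have "((\<lambda>(m, y). f m y) \<longlongrightarrow> l x) (sequentially \<times>\<^sub>F nhds x)"
    using assms unfolding converges_continuously_def by blast
  ultimately have "((\<lambda>m. case (m, x) of (m, y) \<Rightarrow> f m y) \<longlongrightarrow> l x) sequentially"
    by (rule filterlim_compose[rotated])
  then show ?thesis by simp
qed

lemma converges_continuouslyD:
  fixes f :: "nat \<Rightarrow> 'a::topological_space \<Rightarrow> real"
  assumes "converges_continuously S f l" "x \<in> S" "e > 0"
  obtains N U where "open U" "x \<in> U" "\<And>m y. m \<ge> N \<Longrightarrow> y \<in> U \<Longrightarrow> \<bar>f m y - l x\<bar> < e"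
proof -
  have "eventually (\<lambda>(m, y). dist (f m y) (l x) < e) (sequentially \<times>\<^sub>F nhds x)"
    using tendstoD[OF assms(1)[unfolded converges_continuously_def, rule_format, OF assms(2)] assms(3)]
    by (simp add: case_prod_unfold)
  then obtain P Q where P: "eventually P sequentially" and Q: "eventually Q (nhds x)"
    and PQ: "\<And>m y. P m \<Longrightarrow> Q y \<Longrightarrow> dist (f m y) (l x) < e"
    unfolding eventually_prod_filter by auto
  obtain N where "\<And>m. m \<ge> N \<Longrightarrow> P m"
    using P unfolding eventually_sequentially by blast
  moreover obtain U where "open U" "x \<in> U" "\<And>y. y \<in> U \<Longrightarrow> Q y"
    using Q unfolding eventually_nhds by blast
  ultimately show ?thesis
    using PQ that by (metis dist_real_def)
qed

lemma converges_continuously_limit_close: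
  fixes f :: "nat \<Rightarrow> 'a::topological_space \<Rightarrow> real"
  assumes c: "converges_continuously S f l" and "y \<in> S" "\<And>m. m \<ge> N \<Longrightarrow> \<bar>f m y - a\<bar> < e"
  shows "\<bar>l y - a\<bar> \<le> e"
proof -
  have "(\<lambda>m. \<bar>f m y - a\<bar>) \<longlonglongrightarrow> \<bar>l y - a\<bar>"
    using converges_continuously_tendsto[OF c \<open>y \<in> S\<close>] by (intro tendsto_intros)
  then show ?thesis
    by (rule LIMSEQ_le_const2) (use assms(3) in force)
qed

text \<open>Continuous convergence gives, near each point, an index from which on all values are close to
  the limit there; finitely many of these neighbourhoods cover a compact set.\<close>

lemma converges_continuously_uniform_on_compact:
  fixes f :: "nat \<Rightarrow> 'a::topological_space \<Rightarrow> real"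
  assumes c: "converges_continuously S f l" and K: "compact K" "K \<subseteq> S"
  shows "uniform_limit K f l sequentially"
  unfolding uniform_limit_sequentially_iff
proof (intro allI impI)
  fix e :: real assume "e > 0"
  have "\<exists>U N. open U \<and> x \<in> U \<and> (\<forall>m\<ge>N. \<forall>y\<in>U. \<bar>f m y - l x\<bar> < e/2)" if "x \<in> K" for x
    using converges_continuouslyD[OF c, of x "e/2"] that K(2) \<open>e > 0\<close> by (metis half_gt_zero subsetD)
  then obtain U N where UN: "\<And>x. x \<in> K \<Longrightarrow> open (U x)" "\<And>x. x \<in> K \<Longrightarrow> x \<in> U x"
      "\<And>x m y. x \<in> K \<Longrightarrow> m \<ge> N x \<Longrightarrow> y \<in> U x \<Longrightarrow> \<bar>f m y - l x\<bar> < e/2"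
    by metis
  obtain T where T: "T \<subseteq> K" "finite T" "K \<subseteq> (\<Union>x\<in>T. U x)"
    using compactE_image[OF K(1), of K U] UN(1,2) by (metis UN_I subsetI)
  have "dist (f m y) (l y) < e" if "m \<ge> Max (N ` T)" "y \<in> K" for m y
  proof -
    obtain x where x: "x \<in> T" "y \<in> U x"
      using T(3) \<open>y \<in> K\<close> by blast
    then have "x \<in> K" "N x \<le> m"
      using T that(1) order_trans[OF Max_ge[of "N ` T" "N x"] that(1)] by auto
    then have "\<bar>f m y - l x\<bar> < e/2" "\<bar>l y - l x\<bar> \<le> e/2"
      using UN(3)[OF \<open>x \<in> K\<close> _ x(2)] K(2) \<open>y \<in> K\<close>
        converges_continuously_limit_close[OF c, of y "N x" "l x" "e/2"] by blast+
    then show ?thesis unfolding dist_real_def by argo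
  qed
  then show "\<exists>N. \<forall>n\<ge>N. \<forall>x\<in>K. dist (f n x) (l x) < e" by blast
qed

lemma converges_continuously_continuous_on:
  fixes f :: "nat \<Rightarrow> 'a::topological_space \<Rightarrow> real"
  assumes c: "converges_continuously S f l"
  shows "continuous_on S l"
  unfolding continuous_on_def
proof (intro ballI tendstoI)
  fix x and e :: real assume "x \<in> S" "e > 0"
  obtain N U where UN: "open U" "x \<in> U" "\<And>m y. m \<ge> N \<Longrightarrow> y \<in> U \<Longrightarrow> \<bar>f m y - l x\<bar> < e/2"
    using converges_continuouslyD[OF c \<open>x \<in> S\<close> half_gt_zero[OF \<open>e > 0\<close>]] by metis
  have "\<bar>l y - l x\<bar> \<le> e/2" if "y \<in> U" "y \<in> S" for y
    by (rule converges_continuously_limit_close[OF c, where N = N]) (use that UN(3) in auto)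
  then show "eventually (\<lambda>y. dist (l y) (l x) < e) (at x within S)"
    unfolding eventually_at_topological using UN(1,2) \<open>e > 0\<close>
    by (intro exI[of _ U]) (force simp: dist_real_def)
qed

text \<open>The converse: locally uniform convergence of continuous functions is continuous convergence.\<close>

lemma converges_continuouslyI:
  fixes f :: "nat \<Rightarrow> 'a::topological_space \<Rightarrow> real"
  assumes "\<And>m. continuous_on S (f m)"
    and "\<And>x. x \<in> S \<Longrightarrow> \<exists>U. open U \<and> x \<in> U \<and> U \<subseteq> S \<and> uniform_limit U f l sequentially"
  shows "converges_continuously S f l"
  unfolding converges_continuously_def
proof (intro ballI tendstoI)
  fix x and e :: real assume "x \<in> S" "e > 0"
  obtain U where U: "open U" "x \<in> U" "U \<subseteq> S" and u: "uniform_limit U f l sequentially"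
    using assms(2)[OF \<open>x \<in> S\<close>] by blast
  have "continuous_on U l"
    by (rule uniform_limit_theorem[OF _ u])
       (auto intro!: always_eventually continuous_on_subset[OF assms(1) U(3)])
  then have "eventually (\<lambda>y. dist (l y) (l x) < e/2) (at x within U)"
    using U(2) half_gt_zero[OF \<open>e > 0\<close>] unfolding continuous_on_def by (blast intro: tendstoD)
  then have "eventually (\<lambda>y. y \<in> U \<and> dist (l y) (l x) < e/2) (nhds x)"
    using U(1,2) \<open>e > 0\<close> unfolding at_within_open[OF U(2,1)] eventually_at_filter
    by (auto elim!: eventually_elim2 intro!: eventually_nhds_in_open)
  moreover have "eventually (\<lambda>m. \<forall>y\<in>U. dist (f m y) (l y) < e/2) sequentially"
    using uniform_limitD[OF u half_gt_zero[OF \<open>e > 0\<close>]] .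
  ultimately have "eventually (\<lambda>p. (\<forall>y\<in>U. dist (f (fst p) y) (l y) < e/2) \<and>
      snd p \<in> U \<and> dist (l (snd p)) (l x) < e/2) (sequentially \<times>\<^sub>F nhds x)"
    by (intro eventually_conj eventually_compose_filterlim[OF _ filterlim_fst]
        eventually_compose_filterlim[OF _ filterlim_snd]) (auto elim: eventually_mono)
  then show "eventually (\<lambda>p. dist (case p of (m, y) \<Rightarrow> f m y) (l x) < e) (sequentially \<times>\<^sub>F nhds x)"
  proof (rule eventually_mono, clarsimp)
    fix m y
    assume "\<forall>y\<in>U. dist (f m y) (l y) * 2 < e" "y \<in> U" "dist (l y) (l x) * 2 < e"
    then show "dist (f m y) (l x) < e"
      using dist_triangle[of "f m y" "l x" "l y"] by fastforce
  qed
qed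

lemma converges_continuously_cong:
  assumes "open S" "\<And>m x. x \<in> S \<Longrightarrow> f m x = g m x" "\<And>x. x \<in> S \<Longrightarrow> l x = l' x"
  shows "converges_continuously S f l = converges_continuously S g l'"
  unfolding converges_continuously_def
proof (intro ball_cong refl filterlim_cong)
  fix x assume "x \<in> S"
  show "nhds (l x) = nhds (l' x)" using assms(3) \<open>x \<in> S\<close> by simp
  have "eventually (\<lambda>y. y \<in> S) (nhds x)"
    using assms(1) \<open>x \<in> S\<close> eventually_nhds_in_open by blast
  then have "eventually (\<lambda>p. snd p \<in> S) (sequentially \<times>\<^sub>F nhds x)"
    unfolding eventually_prod_filter by (intro exI[of _ "\<lambda>_. True"] exI[of _ "\<lambda>y. y \<in> S"]) auto
  then show "eventually (\<lambda>p. (case p of (m, y) \<Rightarrow> f m y) = (case p of (m, y) \<Rightarrow> g m y)) (sequentially \<times>\<^sub>F nhds x)"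
    by (rule eventually_mono) (auto simp: assms(2))
qed

lemma converges_continuously_const:
  assumes "open S" "continuous_on S f"
  shows "converges_continuously S (\<lambda>_. f) f"
  unfolding converges_continuously_def
proof
  fix x assume "x \<in> S"
  have "(f \<longlongrightarrow> f x) (nhds x)"
    using assms \<open>x \<in> S\<close> by (metis at_within_open continuous_on_def tendsto_at_iff_tendsto_nhds)
  then have "((\<lambda>p. f (snd p)) \<longlongrightarrow> f x) (sequentially \<times>\<^sub>F nhds x)"
    by (rule filterlim_compose) (rule filterlim_snd)
  then show "((\<lambda>(m, y). f y) \<longlongrightarrow> f x) (sequentially \<times>\<^sub>F nhds x)"
    by (simp add: case_prod_unfold)
qed

lemma converges_continuously_add:
  fixes f :: "nat \<Rightarrow> 'a::topological_space \<Rightarrow> real"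
  assumes "converges_continuously S f l" "converges_continuously S g l'"
  shows "converges_continuously S (\<lambda>m x. f m x + g m x) (\<lambda>x. l x + l' x)"
  using assms tendsto_add unfolding converges_continuously_def case_prod_unfold by blast

lemma converges_continuously_mult:
  fixes f :: "nat \<Rightarrow> 'a::topological_space \<Rightarrow> real"
  assumes "converges_continuously S f l" "converges_continuously S g l'"
  shows "converges_continuously S (\<lambda>m x. f m x * g m x) (\<lambda>x. l x * l' x)"
  using assms tendsto_mult unfolding converges_continuously_def case_prod_unfold by blast

lemma converges_continuously_compose:
  fixes F :: "real^'b::finite \<Rightarrow> real"
  assumes "open V" "continuous_on V F"
    and "\<And>a. converges_continuously S (\<lambda>m y. g m y $ a) (\<lambda>y. l y $ a)" "\<And>y. y \<in> S \<Longrightarrow> l y \<in> V"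
  shows "converges_continuously S (\<lambda>m y. F (g m y)) (\<lambda>y. F (l y))"
  unfolding converges_continuously_def
proof
  fix x assume "x \<in> S"
  have F: "(F \<longlongrightarrow> F (l x)) (nhds (l x))"
    using assms(1,2,4) \<open>x \<in> S\<close>
    by (metis at_within_open continuous_on_def tendsto_at_iff_tendsto_nhds)
  have "((\<lambda>(m, y). g m y) \<longlongrightarrow> l x) (sequentially \<times>\<^sub>F nhds x)"
    using assms(3) \<open>x \<in> S\<close> unfolding converges_continuously_def case_prod_unfold
    by (intro vec_tendstoI) blast
  then show "((\<lambda>(m, y). F (g m y)) \<longlongrightarrow> F (l x)) (sequentially \<times>\<^sub>F nhds x)"
    using filterlim_compose[OF F] by (simp add: case_prod_unfold)
qed

lemma Ck_convergent_limit:
  assumes "Ck_convergent k S f"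
  obtains l where "converges_continuously S f l"
  using assms by (cases k) auto

lemma Ck_convergent_continuous:
  assumes "Ck_convergent k S f"
  shows "continuous_on S (f m)"
  using assms
  by (cases k) (auto intro!: continuous_at_imp_continuous_on differentiable_imp_continuous_within)

lemma Ck_convergent_SucD: "Ck_convergent (Suc k) S f \<Longrightarrow> Ck_convergent k S f"
proof (induction k arbitrary: f)
  case 0
  then show ?case using Ck_convergent_continuous[OF 0] by simp
qed auto

lemma Ck_convergent_mono: "Ck_convergent k S f \<Longrightarrow> j \<le> k \<Longrightarrow> Ck_convergent j S f"
  by (induction k) (auto simp: le_Suc_eq dest: Ck_convergent_SucD simp del: Ck_convergent.simps)

lemma Ck_convergent_cong:
  assumes "open S" "\<And>m x. x \<in> S \<Longrightarrow> f m x = g m x"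
  shows "Ck_convergent k S f = Ck_convergent k S g"
  using assms(2)
proof (induction k arbitrary: f g)
  case 0
  have "converges_continuously S f l = converges_continuously S g l" for l
    by (rule converges_continuously_cong) (use assms(1) 0 in auto)
  moreover have "continuous_on S (f m) = continuous_on S (g m)" for m
    by (rule continuous_on_cong) (use 0 in auto)
  ultimately show ?case by simp
next
  case (Suc k)
  have "converges_continuously S f l = converges_continuously S g l" for l
    by (rule converges_continuously_cong) (use assms(1) Suc.prems in auto)
  moreover have "f m differentiable (at x) \<longleftrightarrow> g m differentiable (at x)" if "x \<in> S" for m x
    using has_derivative_transform_within_open[OF _ assms(1) that, of "f m" _ UNIV "g m"]
      has_derivative_transform_within_open[OF _ assms(1) that, of "g m" _ UNIV "f m"] Suc.prems
    unfolding differentiable_def by metis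
  moreover have "Ck_convergent k S (\<lambda>m. partial i (f m)) = Ck_convergent k S (\<lambda>m. partial i (g m))" for i
    by (rule Suc.IH) (use partial_cong[OF assms(1)] Suc.prems in blast)
  ultimately show ?case by simp
qed

lemma Ck_convergent_const_iff:
  assumes "open S"
  shows "Ck_convergent k S (\<lambda>_. f) = Ck_on k S f"
proof (induction k arbitrary: f)
  case 0
  then show ?case using converges_continuously_const[OF assms] by auto
next
  case (Suc k)
  have "\<exists>l. converges_continuously S (\<lambda>_. f) l" if "\<forall>x\<in>S. f differentiable (at x)"
    using converges_continuously_const[OF assms, of f] that
    by (blast intro: continuous_at_imp_continuous_on differentiable_imp_continuous_within)
  then show ?case using Suc by auto
qed

lemma Ck_convergent_imp_Ck_on: "Ck_convergent k S f \<Longrightarrow> Ck_on k S (f m)"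
  by (induction k arbitrary: f) auto

lemma Ck_on_cong:
  assumes "open S" "\<And>x. x \<in> S \<Longrightarrow> f x = g x"
  shows "Ck_on k S f = Ck_on k S g"
  using Ck_convergent_cong[of S "\<lambda>_. f" "\<lambda>_. g" k] assms by (simp add: Ck_convergent_const_iff)

lemma Ck_on_const [simp]:
  fixes S :: "(real^'n::finite) set"
  shows "Ck_on k S (\<lambda>_. c)"
proof (induction k arbitrary: c)
  case (Suc k)
  have "partial i (\<lambda>_::real^'n. c) = (\<lambda>_. 0)" for i by (simp add: fun_eq_iff)
  then show ?case using Suc by simp
qed simp

lemma Ck_on_nth [simp]: "Ck_on k S (\<lambda>x. x $ a)"
proof (cases k)
  case 0
  then show ?thesis by (simp add: continuous_on_component)
next
  case (Suc j)
  have "partial i (\<lambda>x. x $ a) = (\<lambda>_. if i = a then 1 else 0)" for i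
    by (simp add: fun_eq_iff partial_nth)
  then show ?thesis using Suc has_derivative_nth by (auto simp: differentiable_def)
qed

lemma Ck_convergent_add:
  assumes "open S" "Ck_convergent k S f" "Ck_convergent k S g"
  shows "Ck_convergent k S (\<lambda>m x. f m x + g m x)"
  using assms(2,3)
proof (induction k arbitrary: f g)
  case 0
  then show ?case by (auto intro!: continuous_intros converges_continuously_add)
next
  case (Suc k)
  have "Ck_convergent k S (\<lambda>m. partial i (\<lambda>x. f m x + g m x)) =
        Ck_convergent k S (\<lambda>m x. partial i (f m) x + partial i (g m) x)" for i
    by (rule Ck_convergent_cong) (use assms(1) Suc.prems in \<open>auto intro!: partial_add\<close>)
  then show ?case
    using Suc by (auto intro!: derivative_intros converges_continuously_add)
qed

lemma Ck_convergent_mult: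
  assumes "open S" "Ck_convergent k S f" "Ck_convergent k S g"
  shows "Ck_convergent k S (\<lambda>m x. f m x * g m x)"
  using assms(2,3)
proof (induction k arbitrary: f g)
  case 0
  then show ?case by (auto intro!: continuous_intros converges_continuously_mult)
next
  case (Suc k)
  have "Ck_convergent k S (\<lambda>m x. f m x * partial i (g m) x + partial i (f m) x * g m x)" for i
    using Suc.prems Ck_convergent_SucD by (auto intro!: Ck_convergent_add assms(1) Suc.IH)
  moreover have "Ck_convergent k S (\<lambda>m. partial i (\<lambda>x. f m x * g m x)) =
        Ck_convergent k S (\<lambda>m x. f m x * partial i (g m) x + partial i (f m) x * g m x)" for i
    by (rule Ck_convergent_cong) (use assms(1) Suc.prems in \<open>auto intro!: partial_mult\<close>)
  ultimately show ?case
    using Suc.prems by (auto intro!: derivative_intros converges_continuously_mult)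
qed

lemma Ck_convergent_const_seq: "open S \<Longrightarrow> Ck_on k S f \<Longrightarrow> Ck_convergent k S (\<lambda>_. f)"
  by (simp add: Ck_convergent_const_iff)

lemma Ck_convergent_sum:
  assumes "open S" "\<And>a. a \<in> A \<Longrightarrow> Ck_convergent k S (f a)"
  shows "Ck_convergent k S (\<lambda>m x. \<Sum>a\<in>A. f a m x)"
proof (cases "finite A")
  case True
  then show ?thesis using assms(2)
    by (induction A) (auto intro!: Ck_convergent_add Ck_convergent_const_seq assms(1))
qed (auto intro!: Ck_convergent_const_seq assms(1))

lemma converges_continuously_shift:
  fixes f :: "nat \<Rightarrow> 'a::topological_space \<Rightarrow> real"
  assumes l: "converges_continuously S (\<lambda>m. f (Suc m)) l"
  shows "converges_continuously S f l"
  unfolding converges_continuously_def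
proof (intro ballI tendstoI)
  fix x and \<epsilon> :: real assume "x \<in> S" "\<epsilon> > 0"
  obtain N U where U: "open U" "x \<in> U" "\<And>m y. m \<ge> N \<Longrightarrow> y \<in> U \<Longrightarrow> \<bar>f (Suc m) y - l x\<bar> < \<epsilon>"
    using converges_continuouslyD[OF l \<open>x \<in> S\<close> \<open>\<epsilon> > 0\<close>] by metis
  have "\<bar>f m y - l x\<bar> < \<epsilon>" if "m \<ge> Suc N" "y \<in> U" for m y
    using U(3)[of "m - 1" y] that by (cases m) auto
  moreover have "eventually (\<lambda>m. m \<ge> Suc N) sequentially" "eventually (\<lambda>y. y \<in> U) (nhds x)"
    using eventually_ge_at_top eventually_nhds_in_open[OF U(1,2)] by blast+
  ultimately have "\<forall>\<^sub>F p in sequentially \<times>\<^sub>F nhds x. \<bar>f (fst p) (snd p) - l x\<bar> < \<epsilon>"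
    unfolding eventually_prod_filter
    by (intro exI[of _ "\<lambda>m. m \<ge> Suc N"] exI[of _ "\<lambda>y. y \<in> U"]) auto
  then show "\<forall>\<^sub>F p in sequentially \<times>\<^sub>F nhds x. dist (case p of (m, y) \<Rightarrow> f m y) (l x) < \<epsilon>"
    by (simp add: case_prod_unfold dist_real_def)
qed

text \<open>Recursions describe the members with positive index only; this adjoins the initial one.\<close>

lemma Ck_convergent_shift:
  "Ck_convergent k S (\<lambda>m. f (Suc m)) \<Longrightarrow> Ck_on k S (f 0) \<Longrightarrow> Ck_convergent k S f"
proof (induction k arbitrary: f)
  case 0
  have "continuous_on S (f m)" for m
    using 0 by (cases m) auto
  moreover obtain l where "converges_continuously S (\<lambda>m. f (Suc m)) l"
    using 0(1) by auto
  ultimately show ?case using converges_continuously_shift[of S f l] by auto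
next
  case (Suc k)
  have "Ck_convergent k S (\<lambda>m. partial i (f m))" for i
    by (rule Suc.IH) (use Suc.prems in simp_all)
  moreover have "f m differentiable (at x)" if "x \<in> S" for m x
    using Suc.prems that by (cases m) auto
  moreover obtain l where "converges_continuously S (\<lambda>m. f (Suc m)) l"
    using Suc.prems(1) by auto
  ultimately show ?case using converges_continuously_shift[of S f l] by auto
qed

lemma Ck_convergent_uniformly_Cauchy:
  assumes "Ck_convergent k S f" "compact K" "K \<subseteq> S" "\<eta> > 0"
  shows "\<forall>\<^sub>F N in sequentially. \<forall>m\<ge>N. \<forall>m'\<ge>N. \<forall>z\<in>K. \<bar>f m z - f m' z\<bar> \<le> \<eta>"
proof -
  obtain l where "converges_continuously S f l"
    using Ck_convergent_limit[OF assms(1)] .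
  then have u: "uniform_limit K f l sequentially"
    by (rule converges_continuously_uniform_on_compact[OF _ assms(2,3)])
  obtain N where N: "\<And>m z. m \<ge> N \<Longrightarrow> z \<in> K \<Longrightarrow> dist (f m z) (l z) < \<eta> / 2"
    using uniform_limitD[OF u half_gt_zero[OF assms(4)]] unfolding eventually_sequentially by blast
  have "\<bar>f m z - f m' z\<bar> \<le> \<eta>" if "m \<ge> N" "m' \<ge> N" "z \<in> K" for m m' z
    using N[OF that(1,3)] N[OF that(2,3)] unfolding dist_real_def by argo
  then show ?thesis
    unfolding eventually_sequentially by (intro exI[of _ N]) (meson order_trans)
qed

text \<open>By the chain rule, the partial derivatives of the composition are sums of products of functions to which the
  induction hypothesis and \<open>Ck_convergent_mult\<close> apply. The limit of the inner functions has to
  stay in the domain of the outer one.\<close>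

lemma Ck_convergent_compose:
  fixes F :: "real^'b::finite \<Rightarrow> real" and g :: "nat \<Rightarrow> real^'a::finite \<Rightarrow> real^'b"
  assumes "open S" "open V" "Ck_on k V F"
    and "\<And>a. Ck_convergent k S (\<lambda>m y. g m y $ a)"
    and "\<And>a. converges_continuously S (\<lambda>m y. g m y $ a) (\<lambda>y. l y $ a)"
    and "\<And>y. y \<in> S \<Longrightarrow> l y \<in> V" "\<And>m y. y \<in> S \<Longrightarrow> g m y \<in> V"
  shows "Ck_convergent k S (\<lambda>m y. F (g m y))"
  using assms(3,4)
proof (induction k arbitrary: F)
  case 0
  have "continuous_on S (\<lambda>y. \<chi> a. g m y $ a)" for m
    by (rule continuous_on_vec_lambda) (use 0(2) in simp)
  then have cg: "continuous_on S (g m)" for m by simp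
  have "continuous_on S (\<lambda>y. F (g m y))" for m
    by (rule continuous_on_compose2[OF _ cg]) (use 0(1) assms(7) in auto)
  moreover have "converges_continuously S (\<lambda>m y. F (g m y)) (\<lambda>y. F (l y))"
    by (rule converges_continuously_compose[OF assms(2) _ assms(5,6)]) (use 0(1) in simp_all)
  ultimately show ?case by auto
next
  case (Suc k)
  have "continuous_on V F"
    using Suc.prems(1)
    by (auto intro: continuous_at_imp_continuous_on differentiable_imp_continuous_within)
  then have "converges_continuously S (\<lambda>m y. F (g m y)) (\<lambda>y. F (l y))"
    by (rule converges_continuously_compose[OF assms(2) _ assms(5,6)])
  moreover have "(\<lambda>y. F (g m y)) differentiable (at x)" if "x \<in> S" for m x
    using has_derivative_comp_partials[of F "g m" x] Suc.prems assms(7) that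
    by (auto simp: differentiable_def)
  moreover have "Ck_convergent k S (\<lambda>m. partial i (\<lambda>y. F (g m y)))" for i
  proof -
    have "Ck_convergent k S (\<lambda>m y. partial a F (g m y) * partial i (\<lambda>y. g m y $ a) y)" for a
    proof (rule Ck_convergent_mult[OF assms(1)])
      show "Ck_convergent k S (\<lambda>m y. partial a F (g m y))"
        by (rule Suc.IH) (use Suc.prems(1) Ck_convergent_SucD[OF Suc.prems(2)] in simp_all)
      show "Ck_convergent k S (\<lambda>m. partial i (\<lambda>y. g m y $ a))"
        using Suc.prems(2)[of a] by simp
    qed
    then have "Ck_convergent k S (\<lambda>m y. \<Sum>a\<in>UNIV. partial a F (g m y) * partial i (\<lambda>y. g m y $ a) y)"
      by (intro Ck_convergent_sum assms(1))
    moreover have "Ck_convergent k S (\<lambda>m. partial i (\<lambda>y. F (g m y))) =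
       Ck_convergent k S (\<lambda>m y. \<Sum>a\<in>UNIV. partial a F (g m y) * partial i (\<lambda>y. g m y $ a) y)"
      by (intro Ck_convergent_cong assms(1) partial_chain) (use Suc.prems assms(7) in auto)
    ultimately show ?thesis by simp
  qed
  ultimately show ?case by auto
qed

lemma abs_sum_mult_nth_le:
  fixes h :: "real^'n::finite"
  assumes "\<And>i. \<bar>c i\<bar> \<le> b"
  shows "\<bar>\<Sum>i\<in>UNIV. c i * h $ i\<bar> \<le> real CARD('n) * b * norm h"
proof -
  have "b \<ge> 0" using assms order_trans[OF abs_ge_zero] by blast
  have "\<bar>\<Sum>i\<in>UNIV. c i * h $ i\<bar> \<le> (\<Sum>i\<in>(UNIV::'n set). b * norm h)"
    by (intro order_trans[OF sum_abs] sum_mono)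
       (auto simp: abs_mult intro!: mult_mono assms component_le_norm_cart \<open>b \<ge> 0\<close>)
  then show ?thesis by simp
qed

text \<open>The theorem on termwise differentiation, applied on a ball around each point, and then to the
  partial derivatives in turn.\<close>

lemma Ck_on_limit:
  assumes "open S" "Ck_convergent k S f" "converges_continuously S f l"
  shows "Ck_on k S l"
  using assms(2,3)
proof (induction k arbitrary: f l)
  case 0
  then show ?case using converges_continuously_continuous_on by simp
next
  case (Suc k)
  have "\<exists>l. converges_continuously S (\<lambda>m. partial i (f m)) l" for i
  proof -
    have "Ck_convergent k S (\<lambda>m. partial i (f m))" using Suc.prems(1) by simp
    then show ?thesis using Ck_convergent_limit by metis
  qed
  then obtain l' where l': "\<And>i. converges_continuously S (\<lambda>m. partial i (f m)) (l' i)"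
    by metis
  have D: "(l has_derivative (\<lambda>h. \<Sum>i\<in>UNIV. l' i x * h $ i)) (at x)" if "x \<in> S" for x
  proof -
    obtain \<epsilon> where "\<epsilon> > 0" and \<epsilon>: "cball x \<epsilon> \<subseteq> S"
      using assms(1) \<open>x \<in> S\<close> open_contains_cball by blast
    have ball_S: "y \<in> S" if "y \<in> ball x \<epsilon>" for y
      using \<epsilon> that ball_subset_cball by blast
    have "\<exists>g. \<forall>y\<in>ball x \<epsilon>. (\<lambda>m. f m y) \<longlonglongrightarrow> g y \<and>
        (g has_derivative (\<lambda>h. \<Sum>i\<in>UNIV. l' i y * h $ i)) (at y within ball x \<epsilon>)"
    proof (rule has_derivative_sequence[where f' = "\<lambda>m y h. \<Sum>i\<in>UNIV. partial i (f m) y * h $ i"])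
      show "(f n has_derivative (\<lambda>h. \<Sum>i\<in>UNIV. partial i (f n) y * h $ i)) (at y within ball x \<epsilon>)"
        if "y \<in> ball x \<epsilon>" for n y
      proof -
        have "f n differentiable (at y)" using Suc.prems(1) ball_S[OF that] by simp
        then show ?thesis by (rule has_derivative_at_withinI[OF has_derivative_partials])
      qed
      show "(\<lambda>m. f m x) \<longlonglongrightarrow> l x"
        using converges_continuously_tendsto[OF Suc.prems(2) \<open>x \<in> S\<close>] .
      fix e :: real assume "e > 0"
      define N where "N = real CARD('a)"
      have "N > 0" by (simp add: N_def)
      have "\<forall>\<^sub>F n in sequentially. \<forall>i. \<forall>y\<in>cball x \<epsilon>. dist (partial i (f n) y) (l' i y) < e / N"
        by (intro eventually_all_finite
            uniform_limitD[OF converges_continuously_uniform_on_compact[OF l' compact_cball \<epsilon>]]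
            divide_pos_pos \<open>e > 0\<close> \<open>N > 0\<close>)
      then show "\<forall>\<^sub>F n in sequentially. \<forall>y\<in>ball x \<epsilon>. \<forall>h.
          norm ((\<Sum>i\<in>UNIV. partial i (f n) y * h $ i) - (\<Sum>i\<in>UNIV. l' i y * h $ i)) \<le> e * norm h"
      proof (rule eventually_mono, intro ballI allI)
        fix n y and h :: "real^'a"
        assume n: "\<forall>i. \<forall>y\<in>cball x \<epsilon>. dist (partial i (f n) y) (l' i y) < e / N" and y: "y \<in> ball x \<epsilon>"
        have "\<bar>\<Sum>i\<in>UNIV. (partial i (f n) y - l' i y) * h $ i\<bar> \<le> N * (e / N) * norm h"
          by (rule abs_sum_mult_nth_le[where 'n = 'a, folded N_def])
             (use n y in \<open>simp add: dist_real_def less_imp_le\<close>)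
        also have "\<dots> = e * norm h" using \<open>N > 0\<close> by simp
        finally show "norm ((\<Sum>i\<in>UNIV. partial i (f n) y * h $ i) - (\<Sum>i\<in>UNIV. l' i y * h $ i)) \<le> e * norm h"
          by (simp add: left_diff_distrib sum_subtractf)
      qed
    qed (use \<open>\<epsilon> > 0\<close> in auto)
    then obtain g where g: "\<And>y. y \<in> ball x \<epsilon> \<Longrightarrow> (\<lambda>m. f m y) \<longlonglongrightarrow> g y"
      and g': "\<And>y. y \<in> ball x \<epsilon> \<Longrightarrow> (g has_derivative (\<lambda>h. \<Sum>i\<in>UNIV. l' i y * h $ i)) (at y within ball x \<epsilon>)"
      by blast
    have "g y = l y" if "y \<in> ball x \<epsilon>" for y
      using LIMSEQ_unique[OF g[OF that] converges_continuously_tendsto[OF Suc.prems(2) ball_S[OF that]]] .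
    moreover have "(g has_derivative (\<lambda>h. \<Sum>i\<in>UNIV. l' i x * h $ i)) (at x)"
      using g'[of x] \<open>\<epsilon> > 0\<close> at_within_open[of x "ball x \<epsilon>"] by simp
    ultimately show ?thesis
      using has_derivative_transform_within_open[of g _ x UNIV "ball x \<epsilon>" l] \<open>\<epsilon> > 0\<close> by auto
  qed
  have "partial i l x = l' i x" if "x \<in> S" for i x
    using partial_eqI[OF D[OF that], of i] by (simp add: axis_def if_distrib cong: if_cong)
  then have "Ck_on k S (partial i l) = Ck_on k S (l' i)" for i
    by (intro Ck_on_cong assms(1)) auto
  moreover have "Ck_on k S (l' i)" for i
    by (rule Suc.IH[OF _ l']) (use Suc.prems(1) in simp)
  ultimately show ?case
    using D by (auto simp: differentiable_def)
qed

section \<open>Functions of class \<open>C\<^sup>k\<close>\<close>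

lemma Ck_on_imp_continuous_on: "Ck_on k S f \<Longrightarrow> continuous_on S f"
  by (cases k) (auto intro!: continuous_at_imp_continuous_on differentiable_imp_continuous_within)

lemma Ck_on_add: "open S \<Longrightarrow> Ck_on k S f \<Longrightarrow> Ck_on k S g \<Longrightarrow> Ck_on k S (\<lambda>x. f x + g x)"
  using Ck_convergent_add[of S k "\<lambda>_. f" "\<lambda>_. g"] by (simp add: Ck_convergent_const_iff)

lemma Ck_on_mult: "open S \<Longrightarrow> Ck_on k S f \<Longrightarrow> Ck_on k S g \<Longrightarrow> Ck_on k S (\<lambda>x. f x * g x)"
  using Ck_convergent_mult[of S k "\<lambda>_. f" "\<lambda>_. g"] by (simp add: Ck_convergent_const_iff)

lemma Ck_on_sum: "open S \<Longrightarrow> (\<And>a. a \<in> A \<Longrightarrow> Ck_on k S (f a)) \<Longrightarrow> Ck_on k S (\<lambda>x. \<Sum>a\<in>A. f a x)"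
  using Ck_convergent_sum[of S A k "\<lambda>a _. f a"] by (simp add: Ck_convergent_const_iff)

lemma Ck_on_prod:
  assumes "open S" "\<And>a. a \<in> A \<Longrightarrow> Ck_on k S (f a)"
  shows "Ck_on k S (\<lambda>x. \<Prod>a\<in>A. f a x)"
  using assms(2)
proof (induction A rule: infinite_finite_induct)
  case (insert a A)
  then show ?case using Ck_on_mult[OF assms(1)] by simp
qed simp_all

lemma Ck_on_compose:
  fixes F :: "real^'b::finite \<Rightarrow> real" and g :: "real^'a::finite \<Rightarrow> real^'b"
  assumes "open S" "open V" "Ck_on k V F" "\<And>a. Ck_on k S (\<lambda>y. g y $ a)" "\<And>y. y \<in> S \<Longrightarrow> g y \<in> V"
  shows "Ck_on k S (\<lambda>y. F (g y))"
proof -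
  have "converges_continuously S (\<lambda>m y. g y $ a) (\<lambda>y. g y $ a)" for a
    by (rule converges_continuously_const[OF assms(1) Ck_on_imp_continuous_on[OF assms(4)]])
  then have "Ck_convergent k S (\<lambda>_ y. F (g y))"
    by (intro Ck_convergent_compose[OF assms(1-3), of "\<lambda>_. g" g] Ck_convergent_const_seq assms(1,4,5))
  then show ?thesis by (simp add: Ck_convergent_const_iff assms(1))
qed

lemma Ck_on_mono: "open S \<Longrightarrow> Ck_on k S f \<Longrightarrow> j \<le> k \<Longrightarrow> Ck_on j S f"
  using Ck_convergent_mono[of k S "\<lambda>_. f" j] by (simp add: Ck_convergent_const_iff)

lemma Ck_on_subset: "Ck_on k S f \<Longrightarrow> T \<subseteq> S \<Longrightarrow> Ck_on k T f"
  by (induction k arbitrary: f) (auto intro: continuous_on_subset)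

lemma Ck_on_partial: "Ck_on (Suc k) S f \<Longrightarrow> Ck_on k S (partial i f)"
  by simp

lemma partial_inverse:
  assumes "f differentiable (at x)" "f x \<noteq> 0"
  shows "partial i (\<lambda>z. inverse (f z)) x = - 1 * (partial i f x * (inverse (f x) * inverse (f x)))"
proof -
  have "(f has_derivative frechet_derivative f (at x)) (at x)"
    using assms(1) frechet_derivative_works by blast
  from partial_eqI[OF Deriv.has_derivative_inverse[OF assms(2) this]] show ?thesis
    by (simp add: partial_def)
qed

lemma Ck_on_inverse:
  assumes "open S" "Ck_on k S f" "\<And>x. x \<in> S \<Longrightarrow> f x \<noteq> 0"
  shows "Ck_on k S (\<lambda>x. inverse (f x))"
  using assms(2)
proof (induction k)
  case 0
  then show ?case using assms(3) by (auto intro!: continuous_intros)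
next
  case (Suc k)
  have f: "Ck_on k S (\<lambda>x. inverse (f x))"
    using Suc Ck_on_mono[OF assms(1), of "Suc k" f k] by simp
  have "Ck_on k S (partial i f)" for i
    using Suc.prems by simp
  then have "Ck_on k S (\<lambda>x. - 1 * (partial i f x * (inverse (f x) * inverse (f x))))" for i
    by (intro Ck_on_mult assms(1) f Ck_on_const)
  moreover have "Ck_on k S (partial i (\<lambda>x. inverse (f x))) =
      Ck_on k S (\<lambda>x. - 1 * (partial i f x * (inverse (f x) * inverse (f x))))" for i
    by (rule Ck_on_cong[OF assms(1)], rule partial_inverse) (use Suc.prems assms(3) in auto)
  moreover have "(\<lambda>x. inverse (f x)) differentiable (at x)" if "x \<in> S" for x
    using Suc.prems assms(3) that by (auto intro!: derivative_intros)
  ultimately show ?case by simp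
qed

section \<open>Integration along a coordinate axis\<close>

text \<open>Cubes around the origin are mapped into themselves by every \<open>axis_scale e s\<close> with \<open>0 \<le> s \<le> 1\<close>, and
  they are the natural domain of convergence for power series that is used below.\<close>

definition cube :: "real \<Rightarrow> (real^'n::finite) set" where
  "cube \<rho> = {z. \<forall>i. \<bar>z $ i\<bar> \<le> \<rho>}"

definition open_cube :: "real \<Rightarrow> (real^'n::finite) set" where
  "open_cube \<rho> = {z. \<forall>i. \<bar>z $ i\<bar> < \<rho>}"

definition axis_scale :: "'n \<Rightarrow> real \<Rightarrow> real^'n::finite \<Rightarrow> real^'n" where
  "axis_scale e s z = (\<chi> i. if i = e then s * z $ i else z $ i)"

text \<open>The integral of \<open>f\<close> over the coordinate \<open>e\<close> from \<open>0\<close> to \<open>z $ e\<close>, the other coordinates being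
  those of \<open>z\<close>. The substitution to the fixed interval \<open>{0..1}\<close> makes negative upper limits and
  differentiation under the integral sign unproblematic.\<close>

definition axis_integral :: "'n \<Rightarrow> (real^'n::finite \<Rightarrow> real) \<Rightarrow> real^'n \<Rightarrow> real" where
  "axis_integral e f z = z $ e * integral {0..1} (\<lambda>s. f (axis_scale e s z))"

lemma cube_eq_cbox: "cube \<rho> = cbox (\<chi> i. - \<rho>) (\<chi> i. \<rho>)"
  by (auto simp: cube_def mem_box_cart abs_le_iff minus_le_iff)

lemma open_cube_eq_box: "open_cube \<rho> = box (\<chi> i. - \<rho>) (\<chi> i. \<rho>)"
  by (auto simp: open_cube_def mem_box_cart abs_less_iff minus_less_iff)

lemma compact_cube: "compact (cube \<rho>)" and convex_cube: "convex (cube \<rho>)"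
  by (simp_all add: cube_eq_cbox compact_cbox convex_box)

lemma open_open_cube: "open (open_cube \<rho>)" and convex_open_cube: "convex (open_cube \<rho>)"
  by (simp_all add: open_cube_eq_box open_box convex_box)

lemma open_cube_subset_cube: "open_cube \<rho> \<subseteq> cube \<rho>"
  by (auto simp: open_cube_def cube_def less_imp_le)

lemma cube_subset_open_cube: "\<sigma> < \<rho> \<Longrightarrow> cube \<sigma> \<subseteq> open_cube \<rho>"
  by (auto simp: open_cube_def cube_def intro: le_less_trans)

lemma cube_mono: "\<sigma> \<le> \<rho> \<Longrightarrow> cube \<sigma> \<subseteq> cube \<rho>"
  by (auto simp: cube_def intro: order_trans)

lemma cubeD: "z \<in> cube \<rho> \<Longrightarrow> \<bar>z $ i\<bar> \<le> \<rho>"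
  by (simp add: cube_def)

lemma axis_scale_nth: "axis_scale e s z $ i = (if i = e then s * z $ i else z $ i)"
  by (simp add: axis_scale_def)

lemma abs_axis_scale_le: "s \<in> {0..1} \<Longrightarrow> \<bar>axis_scale e s z $ i\<bar> \<le> \<bar>z $ i\<bar>"
  by (auto simp: axis_scale_nth abs_mult mult_left_le_one_le)

lemma axis_scale_in_cube: "s \<in> {0..1} \<Longrightarrow> z \<in> cube \<rho> \<Longrightarrow> axis_scale e s z \<in> cube \<rho>"
  using abs_axis_scale_le[of s e z] by (auto simp: cube_def intro: order_trans)

lemma axis_scale_in_open_cube: "s \<in> {0..1} \<Longrightarrow> z \<in> open_cube \<rho> \<Longrightarrow> axis_scale e s z \<in> open_cube \<rho>"
  using abs_axis_scale_le[of s e z] by (auto simp: open_cube_def intro: le_less_trans)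

lemma continuous_on_axis_scale:
  fixes e :: "'n::finite"
  shows "continuous_on UNIV (\<lambda>(z, s). axis_scale e s z)"
proof -
  have "continuous_on UNIV (\<lambda>p::(real^'n) \<times> real. \<chi> i. if i = e then snd p * fst p $ i else fst p $ i)"
  proof (rule continuous_on_vec_lambda)
    fix i
    show "continuous_on UNIV (\<lambda>p::(real^'n) \<times> real. if i = e then snd p * fst p $ i else fst p $ i)"
      by (cases "i = e") (auto intro!: continuous_intros)
  qed
  then show ?thesis by (simp add: axis_scale_def case_prod_unfold)
qed

lemma continuous_on_axis_scale_compose:
  assumes "continuous_on S f" "\<And>s z. s \<in> {0..1} \<Longrightarrow> z \<in> K \<Longrightarrow> axis_scale e s z \<in> S"
  shows "continuous_on (K \<times> {0..1}) (\<lambda>(z, s). f (axis_scale e s z))"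
proof -
  have "continuous_on (K \<times> {0..1}) (\<lambda>p. axis_scale e (snd p) (fst p))"
    using continuous_on_subset[OF continuous_on_axis_scale[of e], of "K \<times> {0..1}"]
    by (simp add: case_prod_unfold)
  moreover have "(\<lambda>p. axis_scale e (snd p) (fst p)) ` (K \<times> {0..1}) \<subseteq> S"
    using assms(2) by auto
  ultimately show ?thesis
    using continuous_on_compose2[OF assms(1)] by (simp add: case_prod_unfold)
qed

lemma continuous_on_axis_scale_segment:
  assumes "continuous_on S f" "\<And>s. s \<in> {0..1} \<Longrightarrow> axis_scale e s z \<in> S"
  shows "continuous_on {0..1} (\<lambda>s. f (axis_scale e s z))"
proof -
  have "continuous_on ({z} \<times> {0..1}) (\<lambda>(z, s). f (axis_scale e s z))"
    by (rule continuous_on_axis_scale_compose) (use assms in auto)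
  moreover have "continuous_on {0..1::real} (\<lambda>s. (z, s))"
    by (intro continuous_intros)
  ultimately show ?thesis
    by (auto dest: continuous_on_compose2[where g = "\<lambda>(z, s). f (axis_scale e s z)" and f = "\<lambda>s. (z, s)" and s = "{0..1}"])
qed

lemma axis_integral_cong:
  assumes "\<And>z. z \<in> S \<Longrightarrow> f z = g z" "\<And>s. s \<in> {0..1} \<Longrightarrow> axis_scale e s z \<in> S"
  shows "axis_integral e f z = axis_integral e g z"
  unfolding axis_integral_def using assms by (auto intro!: arg_cong2[where f="(*)"] integral_cong)

lemma axis_integral_diff:
  assumes "continuous_on S f" "continuous_on S g" "\<And>s. s \<in> {0..1} \<Longrightarrow> axis_scale e s z \<in> S"
  shows "axis_integral e (\<lambda>z. f z - g z) z = axis_integral e f z - axis_integral e g z"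
  unfolding axis_integral_def
  using assms continuous_on_axis_scale_segment[of S _ e z]
  by (subst integral_diff) (auto intro!: integrable_continuous_interval simp: right_diff_distrib)

lemma axis_integral_bound:
  assumes "continuous_on S f" "\<And>s. s \<in> {0..1} \<Longrightarrow> axis_scale e s z \<in> S"
    and "\<And>z. z \<in> S \<Longrightarrow> \<bar>f z\<bar> \<le> N"
  shows "\<bar>axis_integral e f z\<bar> \<le> \<bar>z $ e\<bar> * N"
proof -
  have "norm (integral {0..1} (\<lambda>s. f (axis_scale e s z))) \<le> N * (1 - 0)"
    by (rule integral_bound) (use assms continuous_on_axis_scale_segment[of S f e z] in auto)
  then show ?thesis
    unfolding axis_integral_def abs_mult by (intro mult_left_mono) auto
qed

lemma axis_integral_at_0: "z $ e = 0 \<Longrightarrow> axis_integral e f z = 0"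
  by (simp add: axis_integral_def)

lemma continuous_on_axis_integral:
  assumes "continuous_on S f" "\<And>s z. s \<in> {0..1} \<Longrightarrow> z \<in> S \<Longrightarrow> axis_scale e s z \<in> S"
  shows "continuous_on S (axis_integral e f)"
proof -
  have "continuous_on S (\<lambda>z. integral (cbox 0 1) (\<lambda>s. f (axis_scale e s z)))"
    by (rule integral_continuous_on_param)
       (use continuous_on_axis_scale_compose[OF assms] in simp)
  then show ?thesis
    unfolding axis_integral_def[abs_def] by (auto intro!: continuous_intros simp: continuous_on_component)
qed

lemma norm_less_of_cube:
  fixes z :: "real^'n::finite"
  assumes "\<epsilon> > 0" "z \<in> cube (\<epsilon> / (2 * real CARD('n)))"
  shows "norm z < \<epsilon>"
proof -
  have "norm z \<le> (\<Sum>i\<in>UNIV. \<bar>z $ i\<bar>)" by (rule norm_le_l1_cart)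
  also have "\<dots> \<le> (\<Sum>i\<in>(UNIV::'n set). \<epsilon> / (2 * real CARD('n)))"
    using assms(2) by (intro sum_mono) (simp add: cube_def)
  also have "\<dots> < \<epsilon>" using \<open>\<epsilon> > 0\<close> by simp
  finally show ?thesis .
qed

lemma open_contains_translated_cube:
  fixes q :: "real^'n::finite"
  assumes "open V" "q \<in> V"
  obtains \<rho> where "\<rho> > 0" "\<And>x. x \<in> cube \<rho> \<Longrightarrow> q + x \<in> V"
proof -
  obtain \<epsilon> where \<epsilon>: "\<epsilon> > 0" "ball q \<epsilon> \<subseteq> V"
    using assms open_contains_ball by blast
  show ?thesis
  proof (rule that)
    show "\<epsilon> / (2 * real CARD('n)) > 0" using \<epsilon>(1) by simp
    show "q + x \<in> V" if "x \<in> cube (\<epsilon> / (2 * real CARD('n)))" for x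
      using norm_less_of_cube[OF \<epsilon>(1) that] \<epsilon>(2) by (auto simp: dist_norm)
  qed
qed

text \<open>A common bound for all components \<open>\<Gamma>\<^sup>h\<^sub>i\<^sub>j\<close>, or for all their partial derivatives, is obtained from
  this by taking tuples of indices for \<open>'k\<close>.\<close>

lemma finite_family_bounded_on_compact:
  fixes F :: "'k::finite \<Rightarrow> 'a::topological_space \<Rightarrow> real"
  assumes "compact K" "\<And>k. continuous_on K (F k)"
  obtains b where "b \<ge> 0" "\<And>k x. x \<in> K \<Longrightarrow> \<bar>F k x\<bar> \<le> b"
proof -
  have "\<exists>b. \<forall>x\<in>K. \<bar>F k x\<bar> \<le> b" for k
    using compact_imp_bounded[OF compact_continuous_image[OF assms(2,1)], of k] bounded_real by (metis imageI)
  then obtain b where b: "\<And>k x. x \<in> K \<Longrightarrow> \<bar>F k x\<bar> \<le> b k" by metis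
  have "b k \<le> (\<Sum>k\<in>UNIV. \<bar>b k\<bar>)" for k
    using member_le_sum[of k UNIV "\<lambda>k. \<bar>b k\<bar>"] by simp
  with b show ?thesis
    by (intro that[of "\<Sum>k\<in>UNIV. \<bar>b k\<bar>"]) (auto intro: order_trans sum_nonneg)
qed

lemma sum_mult_axis_nth: "(\<Sum>j\<in>UNIV. c j * axis i (1::real) $ j) = (c i :: real)"
  for i :: "'n::finite"
  by (simp add: axis_def if_distrib cong: if_cong)

lemma bounded_linear_axis_scale: "bounded_linear (axis_scale e t)"
  unfolding linear_conv_bounded_linear[symmetric]
  by (rule linearI) (auto simp: axis_scale_def vec_eq_iff algebra_simps)

lemma has_derivative_axis_scale_compose:
  assumes "f differentiable (at (axis_scale e t z))"
  shows "((\<lambda>z. f (axis_scale e t z)) has_derivative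
    (\<lambda>h. \<Sum>i\<in>UNIV. partial i f (axis_scale e t z) * (if i = e then t else 1) * h $ i)) (at z)"
proof -
  have "((\<lambda>z. f (axis_scale e t z)) has_derivative
    (\<lambda>h. \<Sum>i\<in>UNIV. partial i f (axis_scale e t z) * axis_scale e t h $ i)) (at z)"
    by (rule has_derivative_compose[OF bounded_linear_imp_has_derivative[OF bounded_linear_axis_scale]
          has_derivative_partials[OF assms]])
  also have "(\<lambda>h. \<Sum>i\<in>UNIV. partial i f (axis_scale e t z) * axis_scale e t h $ i) =
      (\<lambda>h. \<Sum>i\<in>UNIV. partial i f (axis_scale e t z) * (if i = e then t else 1) * h $ i)"
    by (intro ext sum.cong) (auto simp: axis_scale_nth)
  finally show ?thesis .
qed

lemma axis_scale_1 [simp]: "axis_scale e 1 z = z"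
  by (simp add: axis_scale_def vec_eq_iff)

lemma has_vector_derivative_axis_scale:
  assumes "f differentiable (at (axis_scale e t z))"
  shows "((\<lambda>t. f (axis_scale e t z)) has_vector_derivative partial e f (axis_scale e t z) * z $ e) (at t within T)"
proof -
  have eq: "axis_scale e t z = (z - (z $ e) *\<^sub>R axis e 1) + t *\<^sub>R ((z $ e) *\<^sub>R axis e 1)" for t
    by (simp add: axis_scale_def axis_def vec_eq_iff)
  have "((\<lambda>t. axis_scale e t z) has_derivative (\<lambda>h. h *\<^sub>R ((z $ e) *\<^sub>R axis e 1))) (at t within T)"
    unfolding eq[abs_def] by (auto intro!: derivative_eq_intros)
  from has_derivative_compose[OF this has_derivative_partials[OF assms]]
  have "((\<lambda>t. f (axis_scale e t z)) has_derivative
    (\<lambda>h. \<Sum>i\<in>UNIV. partial i f (axis_scale e t z) * (h *\<^sub>R ((z $ e) *\<^sub>R axis e 1)) $ i)) (at t within T)" .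
  also have "(\<lambda>h. \<Sum>i\<in>UNIV. partial i f (axis_scale e t z) * (h *\<^sub>R ((z $ e) *\<^sub>R axis e 1)) $ i) =
    (\<lambda>h. h *\<^sub>R (partial e f (axis_scale e t z) * z $ e))"
    by (simp add: axis_def if_distrib mult_ac cong: if_cong)
  finally show ?thesis unfolding has_vector_derivative_def .
qed

context
  fixes f :: "real^'n::finite \<Rightarrow> real" and e :: 'n and \<rho> :: real
  assumes f: "Ck_on (Suc 0) (open_cube \<rho>) f"
begin

text \<open>Differentiation under the integral sign in the transversal directions, and the fundamental
  theorem of calculus in the direction of integration.\<close>

lemma axis_integral_derivatives:
  assumes z: "z \<in> open_cube \<rho>"
  shows "axis_integral e f differentiable (at z)"
    and "partial i (axis_integral e f) z = (if i = e then f z else axis_integral e (partial i f) z)"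
proof -
  have fd: "f differentiable (at x)" if "x \<in> open_cube \<rho>" for x
    using f that by simp
  have pc: "continuous_on (open_cube \<rho>) (partial i f)" for i
    using f by simp
  have fc: "continuous_on (open_cube \<rho>) f"
    using f by (rule Ck_on_imp_continuous_on)
  define D where "D x t = (\<Sum>i\<in>UNIV. (partial i f (axis_scale e t x) * (if i = e then t else 1)) *\<^sub>R
      blinfun_inner_left (axis i (1::real)))" for x :: "real^'n" and t :: real
  have D_apply: "blinfun_apply (D x t) = (\<lambda>h. \<Sum>i\<in>UNIV. partial i f (axis_scale e t x) * (if i = e then t else 1) * h $ i)" for x t
    by (simp add: fun_eq_iff D_def blinfun.sum_left blinfun.scaleR_left inner_axis)
  have D_cont: "continuous_on (open_cube \<rho> \<times> {0..1}) (\<lambda>(x, t). D x t)"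
  proof -
    have "continuous_on (open_cube \<rho> \<times> {0..1}) (\<lambda>p. partial i f (axis_scale e (snd p) (fst p)))" for i
      using continuous_on_axis_scale_compose[OF pc[of i] axis_scale_in_open_cube]
      by (simp add: case_prod_unfold)
    moreover have "continuous_on (open_cube \<rho> \<times> {0..1}) (\<lambda>p::(real^'n) \<times> real. if i = e then snd p else 1)" for i
      by (cases "i = e") (auto intro!: continuous_intros)
    ultimately show ?thesis
      unfolding D_def case_prod_unfold by (intro continuous_intros)
  qed
  have scale_c: "continuous_on {0..1} (\<lambda>t. g (axis_scale e t x))"
    if "continuous_on (open_cube \<rho>) g" "x \<in> open_cube \<rho>" for g :: "real^'n \<Rightarrow> real" and x
    by (rule continuous_on_axis_scale_segment[OF that(1)]) (use axis_scale_in_open_cube that(2) in blast)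
  have "((\<lambda>x. integral (cbox 0 1) (\<lambda>t. f (axis_scale e t x))) has_derivative
      integral (cbox 0 1) (D z)) (at z within open_cube \<rho>)"
  proof (rule leibniz_rule)
    show "((\<lambda>x. f (axis_scale e t x)) has_derivative blinfun_apply (D x t)) (at x within open_cube \<rho>)"
      if "x \<in> open_cube \<rho>" "t \<in> cbox 0 1" for x t
      unfolding D_apply
      by (rule has_derivative_at_withinI[OF has_derivative_axis_scale_compose[OF
            fd[OF axis_scale_in_open_cube[OF _ that(1)]]]]) (use that(2) in simp)
    show "(\<lambda>t. f (axis_scale e t x)) integrable_on cbox 0 1" if "x \<in> open_cube \<rho>" for x
      using scale_c[OF fc that] by (simp add: integrable_continuous_interval)
  qed (use D_cont z convex_open_cube in auto)
  then have J: "((\<lambda>x. integral {0..1} (\<lambda>t. f (axis_scale e t x))) has_derivative integral {0..1} (D z)) (at z)"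
    using at_within_open[OF z open_open_cube] by simp
  have Dz: "D z integrable_on {0..1}"
  proof (rule integrable_continuous_interval)
    have "continuous_on {0..1::real} (\<lambda>t. (z, t))" by (intro continuous_intros)
    from continuous_on_compose2[OF D_cont this] z show "continuous_on {0..1} (D z)" by auto
  qed
  have pJ: "partial i (\<lambda>x. integral {0..1} (\<lambda>t. f (axis_scale e t x))) z =
      integral {0..1} (\<lambda>t. partial i f (axis_scale e t z) * (if i = e then t else 1))"
    using partial_eqI[OF J, of i] blinfun_apply_integral[OF Dz, of "axis i 1"]
    unfolding D_apply sum_mult_axis_nth by simp
  have J': "(\<lambda>x. integral {0..1} (\<lambda>t. f (axis_scale e t x))) differentiable (at z)"
    using J by (auto simp: differentiable_def)
  have n: "(\<lambda>x. x $ e) differentiable (at z)"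
    using has_derivative_nth by (auto simp: differentiable_def)
  show "axis_integral e f differentiable (at z)"
    unfolding axis_integral_def[abs_def] by (intro derivative_intros J' n)
  have p: "partial i (axis_integral e f) z =
      z $ e * integral {0..1} (\<lambda>t. partial i f (axis_scale e t z) * (if i = e then t else 1)) +
      (if i = e then 1 else 0) * integral {0..1} (\<lambda>t. f (axis_scale e t z))"
    unfolding axis_integral_def[abs_def] by (subst partial_mult[OF n J']) (simp add: pJ partial_nth)
  show "partial i (axis_integral e f) z = (if i = e then f z else axis_integral e (partial i f) z)"
  proof (cases "i = e")
    case True
    \<comment> \<open>the two integrals of \<open>p\<close> add up to the integral of this derivative\<close>
    have "((\<lambda>t. t * f (axis_scale e t z)) has_vector_derivative
        z $ e * (partial e f (axis_scale e t z) * t) + f (axis_scale e t z)) (at t within {0..1})"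
      if "t \<in> {0..1}" for t
      using has_vector_derivative_mult[OF has_vector_derivative_id
          has_vector_derivative_axis_scale[OF fd[OF axis_scale_in_open_cube[OF that z, of e]], where T = "{0..1}"]]
      by (simp add: mult_ac)
    then have "((\<lambda>t. z $ e * (partial e f (axis_scale e t z) * t) + f (axis_scale e t z)) has_integral
        1 * f (axis_scale e 1 z) - 0 * f (axis_scale e 0 z)) {0..1}"
      by (intro fundamental_theorem_of_calculus) auto
    moreover have "((\<lambda>t. z $ e * (partial e f (axis_scale e t z) * t) + f (axis_scale e t z)) has_integral
       z $ e * integral {0..1} (\<lambda>t. partial e f (axis_scale e t z) * t) + integral {0..1} (\<lambda>t. f (axis_scale e t z))) {0..1}"
      by (intro has_integral_add has_integral_mult_right integrable_integral integrable_continuous_interval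
          continuous_intros scale_c pc fc z)
    ultimately have "1 * f (axis_scale e 1 z) - 0 * f (axis_scale e 0 z) =
        z $ e * integral {0..1} (\<lambda>t. partial e f (axis_scale e t z) * t) + integral {0..1} (\<lambda>t. f (axis_scale e t z))"
      by (rule has_integral_unique)
    then show ?thesis
      using p True by simp
  qed (simp add: p axis_integral_def)
qed

end

lemma axis_integral_uniform:
  fixes f g :: "real^'n::finite \<Rightarrow> real"
  assumes "continuous_on (cube \<sigma>) f" "continuous_on (cube \<sigma>) g" "0 \<le> \<sigma>"
    and "\<And>x. x \<in> cube \<sigma> \<Longrightarrow> \<bar>f x - g x\<bar> \<le> d" and z: "z \<in> cube \<sigma>"
  shows "\<bar>axis_integral e f z - axis_integral e g z\<bar> \<le> \<sigma> * d"
proof -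
  have "d \<ge> 0" using assms(4)[OF z] by linarith
  have "\<bar>axis_integral e (\<lambda>x. f x - g x) z\<bar> \<le> \<bar>z $ e\<bar> * d"
    by (rule axis_integral_bound[where S = "cube \<sigma>"])
       (use assms(1,2,4) axis_scale_in_cube[OF _ z] in \<open>auto intro!: continuous_intros\<close>)
  also have "\<dots> \<le> \<sigma> * d"
    using cubeD[OF z] \<open>d \<ge> 0\<close> by (intro mult_right_mono)
  finally show ?thesis
    using axis_integral_diff[OF assms(1,2) axis_scale_in_cube[OF _ z]] by simp
qed

lemma open_cube_cube_between:
  fixes x :: "real^'n::finite"
  assumes "x \<in> open_cube \<rho>"
  obtains \<sigma> where "0 < \<sigma>" "\<sigma> < \<rho>" "x \<in> open_cube \<sigma>"
proof -
  have fin: "finite (range (\<lambda>i. \<bar>x $ i\<bar>))" by simp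
  define s where "s = Max (range (\<lambda>i. \<bar>x $ i\<bar>))"
  have le: "\<bar>x $ i\<bar> \<le> s" for i unfolding s_def by (rule Max_ge) auto
  have "s < \<rho>" using assms Max_in[OF fin] by (auto simp: s_def open_cube_def)
  moreover have "0 \<le> s" using le order_trans[OF abs_ge_zero] by blast
  moreover have "\<bar>x $ i\<bar> < (s + \<rho>) / 2" for i
    by (rule le_less_trans[OF le]) (use \<open>s < \<rho>\<close> in simp)
  ultimately show ?thesis
    by (intro that[of "(s + \<rho>) / 2"]) (auto simp: open_cube_def)
qed

text \<open>The closed cubes of smaller radius exhaust the open cube, so they suffice as test sets.\<close>

lemma converges_continuously_open_cubeI:
  fixes f :: "nat \<Rightarrow> real^'n::finite \<Rightarrow> real"
  assumes "\<And>m. continuous_on (open_cube \<rho>) (f m)"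
    and "\<And>\<sigma>. 0 < \<sigma> \<Longrightarrow> \<sigma> < \<rho> \<Longrightarrow> uniform_limit (cube \<sigma>) f l sequentially"
  shows "converges_continuously (open_cube \<rho>) f l"
proof (rule converges_continuouslyI[OF assms(1)])
  fix x :: "real^'n" assume "x \<in> open_cube \<rho>"
  then obtain \<sigma> where \<sigma>: "0 < \<sigma>" "\<sigma> < \<rho>" "x \<in> open_cube \<sigma>"
    by (rule open_cube_cube_between)
  have "uniform_limit (open_cube \<sigma>) f l sequentially"
    by (rule uniform_limit_on_subset[OF assms(2)[OF \<sigma>(1,2)] open_cube_subset_cube])
  then show "\<exists>U. open U \<and> x \<in> U \<and> U \<subseteq> open_cube \<rho> \<and> uniform_limit U f l sequentially"
    using \<sigma> open_open_cube[of \<sigma>] open_cube_subset_cube[of \<sigma>] cube_subset_open_cube[OF \<sigma>(2)] by blast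
qed

lemma uniform_limit_axis_integral:
  fixes f :: "nat \<Rightarrow> real^'n::finite \<Rightarrow> real"
  assumes "\<And>m. continuous_on (cube \<sigma>) (f m)" "0 < \<sigma>" and u: "uniform_limit (cube \<sigma>) f l sequentially"
  shows "uniform_limit (cube \<sigma>) (\<lambda>m. axis_integral e (f m)) (axis_integral e l) sequentially"
proof (rule uniform_limitI)
  have l: "continuous_on (cube \<sigma>) l"
    by (rule uniform_limit_theorem[OF _ u]) (use assms(1) in auto)
  fix \<epsilon> :: real assume "\<epsilon> > 0"
  then have "\<epsilon> / (2 * \<sigma>) > 0" using \<open>0 < \<sigma>\<close> by simp
  from uniform_limitD[OF u this]
  show "\<forall>\<^sub>F m in sequentially. \<forall>z\<in>cube \<sigma>. dist (axis_integral e (f m) z) (axis_integral e l z) < \<epsilon>"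
  proof (rule eventually_mono, intro ballI)
    fix m and z :: "real^'n"
    assume m: "\<forall>x\<in>cube \<sigma>. dist (f m x) (l x) < \<epsilon> / (2 * \<sigma>)" and z: "z \<in> cube \<sigma>"
    have "\<bar>axis_integral e (f m) z - axis_integral e l z\<bar> \<le> \<sigma> * (\<epsilon> / (2 * \<sigma>))"
      by (rule axis_integral_uniform[OF assms(1) l _ _ z])
         (use m \<open>0 < \<sigma>\<close> in \<open>auto simp: dist_real_def less_imp_le\<close>)
    also have "\<dots> < \<epsilon>" using \<open>0 < \<sigma>\<close> \<open>\<epsilon> > 0\<close> by simp
    finally show "dist (axis_integral e (f m) z) (axis_integral e l z) < \<epsilon>"
      by (simp add: dist_real_def)
  qed
qed

lemma converges_continuously_axis_integral:
  fixes f :: "nat \<Rightarrow> real^'n::finite \<Rightarrow> real"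
  assumes "\<And>m. continuous_on (open_cube \<rho>) (f m)" "converges_continuously (open_cube \<rho>) f l"
  shows "converges_continuously (open_cube \<rho>) (\<lambda>m. axis_integral e (f m)) (axis_integral e l)"
proof (rule converges_continuously_open_cubeI)
  show "continuous_on (open_cube \<rho>) (axis_integral e (f m))" for m
    by (rule continuous_on_axis_integral[OF assms(1) axis_scale_in_open_cube])
  fix \<sigma> :: real assume \<sigma>: "0 < \<sigma>" "\<sigma> < \<rho>"
  note sub = cube_subset_open_cube[OF \<sigma>(2)]
  have u: "uniform_limit (cube \<sigma>) f l sequentially"
    by (rule converges_continuously_uniform_on_compact[OF assms(2) compact_cube sub])
  show "uniform_limit (cube \<sigma>) (\<lambda>m. axis_integral e (f m)) (axis_integral e l) sequentially"
    by (rule uniform_limit_axis_integral[OF continuous_on_subset[OF assms(1) sub] \<sigma>(1) u])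
qed

text \<open>Both cases of \<open>axis_integral_derivatives\<close> stay within the reach of the induction hypothesis:
  differentiation either commutes with the integral or cancels it.\<close>

lemma Ck_convergent_axis_integral:
  fixes f :: "nat \<Rightarrow> real^'n::finite \<Rightarrow> real"
  shows "Ck_convergent k (open_cube \<rho>) f \<Longrightarrow> Ck_convergent k (open_cube \<rho>) (\<lambda>m. axis_integral e (f m))"
proof (induction k arbitrary: f)
  case 0
  then obtain l where "converges_continuously (open_cube \<rho>) f l" by auto
  with 0 have "converges_continuously (open_cube \<rho>) (\<lambda>m. axis_integral e (f m)) (axis_integral e l)"
    by (intro converges_continuously_axis_integral) auto
  moreover have "continuous_on (open_cube \<rho>) (axis_integral e (f m))" for m
    by (rule continuous_on_axis_integral[OF _ axis_scale_in_open_cube]) (use 0 in simp)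
  ultimately show ?case by auto
next
  case (Suc k)
  have c1: "Ck_on (Suc 0) (open_cube \<rho>) (f m)" for m
    by (rule Ck_on_mono[OF open_open_cube Ck_convergent_imp_Ck_on[OF Suc.prems]]) simp
  obtain l where "converges_continuously (open_cube \<rho>) f l"
    using Ck_convergent_limit[OF Suc.prems] .
  then have "converges_continuously (open_cube \<rho>) (\<lambda>m. axis_integral e (f m)) (axis_integral e l)"
    by (intro converges_continuously_axis_integral Ck_convergent_continuous[OF Suc.prems])
  moreover have "Ck_convergent k (open_cube \<rho>) (\<lambda>m. partial i (axis_integral e (f m)))" for i
  proof -
    have "Ck_convergent k (open_cube \<rho>) (\<lambda>m. partial i (axis_integral e (f m))) =
      Ck_convergent k (open_cube \<rho>) (\<lambda>m. if i = e then f m else axis_integral e (partial i (f m)))"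
      by (rule Ck_convergent_cong[OF open_open_cube]) (simp add: axis_integral_derivatives(2)[OF c1])
    moreover have "Ck_convergent k (open_cube \<rho>) (\<lambda>m. partial i (f m))"
      using Suc.prems by simp
    ultimately show ?thesis
      using Suc.IH Ck_convergent_SucD[OF Suc.prems] by (cases "i = e") simp_all
  qed
  ultimately show ?case
    using axis_integral_derivatives(1)[OF c1] by auto
qed

lemma Ck_on_axis_integral: "Ck_on k (open_cube \<rho>) f \<Longrightarrow> Ck_on k (open_cube \<rho>) (axis_integral e f)"
  using Ck_convergent_axis_integral[of k \<rho> "\<lambda>_. f" e]
  by (simp add: Ck_convergent_const_iff open_open_cube)

lemma partial_axis_integral_twice:
  assumes f: "Ck_on (Suc 0) (open_cube \<rho>) f" and z: "z \<in> open_cube \<rho>"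
  shows "partial i (axis_integral e (axis_integral e f)) z =
    (if i = e then axis_integral e f z else axis_integral e (axis_integral e (partial i f)) z)"
proof -
  have "axis_integral e (partial i (axis_integral e f)) z = axis_integral e (axis_integral e (partial i f)) z" if "i \<noteq> e"
    by (rule axis_integral_cong[of "open_cube \<rho>"])
       (use axis_integral_derivatives(2)[OF f] that axis_scale_in_open_cube[OF _ z] in auto)
  then show ?thesis
    using axis_integral_derivatives(2)[OF Ck_on_axis_integral[OF f, of e] z, where e = e and i = i] by simp
qed

section \<open>Affine recursions with a small linear part\<close>

text \<open>Each integration over a cube of radius at most \<open>\<rho>\<close> gains a factor \<open>\<rho>\<close>. This is the source of all
  contraction estimates.\<close>

lemma axis_integral_uniform_le:
  fixes f g :: "real^'n::finite \<Rightarrow> real"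
  assumes "continuous_on (open_cube \<rho>) f" "continuous_on (open_cube \<rho>) g"
    and \<sigma>: "0 < \<sigma>" "\<sigma> < \<rho>" and d: "\<And>x. x \<in> cube \<sigma> \<Longrightarrow> \<bar>f x - g x\<bar> \<le> d" and z: "z \<in> cube \<sigma>"
  shows "\<bar>axis_integral e f z - axis_integral e g z\<bar> \<le> \<rho> * d"
    and "\<bar>axis_integral e (axis_integral e f) z - axis_integral e (axis_integral e g) z\<bar> \<le> \<rho>\<^sup>2 * d"
proof -
  have "0 \<le> d" using d[OF z] by linarith
  note sub = cube_subset_open_cube[OF \<sigma>(2)]
  have c: "continuous_on (cube \<sigma>) f" "continuous_on (cube \<sigma>) g"
    using assms(1,2) continuous_on_subset sub by blast+
  have le: "\<bar>axis_integral e f z - axis_integral e g z\<bar> \<le> \<sigma> * d" if "z \<in> cube \<sigma>" for z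
    by (rule axis_integral_uniform[OF c less_imp_le[OF \<sigma>(1)] d that])
  have "\<sigma> * d \<le> \<rho> * d" using \<sigma> \<open>0 \<le> d\<close> by (intro mult_right_mono) auto
  with le[OF z] show "\<bar>axis_integral e f z - axis_integral e g z\<bar> \<le> \<rho> * d" by linarith
  have "\<bar>axis_integral e (axis_integral e f) z - axis_integral e (axis_integral e g) z\<bar> \<le> \<sigma> * (\<sigma> * d)"
    by (rule axis_integral_uniform[OF continuous_on_axis_integral[OF c(1) axis_scale_in_cube]
          continuous_on_axis_integral[OF c(2) axis_scale_in_cube] less_imp_le[OF \<sigma>(1)] le z])
  also have "\<dots> \<le> \<rho> * (\<rho> * d)" using \<sigma> \<open>0 \<le> d\<close> by (intro mult_mono) auto
  finally show "\<bar>axis_integral e (axis_integral e f) z - axis_integral e (axis_integral e g) z\<bar> \<le> \<rho>\<^sup>2 * d"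
    by (simp add: power2_eq_square mult.assoc)
qed

lemma axis_integral_0 [simp]: "axis_integral e (\<lambda>_. 0) = (\<lambda>_. 0)"
  by (simp add: axis_integral_def fun_eq_iff)

lemma axis_integral_bound_le:
  fixes f :: "real^'n::finite \<Rightarrow> real"
  assumes "continuous_on (open_cube \<rho>) f"
    and \<sigma>: "0 < \<sigma>" "\<sigma> < \<rho>" and d: "\<And>x. x \<in> cube \<sigma> \<Longrightarrow> \<bar>f x\<bar> \<le> d" and z: "z \<in> cube \<sigma>"
  shows "\<bar>axis_integral e f z\<bar> \<le> \<rho> * d"
    and "\<bar>axis_integral e (axis_integral e f) z\<bar> \<le> \<rho>\<^sup>2 * d"
  using axis_integral_uniform_le[OF assms(1) continuous_on_const[of _ 0] \<sigma> _ z] d by simp_all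

text \<open>The linear part of the recursion has norm at most \<open>1 / 2\<close>. Two late iterates are therefore
  mapped to iterates at half their distance, up to the change of the coefficients, which tends
  to \<open>0\<close>. Iterating this shows that the sequence is uniformly Cauchy.\<close>

lemma affine_recursion_Cauchy:
  fixes W B :: "'n::finite \<Rightarrow> nat \<Rightarrow> real^'n \<Rightarrow> real" and e :: 'n
  assumes A: "\<And>h a. Ck_convergent 0 (open_cube \<rho>) (A h a)" and C: "\<And>h a. Ck_convergent 0 (open_cube \<rho>) (C h a)"
    and B: "\<And>h. Ck_convergent 0 (open_cube \<rho>) (B h)"
    and A_le: "\<And>h a m z. z \<in> open_cube \<rho> \<Longrightarrow> \<bar>A h a m z\<bar> \<le> \<alpha>"
    and C_le: "\<And>h a m z. z \<in> open_cube \<rho> \<Longrightarrow> \<bar>C h a m z\<bar> \<le> \<beta>"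
    and small: "real CARD('n) * (\<alpha> * \<rho>\<^sup>2 + \<beta> * \<rho>) \<le> 1 / 2"
    and W: "\<And>h m z. z \<in> open_cube \<rho> \<Longrightarrow> W h (Suc m) z =
      (\<Sum>a\<in>UNIV. A h a m z * axis_integral e (axis_integral e (W a m)) z + C h a m z * axis_integral e (W a m) z) + B h m z"
    and W0: "\<And>h. continuous_on (open_cube \<rho>) (W h 0)"
  shows "Ck_convergent 0 (open_cube \<rho>) (W h)"
proof -
  have W_cont: "continuous_on (open_cube \<rho>) (W h m)" for h m
  proof (induction m arbitrary: h)
    case (Suc m)
    have I: "continuous_on (open_cube \<rho>) (axis_integral e (W a m))"
      "continuous_on (open_cube \<rho>) (axis_integral e (axis_integral e (W a m)))" for a
      by (intro continuous_on_axis_integral Suc axis_scale_in_open_cube; assumption)+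
    have "continuous_on (open_cube \<rho>) (\<lambda>z. (\<Sum>a\<in>UNIV. A h a m z * axis_integral e (axis_integral e (W a m)) z +
        C h a m z * axis_integral e (W a m) z) + B h m z)"
      using A B C by (intro continuous_intros I) auto
    then show ?case using W by (simp cong: continuous_on_cong)
  qed (rule W0)
  have unif: "uniform_limit (cube \<sigma>) (W h) (\<lambda>z. lim (\<lambda>m. W h m z)) sequentially"
    if \<sigma>: "0 < \<sigma>" "\<sigma> < \<rho>" for \<sigma> h
  proof -
    have "\<rho> > 0" using \<sigma> by simp
    have z0: "0 \<in> open_cube \<rho>" using \<open>\<rho> > 0\<close> by (simp add: open_cube_def)
    have "\<alpha> \<ge> 0" "\<beta> \<ge> 0" using A_le[OF z0] C_le[OF z0] order_trans[OF abs_ge_zero] by blast+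
    note sub = cube_subset_open_cube[OF \<sigma>(2)]
    define n where "n = real CARD('n)"
    have n: "n > 0" by (simp add: n_def)
    have bounded: "\<exists>X. \<forall>h. \<forall>z\<in>cube \<sigma>. \<bar>F h z\<bar> \<le> X" if "\<And>h. continuous_on (open_cube \<rho>) (F h)"
      for F :: "'n \<Rightarrow> real^'n \<Rightarrow> real"
      by (rule finite_family_bounded_on_compact[where F = F, OF compact_cube continuous_on_subset[OF that sub]]) blast
    have cauchy: "\<forall>\<^sub>F N in sequentially. \<forall>m\<ge>N. \<forall>m'\<ge>N. \<forall>h a. \<forall>z\<in>cube \<sigma>.
        \<bar>A h a m z - A h a m' z\<bar> \<le> \<eta> \<and> \<bar>C h a m z - C h a m' z\<bar> \<le> \<eta> \<and> \<bar>B h m z - B h m' z\<bar> \<le> \<eta>"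
      if "\<eta> > 0" for \<eta>
    proof -
      have "\<forall>\<^sub>F N in sequentially. \<forall>h a.
        (\<forall>m\<ge>N. \<forall>m'\<ge>N. \<forall>z\<in>cube \<sigma>. \<bar>A h a m z - A h a m' z\<bar> \<le> \<eta>) \<and>
        (\<forall>m\<ge>N. \<forall>m'\<ge>N. \<forall>z\<in>cube \<sigma>. \<bar>C h a m z - C h a m' z\<bar> \<le> \<eta>) \<and>
        (\<forall>m\<ge>N. \<forall>m'\<ge>N. \<forall>z\<in>cube \<sigma>. \<bar>B h m z - B h m' z\<bar> \<le> \<eta>)"
        by (intro eventually_all_finite eventually_conj
            Ck_convergent_uniformly_Cauchy[OF A compact_cube sub that]
            Ck_convergent_uniformly_Cauchy[OF C compact_cube sub that]
            Ck_convergent_uniformly_Cauchy[OF B compact_cube sub that])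
      then show ?thesis by (rule eventually_mono) blast
    qed
    obtain N0 where N0': "\<forall>m\<ge>N0. \<forall>m'\<ge>N0. \<forall>h a. \<forall>z\<in>cube \<sigma>.
        \<bar>A h a m z - A h a m' z\<bar> \<le> 1 \<and> \<bar>C h a m z - C h a m' z\<bar> \<le> 1 \<and> \<bar>B h m z - B h m' z\<bar> \<le> 1"
      using eventually_happens'[OF sequentially_bot cauchy[OF zero_less_one]] by auto
    have N0: "\<bar>B h m z - B h N0 z\<bar> \<le> 1" if "m \<ge> N0" "z \<in> cube \<sigma>" for m h z
      using N0' that by auto
    obtain b where b: "\<And>h z. z \<in> cube \<sigma> \<Longrightarrow> \<bar>B h N0 z\<bar> \<le> b"
    proof -
      have "continuous_on (open_cube \<rho>) (B h N0)" for h using B by simp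
      from bounded[of "\<lambda>h. B h N0", OF this] that show thesis by blast
    qed
    obtain X0 where X0: "\<And>h z. z \<in> cube \<sigma> \<Longrightarrow> \<bar>W h N0 z\<bar> \<le> X0"
      using bounded[of "\<lambda>h. W h N0", OF W_cont] by blast
    define X where "X = max 1 (max X0 (2 * (b + 1)))"
    have X: "X \<ge> 1" "X \<ge> X0" "X \<ge> 2 * (b + 1)" by (auto simp: X_def)
    have W_le: "\<bar>W h m z\<bar> \<le> X" if "m \<ge> N0" "z \<in> cube \<sigma>" for h m z
      using that
    proof (induction m arbitrary: h z rule: dec_induct)
      case base
      then show ?case using X0 X(2) order_trans by blast
    next
      case (step m)
      have z: "z \<in> open_cube \<rho>" using step.prems sub by blast
      have "\<bar>A h a m z * axis_integral e (axis_integral e (W a m)) z + C h a m z * axis_integral e (W a m) z\<bar>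
          \<le> \<alpha> * (\<rho>\<^sup>2 * X) + \<beta> * (\<rho> * X)" for a
        using axis_integral_bound_le[OF W_cont \<sigma> step.IH step.prems, of e a] A_le[OF z] C_le[OF z] \<open>\<alpha> \<ge> 0\<close> \<open>\<beta> \<ge> 0\<close>
        by (intro order_trans[OF abs_triangle_ineq] add_mono) (auto simp: abs_mult intro!: mult_mono)
      then have "\<bar>\<Sum>a\<in>UNIV. A h a m z * axis_integral e (axis_integral e (W a m)) z + C h a m z * axis_integral e (W a m) z\<bar>
          \<le> (\<Sum>a\<in>(UNIV::'n set). \<alpha> * (\<rho>\<^sup>2 * X) + \<beta> * (\<rho> * X))"
        by (intro order_trans[OF sum_abs] sum_mono)
      also have "\<dots> = n * (\<alpha> * \<rho>\<^sup>2 + \<beta> * \<rho>) * X" by (simp add: n_def algebra_simps)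
      also have "\<dots> \<le> 1 / 2 * X" using small X(1) by (intro mult_right_mono) (auto simp: n_def)
      finally have S: "\<bar>\<Sum>a\<in>UNIV. A h a m z * axis_integral e (axis_integral e (W a m)) z +
          C h a m z * axis_integral e (W a m) z\<bar> \<le> 1 / 2 * X" .
      have *: "\<bar>s + u\<bar> \<le> X" if "\<bar>s\<bar> \<le> 1 / 2 * X" "\<bar>u - v\<bar> \<le> 1" "\<bar>v\<bar> \<le> b" for s u v
        using that X(3) by argo
      show ?case
        unfolding W[OF z] by (rule *[OF S N0[OF step.hyps(1) step.prems] b[OF step.prems]])
    qed
    \<comment> \<open>from some index on, any two iterates differ by at most \<open>\<epsilon>\<close>\<close>
    define P where "P \<epsilon> \<longleftrightarrow> (\<exists>N\<ge>N0. \<forall>m\<ge>N. \<forall>m'\<ge>N. \<forall>h. \<forall>z\<in>cube \<sigma>. \<bar>W h m z - W h m' z\<bar> \<le> \<epsilon>)" for \<epsilon>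
    have P0: "P (2 * X)"
    proof -
      have "\<bar>W h m z - W h m' z\<bar> \<le> 2 * X" if "m \<ge> N0" "m' \<ge> N0" "z \<in> cube \<sigma>" for h m m' z
        using W_le[OF that(1,3), of h] W_le[OF that(2,3), of h] by linarith
      then show ?thesis unfolding P_def by blast
    qed
    have P_step: "P (3 / 4 * \<epsilon>)" if "P \<epsilon>" "\<epsilon> > 0" for \<epsilon>
    proof -
      \<comment> \<open>\<open>\<eta>\<close> bounds the variation of the coefficients so that it contributes at most \<open>\<epsilon> / 4\<close>\<close>
      define M where "M = n * (\<rho>\<^sup>2 * X + \<rho> * X) + 1"
      have "M > 0" using n \<open>\<rho> > 0\<close> X(1) by (auto simp: M_def intro!: add_nonneg_pos mult_nonneg_nonneg)
      define \<eta> where "\<eta> = \<epsilon> / 4 / M"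
      have "\<eta> > 0" using \<open>\<epsilon> > 0\<close> \<open>M > 0\<close> by (simp add: \<eta>_def)
      obtain N where N: "N \<ge> N0" "\<And>m m' h z. m \<ge> N \<Longrightarrow> m' \<ge> N \<Longrightarrow> z \<in> cube \<sigma> \<Longrightarrow> \<bar>W h m z - W h m' z\<bar> \<le> \<epsilon>"
        using \<open>P \<epsilon>\<close> unfolding P_def by blast
      obtain N1 where N1': "\<forall>m\<ge>N1. \<forall>m'\<ge>N1. \<forall>h a. \<forall>z\<in>cube \<sigma>.
          \<bar>A h a m z - A h a m' z\<bar> \<le> \<eta> \<and> \<bar>C h a m z - C h a m' z\<bar> \<le> \<eta> \<and> \<bar>B h m z - B h m' z\<bar> \<le> \<eta>"
        using eventually_happens'[OF sequentially_bot cauchy[OF \<open>\<eta> > 0\<close>]] by auto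
      have N1: "\<bar>A h a m z - A h a m' z\<bar> \<le> \<eta> \<and> \<bar>C h a m z - C h a m' z\<bar> \<le> \<eta> \<and> \<bar>B h m z - B h m' z\<bar> \<le> \<eta>"
        if "m \<ge> N1" "m' \<ge> N1" "z \<in> cube \<sigma>" for m m' h a z
        using N1' that by auto
      have step: "\<bar>W h (Suc m) z - W h (Suc m') z\<bar> \<le> 3 / 4 * \<epsilon>"
        if m: "m \<ge> max N N1" and m': "m' \<ge> max N N1" and z: "z \<in> cube \<sigma>" for h m m' z
      proof -
        have zo: "z \<in> open_cube \<rho>" using z sub by blast
        have m'0: "m' \<ge> N0" using m' N(1) by simp
        define I where "I a = axis_integral e (W a m) z" for a
        define I' where "I' a = axis_integral e (W a m') z" for a
        define J where "J a = axis_integral e (axis_integral e (W a m)) z" for a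
        define J' where "J' a = axis_integral e (axis_integral e (W a m')) z" for a
        have d: "\<bar>I a - I' a\<bar> \<le> \<rho> * \<epsilon>" "\<bar>J a - J' a\<bar> \<le> \<rho>\<^sup>2 * \<epsilon>" for a
          using axis_integral_uniform_le[OF W_cont[of a m] W_cont[of a m'] \<sigma> N(2) z, where e = e] m m'
          by (simp_all add: I_def I'_def J_def J'_def)
        have bd: "\<bar>I' a\<bar> \<le> \<rho> * X" "\<bar>J' a\<bar> \<le> \<rho>\<^sup>2 * X" for a
          using axis_integral_bound_le[OF W_cont \<sigma> W_le[OF m'0] z] by (simp_all add: I'_def J'_def)
        have "\<bar>(A h a m z * J a + C h a m z * I a) - (A h a m' z * J' a + C h a m' z * I' a)\<bar>
            \<le> \<alpha> * (\<rho>\<^sup>2 * \<epsilon>) + \<eta> * (\<rho>\<^sup>2 * X) + (\<beta> * (\<rho> * \<epsilon>) + \<eta> * (\<rho> * X))" for a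
        proof -
          have "(A h a m z * J a + C h a m z * I a) - (A h a m' z * J' a + C h a m' z * I' a) =
              (A h a m z * (J a - J' a) + (A h a m z - A h a m' z) * J' a) +
              (C h a m z * (I a - I' a) + (C h a m z - C h a m' z) * I' a)" by (simp add: algebra_simps)
          also have "\<bar>\<dots>\<bar> \<le> \<alpha> * (\<rho>\<^sup>2 * \<epsilon>) + \<eta> * (\<rho>\<^sup>2 * X) + (\<beta> * (\<rho> * \<epsilon>) + \<eta> * (\<rho> * X))"
            using d[of a] bd[of a] A_le[OF zo] C_le[OF zo] N1[of m m' z h a] m m' z \<open>\<alpha> \<ge> 0\<close> \<open>\<beta> \<ge> 0\<close> \<open>\<eta> > 0\<close>
            by (intro order_trans[OF abs_triangle_ineq] add_mono) (auto simp: abs_mult intro!: mult_mono)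
          finally show ?thesis .
        qed
        then have "\<bar>\<Sum>a\<in>UNIV. (A h a m z * J a + C h a m z * I a) - (A h a m' z * J' a + C h a m' z * I' a)\<bar>
            \<le> (\<Sum>a\<in>(UNIV::'n set). \<alpha> * (\<rho>\<^sup>2 * \<epsilon>) + \<eta> * (\<rho>\<^sup>2 * X) + (\<beta> * (\<rho> * \<epsilon>) + \<eta> * (\<rho> * X)))"
          by (intro order_trans[OF sum_abs] sum_mono)
        also have "\<dots> = n * (\<alpha> * \<rho>\<^sup>2 + \<beta> * \<rho>) * \<epsilon> + \<eta> * (n * (\<rho>\<^sup>2 * X + \<rho> * X))"
          by (simp add: n_def algebra_simps)
        also have "\<dots> \<le> 1 / 2 * \<epsilon> + \<eta> * (n * (\<rho>\<^sup>2 * X + \<rho> * X))"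
          using small \<open>\<epsilon> > 0\<close> by (intro add_right_mono mult_right_mono) (auto simp: n_def)
        finally have 1: "\<bar>\<Sum>a\<in>UNIV. (A h a m z * J a + C h a m z * I a) - (A h a m' z * J' a + C h a m' z * I' a)\<bar>
            \<le> 1 / 2 * \<epsilon> + \<eta> * (n * (\<rho>\<^sup>2 * X + \<rho> * X))" .
        have 2: "\<bar>B h m z - B h m' z\<bar> \<le> \<eta>" using N1[of m m' z h] m m' z by simp
        have "\<eta> * M = \<epsilon> / 4" using \<open>M > 0\<close> by (simp add: \<eta>_def)
        then have 3: "\<eta> * (n * (\<rho>\<^sup>2 * X + \<rho> * X)) + \<eta> = \<epsilon> / 4" by (simp add: M_def algebra_simps)
        have *: "\<bar>s + u\<bar> \<le> 3 / 4 * \<epsilon>" if "\<bar>s\<bar> \<le> 1 / 2 * \<epsilon> + t" "\<bar>u\<bar> \<le> \<eta>" "t + \<eta> = \<epsilon> / 4" for s t u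
          using that by argo
        have "W h (Suc m) z - W h (Suc m') z =
          (\<Sum>a\<in>UNIV. (A h a m z * J a + C h a m z * I a) - (A h a m' z * J' a + C h a m' z * I' a)) + (B h m z - B h m' z)"
          unfolding W[OF zo] I_def I'_def J_def J'_def sum_subtractf by simp
        then show ?thesis using *[OF 1 2 3] by simp
      qed
      have "\<bar>W h m z - W h m' z\<bar> \<le> 3 / 4 * \<epsilon>"
        if "m \<ge> Suc (max N N1)" "m' \<ge> Suc (max N N1)" "z \<in> cube \<sigma>" for h m m' z
        using step[of "m - 1" "m' - 1" z h] that by (cases m; cases m') auto
      then show ?thesis unfolding P_def using N(1)
        by (intro exI[of _ "Suc (max N N1)"]) auto
    qed
    have P_pow: "P ((3 / 4) ^ j * (2 * X))" for j
    proof (induction j)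
      case (Suc j)
      show ?case using P_step[OF Suc] X(1) by (simp add: mult.assoc)
    qed (use P0 in simp)
    have "uniformly_Cauchy_on (cube \<sigma>) (W h)"
    proof (rule uniformly_Cauchy_onI)
      fix \<epsilon> :: real assume "\<epsilon> > 0"
      have "(\<lambda>j. (3 / 4 :: real) ^ j * (2 * X)) \<longlonglongrightarrow> 0 * (2 * X)"
        by (intro tendsto_mult_right LIMSEQ_realpow_zero) auto
      then have "\<forall>\<^sub>F j in sequentially. (3 / 4 :: real) ^ j * (2 * X) < \<epsilon>"
        using order_tendstoD(2)[of _ 0 sequentially \<epsilon>] \<open>\<epsilon> > 0\<close> by simp
      then obtain j where j: "(3 / 4 :: real) ^ j * (2 * X) < \<epsilon>"
        using eventually_happens'[OF sequentially_bot] by blast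
      obtain N where "\<forall>m\<ge>N. \<forall>m'\<ge>N. \<forall>h. \<forall>z\<in>cube \<sigma>. \<bar>W h m z - W h m' z\<bar> \<le> (3 / 4) ^ j * (2 * X)"
        using P_pow[of j] unfolding P_def by blast
      with j show "\<exists>M. \<forall>x\<in>cube \<sigma>. \<forall>m\<ge>M. \<forall>n\<ge>M. dist (W h m x) (W h n x) < \<epsilon>"
        unfolding dist_real_def by (meson le_less_trans)
    qed
    then show ?thesis
      using Cauchy_uniformly_convergent uniformly_convergent_uniform_limit_iff by blast
  qed
  have "converges_continuously (open_cube \<rho>) (W h) (\<lambda>z. lim (\<lambda>m. W h m z))"
    by (rule converges_continuously_open_cubeI[OF W_cont unif])
  then show ?thesis using W_cont by auto
qed

text \<open>A partial derivative of the sequence in a transversal direction obeys a recursion with the same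
  linear part: the terms in which a coefficient is differentiated involve the sequence itself
  only, which converges in \<open>C\<^sup>k\<close> by the induction hypothesis, and so they join the inhomogeneous
  term. In the direction \<open>e\<close> the derivative cancels one integration, and the recursion expresses
  the derivative directly.\<close>

lemma affine_recursion_Ck_convergent:
  fixes W B :: "'n::finite \<Rightarrow> nat \<Rightarrow> real^'n \<Rightarrow> real" and e :: 'n
  assumes A: "\<And>h a. Ck_convergent k (open_cube \<rho>) (A h a)" and C: "\<And>h a. Ck_convergent k (open_cube \<rho>) (C h a)"
    and B: "\<And>h. Ck_convergent k (open_cube \<rho>) (B h)"
    and A_le: "\<And>h a m z. z \<in> open_cube \<rho> \<Longrightarrow> \<bar>A h a m z\<bar> \<le> \<alpha>"
    and C_le: "\<And>h a m z. z \<in> open_cube \<rho> \<Longrightarrow> \<bar>C h a m z\<bar> \<le> \<beta>"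
    and small: "real CARD('n) * (\<alpha> * \<rho>\<^sup>2 + \<beta> * \<rho>) \<le> 1 / 2"
    and W: "\<And>h m z. z \<in> open_cube \<rho> \<Longrightarrow> W h (Suc m) z =
      (\<Sum>a\<in>UNIV. A h a m z * axis_integral e (axis_integral e (W a m)) z + C h a m z * axis_integral e (W a m) z) + B h m z"
    and W0: "\<And>h. Ck_on k (open_cube \<rho>) (W h 0)"
  shows "Ck_convergent k (open_cube \<rho>) (W h)"
  using A C B W W0
proof (induction k arbitrary: W B h)
  case 0
  show ?case
    by (rule affine_recursion_Cauchy[OF 0(1-3) A_le C_le small 0(4)]) (use 0(5) in auto)
next
  case (Suc k)
  let ?S = "open_cube \<rho> :: (real^'n) set"
  let ?I = "axis_integral e"
  note op = open_open_cube[of \<rho>]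
  note A = Suc.prems(1) and C = Suc.prems(2) and B = Suc.prems(3) and W = Suc.prems(4) and W0 = Suc.prems(5)
  note Ak = Ck_convergent_SucD[OF A] and Ck = Ck_convergent_SucD[OF C] and Bk = Ck_convergent_SucD[OF B]
  have W0k: "Ck_on k ?S (W h 0)" for h
    by (rule Ck_on_mono[OF op W0]) simp
  have Wk: "Ck_convergent k ?S (W h)" for h
    by (rule Suc.IH[OF Ak Ck Bk W W0k])
  have W_Ck: "Ck_on (Suc k) ?S (W h m)" for h m
  proof (induction m arbitrary: h)
    case (Suc m)
    have "Ck_on (Suc k) ?S (\<lambda>z. (\<Sum>a\<in>UNIV. A h a m z * ?I (?I (W a m)) z + C h a m z * ?I (W a m) z) + B h m z)"
      by (rule Ck_on_add[OF op Ck_on_sum[OF op Ck_on_add[OF op Ck_on_mult[OF op] Ck_on_mult[OF op]]]])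
         (rule Ck_convergent_imp_Ck_on[OF A] Ck_convergent_imp_Ck_on[OF B]
            Ck_convergent_imp_Ck_on[OF C] Ck_on_axis_integral Suc)+
    moreover have "Ck_on (Suc k) ?S (W h (Suc m)) = Ck_on (Suc k) ?S
        (\<lambda>z. (\<Sum>a\<in>UNIV. A h a m z * ?I (?I (W a m)) z + C h a m z * ?I (W a m) z) + B h m z)"
      by (rule Ck_on_cong[OF op W])
    ultimately show ?case by blast
  qed (rule W0)
  have C1: "Ck_on (Suc 0) ?S f" if "Ck_on (Suc k) ?S f" for f
    by (rule Ck_on_mono[OF op that]) simp
  have diff: "f differentiable (at z)" if "Ck_on (Suc k) ?S f" "z \<in> ?S" for f z
    using that by simp
  have dI: "partial i (?I (W a m)) z = (if i = e then W a m z else ?I (partial i (W a m)) z)"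
    if "z \<in> ?S" for i a m z
    by (rule axis_integral_derivatives(2)[OF C1[OF W_Ck] that])
  have dII: "partial i (?I (?I (W a m))) z = (if i = e then ?I (W a m) z else ?I (?I (partial i (W a m))) z)"
    if "z \<in> ?S" for i a m z
    by (rule partial_axis_integral_twice[OF C1[OF W_Ck] that])
  have dW: "partial i (W h (Suc m)) z =
      (\<Sum>a\<in>UNIV. (A h a m z * partial i (?I (?I (W a m))) z + partial i (A h a m) z * ?I (?I (W a m)) z) +
         (C h a m z * partial i (?I (W a m)) z + partial i (C h a m) z * ?I (W a m) z)) + partial i (B h m) z"
    if "z \<in> ?S" for i h m z
  proof -
    have d: "A h a m differentiable (at z)" "C h a m differentiable (at z)" "B h m differentiable (at z)"
      for a
      using that Ck_convergent_imp_Ck_on[OF A] Ck_convergent_imp_Ck_on[OF B] Ck_convergent_imp_Ck_on[OF C] diff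
      by blast+
    have d': "?I (W a m) differentiable (at z)" "?I (?I (W a m)) differentiable (at z)" for a
      using diff[OF Ck_on_axis_integral[OF W_Ck] that]
        diff[OF Ck_on_axis_integral[OF Ck_on_axis_integral[OF W_Ck]] that] by blast+
    note d = d d'
    have "partial i (W h (Suc m)) z = partial i
        (\<lambda>z. (\<Sum>a\<in>UNIV. A h a m z * ?I (?I (W a m)) z + C h a m z * ?I (W a m) z) + B h m z) z"
      by (rule partial_cong[OF op that W])
    also have "\<dots> = (\<Sum>a\<in>UNIV. partial i (\<lambda>z. A h a m z * ?I (?I (W a m)) z + C h a m z * ?I (W a m) z) z) + partial i (B h m) z"
    proof -
      have t: "(\<lambda>z. A h a m z * ?I (?I (W a m)) z + C h a m z * ?I (W a m) z) differentiable (at z)" for a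
        by (rule differentiable_add[OF differentiable_mult[OF d(1,5)] differentiable_mult[OF d(2,4)]])
      have "(\<lambda>z. \<Sum>a\<in>UNIV. A h a m z * ?I (?I (W a m)) z + C h a m z * ?I (W a m) z) differentiable (at z)"
        by (rule differentiable_sum) (use t in auto)
      then show ?thesis
        using partial_add[OF _ d(3), where i = i] partial_sum[OF t, where A = UNIV and i = i] by simp
    qed
    also have "\<dots> = (\<Sum>a\<in>UNIV. (A h a m z * partial i (?I (?I (W a m))) z + partial i (A h a m) z * ?I (?I (W a m)) z) +
         (C h a m z * partial i (?I (W a m)) z + partial i (C h a m) z * ?I (W a m) z)) + partial i (B h m) z"
    proof -
      have "partial i (\<lambda>z. A h a m z * ?I (?I (W a m)) z + C h a m z * ?I (W a m) z) z =
        (A h a m z * partial i (?I (?I (W a m))) z + partial i (A h a m) z * ?I (?I (W a m)) z) +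
         (C h a m z * partial i (?I (W a m)) z + partial i (C h a m) z * ?I (W a m) z)" for a
        by (simp add: partial_add partial_mult d differentiable_mult)
      then show ?thesis by simp
    qed
    finally show ?thesis .
  qed
  have cI: "Ck_convergent k ?S (\<lambda>m. ?I (W a m))" "Ck_convergent k ?S (\<lambda>m. ?I (?I (W a m)))" for a
    by (intro Ck_convergent_axis_integral Wk)+
  have pA: "Ck_convergent k ?S (\<lambda>m. partial i (A h a m))" and pC: "Ck_convergent k ?S (\<lambda>m. partial i (C h a m))"
    and pB: "Ck_convergent k ?S (\<lambda>m. partial i (B h m))" and pW0: "Ck_on k ?S (partial i (W h 0))" for i h a
    using A[of h a] C[of h a] B[of h] W0[of h] by simp_all
  have "Ck_convergent k ?S (\<lambda>m. partial i (W h m))" for i h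
  proof (cases "i = e")
    case True
    show ?thesis
    proof (rule Ck_convergent_shift)
      have "Ck_convergent k ?S (\<lambda>m z. (\<Sum>a\<in>UNIV. (A h a m z * ?I (W a m) z + partial e (A h a m) z * ?I (?I (W a m)) z) +
         (C h a m z * W a m z + partial e (C h a m) z * ?I (W a m) z)) + partial e (B h m) z)"
        by (rule Ck_convergent_add[OF op Ck_convergent_sum[OF op Ck_convergent_add[OF op
              Ck_convergent_add[OF op Ck_convergent_mult[OF op] Ck_convergent_mult[OF op]]
              Ck_convergent_add[OF op Ck_convergent_mult[OF op] Ck_convergent_mult[OF op]]]]])
           (rule Ak Ck cI pA pC pB Wk)+
      moreover have "Ck_convergent k ?S (\<lambda>m. partial i (W h (Suc m))) =
        Ck_convergent k ?S (\<lambda>m z. (\<Sum>a\<in>UNIV. (A h a m z * ?I (W a m) z + partial e (A h a m) z * ?I (?I (W a m)) z) +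
         (C h a m z * W a m z + partial e (C h a m) z * ?I (W a m) z)) + partial e (B h m) z)"
        by (rule Ck_convergent_cong[OF op]) (simp add: dW dI dII True)
      ultimately show "Ck_convergent k ?S (\<lambda>m. partial i (W h (Suc m)))" by blast
    qed (rule pW0)
  next
    case False
    define B' where "B' h m z = (\<Sum>a\<in>UNIV. partial i (A h a m) z * ?I (?I (W a m)) z + partial i (C h a m) z * ?I (W a m) z) +
      partial i (B h m) z" for h m z
    have B': "Ck_convergent k ?S (B' h)" for h
      unfolding B'_def[abs_def]
      by (rule Ck_convergent_add[OF op Ck_convergent_sum[OF op Ck_convergent_add[OF op
              Ck_convergent_mult[OF op] Ck_convergent_mult[OF op]]]])
         (rule cI pA pC pB)+
    show ?thesis
      by (rule Suc.IH[where W = "\<lambda>h m. partial i (W h m)", OF Ak Ck B' _ pW0])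
         (simp add: dW dI dII False B'_def sum.distrib algebra_simps)
  qed
  moreover obtain l where "converges_continuously ?S (W h) l"
    using Ck_convergent_limit[OF Wk] .
  ultimately show ?case
    using diff[OF W_Ck] by auto
qed

section \<open>Power series with absolutely summable coefficients\<close>

definition monomial :: "('n \<Rightarrow> nat) \<Rightarrow> real^'n::finite \<Rightarrow> real" where
  "monomial \<alpha> z = (\<Prod>i\<in>UNIV. z $ i ^ \<alpha> i)"

definition total_degree :: "('n::finite \<Rightarrow> nat) \<Rightarrow> nat" where
  "total_degree \<alpha> = (\<Sum>i\<in>UNIV. \<alpha> i)"

text \<open>On the closed cube of radius \<open>\<rho>\<close> the function is the sum of a power series whose coefficients
  satisfy \<open>\<Sum>\<bar>a\<^sub>\<alpha>\<bar> \<rho>\<^bsup>\<bar>\<alpha>\<bar>\<^esup> \<le> N\<close>. The least such \<open>N\<close> is a submultiplicative norm, and the functions with a finite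
  norm form a Banach algebra. Stating bounds as a predicate avoids choosing coefficients.\<close>

definition analytic_norm_le :: "real \<Rightarrow> real \<Rightarrow> (real^'n::finite \<Rightarrow> real) \<Rightarrow> bool" where
  "analytic_norm_le \<rho> N f \<longleftrightarrow> \<rho> > 0 \<and>
     (\<exists>a s. ((\<lambda>\<alpha>. \<bar>a \<alpha>\<bar> * \<rho> ^ total_degree \<alpha>) has_sum s) UNIV \<and> s \<le> N \<and>
       (\<forall>z\<in>cube \<rho>. ((\<lambda>\<alpha>. a \<alpha> * monomial \<alpha> z) has_sum f z) UNIV))"

lemma prod_const_power_total_degree: "(\<Prod>i\<in>UNIV. c ^ \<alpha> i) = (c::real) ^ total_degree \<alpha>"
  by (simp add: total_degree_def power_sum)

lemma abs_monomial_le: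
  assumes "z \<in> cube \<rho>"
  shows "\<bar>monomial \<alpha> z\<bar> \<le> \<rho> ^ total_degree \<alpha>"
  unfolding monomial_def abs_prod prod_const_power_total_degree[symmetric]
  by (rule prod_mono) (use cubeD[OF assms] in \<open>auto simp: power_abs intro!: power_mono\<close>)

lemma monomial_add: "monomial (\<lambda>i. \<alpha> i + \<beta> i) z = monomial \<alpha> z * monomial \<beta> z"
  by (simp add: monomial_def power_add prod.distrib)

lemma total_degree_add: "total_degree (\<lambda>i. \<alpha> i + \<beta> i) = total_degree \<alpha> + total_degree \<beta>"
  by (simp add: total_degree_def sum.distrib)

lemma monomial_0 [simp]: "monomial (\<lambda>_. 0) z = 1" and total_degree_0 [simp]: "total_degree (\<lambda>_. 0) = 0"
  by (simp_all add: monomial_def total_degree_def)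

lemma monomial_axis: "monomial (\<lambda>j. if j = i then 1 else 0) z = z $ i"
  by (simp add: monomial_def if_distrib prod.delta cong: if_cong)

lemma total_degree_axis: "total_degree (\<lambda>j. if j = i then 1 else 0) = 1"
  by (simp add: total_degree_def)

lemma has_sum_real_summable_abs:
  fixes f :: "'a \<Rightarrow> real"
  assumes "(f has_sum s) A"
  shows "(\<lambda>x. \<bar>f x\<bar>) summable_on A"
  using summable_on_iff_abs_summable_on_real[of f A] has_sum_imp_summable[OF assms] by simp

lemma summable_on_real_comparison:
  fixes f g :: "'a \<Rightarrow> real"
  assumes "g summable_on A" "\<And>x. x \<in> A \<Longrightarrow> \<bar>f x\<bar> \<le> g x"
  shows "f summable_on A"
  using Infinite_Sum.abs_summable_on_comparison_test'[OF assms(1), of f] assms(2)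
  by (simp add: abs_summable_summable)

text \<open>The Cauchy product before its terms are grouped by degree.\<close>

lemma has_sum_mult_abs:
  fixes f :: "'a \<Rightarrow> real" and g :: "'b \<Rightarrow> real"
  assumes f: "(f has_sum s) A" and g: "(g has_sum t) B"
  shows "((\<lambda>(x, y). f x * g y) has_sum s * t) (A \<times> B)"
proof -
  have absg: "((\<lambda>y. \<bar>g y\<bar>) has_sum infsum (\<lambda>y. \<bar>g y\<bar>) B) B"
    using has_sum_infsum[OF has_sum_real_summable_abs[OF g]] .
  have "(\<lambda>(x, y). \<bar>f x\<bar> * \<bar>g y\<bar>) summable_on A \<times> B"
  proof (rule summable_on_SigmaI)
    show "((\<lambda>y. case (x, y) of (x, y) \<Rightarrow> \<bar>f x\<bar> * \<bar>g y\<bar>) has_sum \<bar>f x\<bar> * infsum (\<lambda>y. \<bar>g y\<bar>) B) B" for x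
      using has_sum_cmult_right[OF absg] by simp
    show "(\<lambda>x. \<bar>f x\<bar> * infsum (\<lambda>y. \<bar>g y\<bar>) B) summable_on A"
      by (rule summable_on_cmult_left[OF has_sum_real_summable_abs[OF f]])
  qed auto
  then have "(\<lambda>(x, y). f x * g y) summable_on A \<times> B"
    by (rule summable_on_real_comparison) (auto simp: abs_mult)
  then show ?thesis
    by (rule has_sum_SigmaI[rotated 2]) (use f g in \<open>auto intro!: has_sum_cmult_left has_sum_cmult_right\<close>)
qed

text \<open>A function given by an absolutely convergent sum of monomials over any index set, with
  repetitions, has a power series: collect the terms with equal exponents. All constructions
  below produce such sums.\<close>

lemma analytic_norm_leI:
  fixes m :: "'j \<Rightarrow> 'n::finite \<Rightarrow> nat"
  assumes "\<rho> > 0"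
    and s: "((\<lambda>j. \<bar>c j\<bar> * \<rho> ^ total_degree (m j)) has_sum s) J" "s \<le> N"
    and f: "\<And>z. z \<in> cube \<rho> \<Longrightarrow> ((\<lambda>j. c j * monomial (m j) z) has_sum f z) J"
  shows "analytic_norm_le \<rho> N f"
proof -
  define J' where "J' \<alpha> = {j \<in> J. m j = \<alpha>}" for \<alpha>
  define a where "a \<alpha> = infsum c (J' \<alpha>)" for \<alpha>
  have bij: "bij_betw (\<lambda>j. (m j, j)) J (Sigma UNIV J')"
    by (rule bij_betwI[of _ _ _ snd]) (auto simp: J'_def)
  have s': "((\<lambda>(\<alpha>, j). \<bar>c j\<bar> * \<rho> ^ total_degree \<alpha>) has_sum s) (Sigma UNIV J')"
    using s(1) has_sum_reindex_bij_betw[OF bij, of "\<lambda>(\<alpha>, j). \<bar>c j\<bar> * \<rho> ^ total_degree \<alpha>"] by simp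
  have c: "(\<lambda>j. \<bar>c j\<bar>) summable_on J' \<alpha>" for \<alpha>
  proof -
    have "(\<lambda>j. \<bar>c j\<bar> * \<rho> ^ total_degree \<alpha>) summable_on J' \<alpha>"
      using summable_on_SigmaD1[OF has_sum_imp_summable[OF s'], of \<alpha>] by simp
    from summable_on_cmult_left[OF this, of "1 / \<rho> ^ total_degree \<alpha>"] show ?thesis
      using \<open>\<rho> > 0\<close> by simp
  qed
  have ca: "(c has_sum a \<alpha>) (J' \<alpha>)" for \<alpha>
    unfolding a_def by (rule has_sum_infsum) (rule summable_on_real_comparison[OF c], simp)
  have a_le: "\<bar>a \<alpha>\<bar> \<le> infsum (\<lambda>j. \<bar>c j\<bar>) (J' \<alpha>)" for \<alpha>
    using norm_infsum_bound[of c "J' \<alpha>"] c by (simp add: a_def)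
  have sum: "((\<lambda>\<alpha>. infsum (\<lambda>j. \<bar>c j\<bar>) (J' \<alpha>) * \<rho> ^ total_degree \<alpha>) has_sum s) UNIV"
    by (rule has_sum_SigmaD[OF s']) (use c in \<open>auto intro!: has_sum_cmult_left has_sum_infsum\<close>)
  have le: "\<bar>a \<alpha>\<bar> * \<rho> ^ total_degree \<alpha> \<le> infsum (\<lambda>j. \<bar>c j\<bar>) (J' \<alpha>) * \<rho> ^ total_degree \<alpha>" for \<alpha>
    using a_le \<open>\<rho> > 0\<close> by (intro mult_right_mono) auto
  have summ: "(\<lambda>\<alpha>. \<bar>a \<alpha>\<bar> * \<rho> ^ total_degree \<alpha>) summable_on UNIV"
    by (rule summable_on_real_comparison[OF has_sum_imp_summable[OF sum]])
       (use le \<open>\<rho> > 0\<close> in \<open>simp add: abs_mult\<close>)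
  have "infsum (\<lambda>\<alpha>. \<bar>a \<alpha>\<bar> * \<rho> ^ total_degree \<alpha>) UNIV \<le> s"
    by (rule has_sum_mono[OF has_sum_infsum[OF summ] sum]) (rule le)
  moreover have "((\<lambda>\<alpha>. a \<alpha> * monomial \<alpha> z) has_sum f z) UNIV" if "z \<in> cube \<rho>" for z
  proof -
    have "((\<lambda>(\<alpha>, j). c j * monomial \<alpha> z) has_sum f z) (Sigma UNIV J')"
      using f[OF that] has_sum_reindex_bij_betw[OF bij, of "\<lambda>(\<alpha>, j). c j * monomial \<alpha> z"] by simp
    then show ?thesis
      by (rule has_sum_SigmaD) (use ca in \<open>auto intro!: has_sum_cmult_left\<close>)
  qed
  ultimately show ?thesis
    unfolding analytic_norm_le_def using \<open>\<rho> > 0\<close> \<open>s \<le> N\<close> has_sum_infsum[OF summ]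
    by (intro conjI exI[of _ a] exI[of _ "infsum (\<lambda>\<alpha>. \<bar>a \<alpha>\<bar> * \<rho> ^ total_degree \<alpha>) UNIV"]) auto
qed

lemma analytic_norm_le_pos: "analytic_norm_le \<rho> N f \<Longrightarrow> \<rho> > 0"
  by (simp add: analytic_norm_le_def)

lemma analytic_norm_le_mono: "analytic_norm_le \<rho> M f \<Longrightarrow> M \<le> N \<Longrightarrow> analytic_norm_le \<rho> N f"
  unfolding analytic_norm_le_def by fastforce

lemma analytic_norm_le_cong:
  "analytic_norm_le \<rho> N f \<Longrightarrow> (\<And>z. z \<in> cube \<rho> \<Longrightarrow> f z = g z) \<Longrightarrow> analytic_norm_le \<rho> N g"
  unfolding analytic_norm_le_def by simp

lemma analytic_norm_leE:
  assumes "analytic_norm_le \<rho> N f"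
  obtains a s where "\<rho> > 0" "((\<lambda>\<alpha>. \<bar>a \<alpha>\<bar> * \<rho> ^ total_degree \<alpha>) has_sum s) UNIV" "0 \<le> s" "s \<le> N"
    "\<And>z. z \<in> cube \<rho> \<Longrightarrow> ((\<lambda>\<alpha>. a \<alpha> * monomial \<alpha> z) has_sum f z) UNIV"
proof -
  obtain a s where as: "\<rho> > 0" "((\<lambda>\<alpha>. \<bar>a \<alpha>\<bar> * \<rho> ^ total_degree \<alpha>) has_sum s) UNIV" "s \<le> N"
    "\<And>z. z \<in> cube \<rho> \<Longrightarrow> ((\<lambda>\<alpha>. a \<alpha> * monomial \<alpha> z) has_sum f z) UNIV"
    using assms unfolding analytic_norm_le_def by blast
  moreover have "0 \<le> s" by (rule has_sum_nonneg[OF as(2)]) (use as(1) in simp)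
  ultimately show ?thesis using that by blast
qed

lemma analytic_norm_le_bound:
  assumes "analytic_norm_le \<rho> N f" "z \<in> cube \<rho>"
  shows "\<bar>f z\<bar> \<le> N"
proof -
  obtain a s where as: "\<rho> > 0" "((\<lambda>\<alpha>. \<bar>a \<alpha>\<bar> * \<rho> ^ total_degree \<alpha>) has_sum s) UNIV" "0 \<le> s" "s \<le> N"
    "\<And>z. z \<in> cube \<rho> \<Longrightarrow> ((\<lambda>\<alpha>. a \<alpha> * monomial \<alpha> z) has_sum f z) UNIV"
    by (rule analytic_norm_leE[OF assms(1)]) blast
  have le: "\<bar>a \<alpha> * monomial \<alpha> z\<bar> \<le> \<bar>a \<alpha>\<bar> * \<rho> ^ total_degree \<alpha>" for \<alpha>
    unfolding abs_mult by (intro mult_left_mono abs_monomial_le assms(2)) simp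
  have t: "((\<lambda>\<alpha>. \<bar>a \<alpha> * monomial \<alpha> z\<bar>) has_sum infsum (\<lambda>\<alpha>. \<bar>a \<alpha> * monomial \<alpha> z\<bar>) UNIV) UNIV"
    by (rule has_sum_infsum[OF has_sum_real_summable_abs[OF as(5)[OF assms(2)]]])
  have "\<bar>f z\<bar> \<le> infsum (\<lambda>\<alpha>. \<bar>a \<alpha> * monomial \<alpha> z\<bar>) UNIV"
    using norm_has_sum_bound[OF _ as(5)[OF assms(2)]] t by simp
  also have "\<dots> \<le> s" by (rule has_sum_mono[OF t as(2)]) (rule le)
  finally show ?thesis using as(4) by simp
qed

lemma analytic_norm_le_nonneg: "analytic_norm_le \<rho> N f \<Longrightarrow> N \<ge> 0"
  by (rule analytic_norm_leE) auto

lemma analytic_norm_le_radius: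
  assumes "analytic_norm_le \<rho> N f" "0 < \<sigma>" "\<sigma> \<le> \<rho>"
  shows "analytic_norm_le \<sigma> N f"
proof -
  obtain a s where as: "\<rho> > 0" "((\<lambda>\<alpha>. \<bar>a \<alpha>\<bar> * \<rho> ^ total_degree \<alpha>) has_sum s) UNIV" "0 \<le> s" "s \<le> N"
    "\<And>z. z \<in> cube \<rho> \<Longrightarrow> ((\<lambda>\<alpha>. a \<alpha> * monomial \<alpha> z) has_sum f z) UNIV"
    by (rule analytic_norm_leE[OF assms(1)]) blast
  have le: "\<bar>a \<alpha>\<bar> * \<sigma> ^ total_degree \<alpha> \<le> \<bar>a \<alpha>\<bar> * \<rho> ^ total_degree \<alpha>" for \<alpha>
    using assms(2,3) by (intro mult_left_mono power_mono) auto
  have summ: "(\<lambda>\<alpha>. \<bar>a \<alpha>\<bar> * \<sigma> ^ total_degree \<alpha>) summable_on UNIV"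
    by (rule summable_on_real_comparison[OF has_sum_imp_summable[OF as(2)]])
       (use le assms(2) in \<open>simp add: abs_mult\<close>)
  show ?thesis
    by (rule analytic_norm_leI[OF assms(2) has_sum_infsum[OF summ]])
       (use has_sum_mono[OF has_sum_infsum[OF summ] as(2) le] as(4,5) cube_mono[OF assms(3)] in auto)
qed

text \<open>Without a constant term every monomial gains at least one factor \<open>\<sigma> / \<rho>\<close> when the radius
  shrinks.\<close>

lemma analytic_norm_le_vanishing:
  assumes "analytic_norm_le \<rho> N f" "f 0 = 0" "0 < \<sigma>" "\<sigma> \<le> \<rho>"
  shows "analytic_norm_le \<sigma> (\<sigma> / \<rho> * N) f"
proof -
  obtain a s where as: "\<rho> > 0" "((\<lambda>\<alpha>. \<bar>a \<alpha>\<bar> * \<rho> ^ total_degree \<alpha>) has_sum s) UNIV" "0 \<le> s" "s \<le> N"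
    "\<And>z. z \<in> cube \<rho> \<Longrightarrow> ((\<lambda>\<alpha>. a \<alpha> * monomial \<alpha> z) has_sum f z) UNIV"
    by (rule analytic_norm_leE[OF assms(1)]) blast
  have "(0::real^'a) \<in> cube \<rho>" using as(1) by (simp add: cube_def)
  from as(5)[OF this] have f0: "((\<lambda>\<alpha>. a \<alpha> * monomial \<alpha> 0) has_sum 0) UNIV"
    using assms(2) by simp
  have "monomial \<alpha> (0::real^'a) = 0" if "\<alpha> \<noteq> (\<lambda>_. 0)" for \<alpha> :: "'a \<Rightarrow> nat"
    using that by (auto simp: monomial_def fun_eq_iff)
  then have "((\<lambda>\<alpha>. a \<alpha> * monomial \<alpha> 0) has_sum 0) {\<lambda>_. 0}"
    using f0 by (subst has_sum_cong_neutral[where S = "{\<lambda>_. 0}" and T = UNIV]) auto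
  then have a0: "a (\<lambda>_. 0) = 0"
    by (simp add: has_sum_finite_iff)
  have le: "\<bar>a \<alpha>\<bar> * \<sigma> ^ total_degree \<alpha> \<le> \<sigma> / \<rho> * (\<bar>a \<alpha>\<bar> * \<rho> ^ total_degree \<alpha>)" for \<alpha>
  proof (cases "\<alpha> = (\<lambda>_. 0)")
    case False
    then have "total_degree \<alpha> \<noteq> 0" by (auto simp: total_degree_def fun_eq_iff)
    then obtain k where k: "total_degree \<alpha> = Suc k" using not0_implies_Suc by blast
    have "\<sigma> * \<sigma> ^ k \<le> \<sigma> * \<rho> ^ k" using assms(3,4) by (intro mult_left_mono power_mono) auto
    then have "\<sigma> ^ total_degree \<alpha> \<le> \<sigma> / \<rho> * \<rho> ^ total_degree \<alpha>" using as(1) k by simp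
    from mult_left_mono[OF this, of "\<bar>a \<alpha>\<bar>"] show ?thesis by (simp add: mult_ac)
  qed (simp add: a0)
  have s': "((\<lambda>\<alpha>. \<sigma> / \<rho> * (\<bar>a \<alpha>\<bar> * \<rho> ^ total_degree \<alpha>)) has_sum (\<sigma> / \<rho> * s)) UNIV"
    by (rule has_sum_cmult_right[OF as(2)])
  have summ: "(\<lambda>\<alpha>. \<bar>a \<alpha>\<bar> * \<sigma> ^ total_degree \<alpha>) summable_on UNIV"
    by (rule summable_on_real_comparison[OF has_sum_imp_summable[OF s']])
       (use le assms(3) in \<open>simp add: abs_mult\<close>)
  have "\<sigma> / \<rho> * s \<le> \<sigma> / \<rho> * N" using as(1,4) assms(3) by (intro mult_left_mono) auto
  then show ?thesis
    by (intro analytic_norm_leI[OF assms(3) has_sum_infsum[OF summ]])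
       (use has_sum_mono[OF has_sum_infsum[OF summ] s' le] as(5) cube_mono[OF assms(4)] in auto)
qed

lemma analytic_norm_le_const: "\<rho> > 0 \<Longrightarrow> analytic_norm_le \<rho> \<bar>c\<bar> (\<lambda>_. c)"
  by (rule analytic_norm_leI[where J = "{()}" and c = "\<lambda>_. c" and m = "\<lambda>_ _. 0"])
     (auto intro!: has_sum_finiteI)

lemma analytic_norm_le_nth: "\<rho> > 0 \<Longrightarrow> analytic_norm_le \<rho> \<rho> (\<lambda>z. z $ i)"
  by (rule analytic_norm_leI[where J = "{()}" and c = "\<lambda>_. 1" and m = "\<lambda>_ j. if j = i then 1 else 0"])
     (auto intro!: has_sum_finiteI simp: monomial_axis[simplified] total_degree_axis[simplified])

text \<open>Completeness of the Banach algebra, in the form in which it is used: for substitution of power series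
  and for telescoping sums of Picard iterates.\<close>

lemma analytic_norm_le_infsum:
  assumes "\<And>j. j \<in> J \<Longrightarrow> analytic_norm_le \<rho> (N j) (f j)" "(N has_sum s) J" "s \<le> N'" "\<rho> > 0"
    and F: "\<And>z. z \<in> cube \<rho> \<Longrightarrow> ((\<lambda>j. f j z) has_sum F z) J"
  shows "analytic_norm_le \<rho> N' F"
proof -
  define P where "P j a s \<longleftrightarrow> ((\<lambda>\<alpha>. \<bar>a \<alpha>\<bar> * \<rho> ^ total_degree \<alpha>) has_sum s) UNIV \<and> 0 \<le> s \<and> s \<le> N j \<and>
    (\<forall>z\<in>cube \<rho>. ((\<lambda>\<alpha>. a \<alpha> * monomial \<alpha> z) has_sum f j z) UNIV)" for j a s
  have "\<exists>a s. P j a s" if "j \<in> J" for j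
    unfolding P_def by (rule analytic_norm_leE[OF assms(1)[OF that]]) blast
  then obtain a t where "\<And>j. j \<in> J \<Longrightarrow> P j (a j) (t j)" by metis
  then have at: "\<And>j. j \<in> J \<Longrightarrow> ((\<lambda>\<alpha>. \<bar>a j \<alpha>\<bar> * \<rho> ^ total_degree \<alpha>) has_sum t j) UNIV"
    "\<And>j. j \<in> J \<Longrightarrow> 0 \<le> t j" "\<And>j. j \<in> J \<Longrightarrow> t j \<le> N j"
    "\<And>j z. j \<in> J \<Longrightarrow> z \<in> cube \<rho> \<Longrightarrow> ((\<lambda>\<alpha>. a j \<alpha> * monomial \<alpha> z) has_sum f j z) UNIV"
    unfolding P_def by blast+
  have t: "t summable_on J"
    by (rule summable_on_real_comparison[OF has_sum_imp_summable[OF assms(2)]]) (use at(2,3) in auto)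
  define M where "M = (\<lambda>(j, \<alpha>). \<bar>a j \<alpha>\<bar> * \<rho> ^ total_degree \<alpha>)"
  have M: "M summable_on J \<times> UNIV"
    unfolding M_def by (rule summable_on_SigmaI[OF _ t]) (use at(1) \<open>\<rho> > 0\<close> in auto)
  have "(M has_sum infsum t J) (J \<times> UNIV)"
    by (rule has_sum_SigmaI[OF _ has_sum_infsum[OF t] M]) (use at(1) in \<open>simp add: M_def\<close>)
  then have 1: "((\<lambda>p. \<bar>(\<lambda>(j, \<alpha>). a j \<alpha>) p\<bar> * \<rho> ^ total_degree (snd p)) has_sum infsum t J) (J \<times> UNIV)"
    by (simp add: M_def case_prod_unfold)
  have 2: "infsum t J \<le> N'"
    using has_sum_mono[OF has_sum_infsum[OF t] assms(2) at(3)] assms(3) by linarith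
  have 3: "((\<lambda>p. (\<lambda>(j, \<alpha>). a j \<alpha>) p * monomial (snd p) z) has_sum F z) (J \<times> UNIV)"
    if "z \<in> cube \<rho>" for z
  proof (rule has_sum_SigmaI[OF _ F[OF that]])
    show "(\<lambda>p. (\<lambda>(j, \<alpha>). a j \<alpha>) p * monomial (snd p) z) summable_on J \<times> UNIV"
      by (rule summable_on_real_comparison[OF M])
         (auto simp: M_def abs_mult intro!: mult_left_mono abs_monomial_le that)
  qed (use at(4) that in auto)
  show ?thesis
    by (rule analytic_norm_leI[OF \<open>\<rho> > 0\<close> 1 2 3])
qed

lemma analytic_norm_le_add:
  assumes "analytic_norm_le \<rho> M f" "analytic_norm_le \<rho> N g"
  shows "analytic_norm_le \<rho> (M + N) (\<lambda>z. f z + g z)"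
  by (rule analytic_norm_le_infsum[where J = UNIV and N = "\<lambda>b. if b then M else N"
        and f = "\<lambda>b. if b then f else g" and s = "M + N"])
     (use assms analytic_norm_le_pos in \<open>auto intro!: has_sum_finiteI simp: UNIV_bool\<close>)

lemma analytic_norm_le_mult:
  assumes "analytic_norm_le \<rho> M f" "analytic_norm_le \<rho> N g"
  shows "analytic_norm_le \<rho> (M * N) (\<lambda>z. f z * g z)"
proof -
  obtain a s where a: "\<rho> > 0" "((\<lambda>\<alpha>. \<bar>a \<alpha>\<bar> * \<rho> ^ total_degree \<alpha>) has_sum s) UNIV" "0 \<le> s" "s \<le> M"
    "\<And>z. z \<in> cube \<rho> \<Longrightarrow> ((\<lambda>\<alpha>. a \<alpha> * monomial \<alpha> z) has_sum f z) UNIV"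
    by (rule analytic_norm_leE[OF assms(1)]) blast
  obtain b t where b: "\<rho> > 0" "((\<lambda>\<alpha>. \<bar>b \<alpha>\<bar> * \<rho> ^ total_degree \<alpha>) has_sum t) UNIV" "0 \<le> t" "t \<le> N"
    "\<And>z. z \<in> cube \<rho> \<Longrightarrow> ((\<lambda>\<alpha>. b \<alpha> * monomial \<alpha> z) has_sum g z) UNIV"
    by (rule analytic_norm_leE[OF assms(2)]) blast
  define m :: "('a \<Rightarrow> nat) \<times> ('a \<Rightarrow> nat) \<Rightarrow> 'a \<Rightarrow> nat" where "m = (\<lambda>(\<alpha>, \<beta>) i. \<alpha> i + \<beta> i)"
  show ?thesis
  proof (rule analytic_norm_leI[OF a(1), where J = "UNIV \<times> UNIV" and c = "\<lambda>(\<alpha>, \<beta>). a \<alpha> * b \<beta>" and m = m])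
    show "((\<lambda>j. \<bar>case j of (\<alpha>, \<beta>) \<Rightarrow> a \<alpha> * b \<beta>\<bar> * \<rho> ^ total_degree (m j)) has_sum s * t) (UNIV \<times> UNIV)"
      using has_sum_mult_abs[OF a(2) b(2)]
      by (simp add: m_def case_prod_unfold total_degree_add power_add abs_mult mult_ac)
    show "s * t \<le> M * N"
      using a b by (intro mult_mono) auto
    fix z :: "real^'a" assume "z \<in> cube \<rho>"
    show "((\<lambda>j. (case j of (\<alpha>, \<beta>) \<Rightarrow> a \<alpha> * b \<beta>) * monomial (m j) z) has_sum f z * g z) (UNIV \<times> UNIV)"
      using has_sum_mult_abs[OF a(5) b(5), OF \<open>z \<in> cube \<rho>\<close> \<open>z \<in> cube \<rho>\<close>]
      by (simp add: m_def case_prod_unfold monomial_add mult_ac)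
  qed
qed

lemma analytic_norm_le_cmult:
  "analytic_norm_le \<rho> N f \<Longrightarrow> analytic_norm_le \<rho> (\<bar>c\<bar> * N) (\<lambda>z. c * f z)"
  by (rule analytic_norm_le_mult[OF analytic_norm_le_const]) (auto dest: analytic_norm_le_pos)

lemma analytic_norm_le_power:
  "analytic_norm_le \<rho> N f \<Longrightarrow> analytic_norm_le \<rho> (N ^ k) (\<lambda>z. f z ^ k)"
proof (induction k)
  case 0
  then show ?case using analytic_norm_le_const[OF analytic_norm_le_pos, of \<rho> N f 1] by simp
next
  case (Suc k)
  then show ?case using analytic_norm_le_mult[of \<rho> N f "N ^ k"] by simp
qed

lemma analytic_norm_le_prod:
  assumes "finite I" "\<rho> > 0" "\<And>i. i \<in> I \<Longrightarrow> analytic_norm_le \<rho> (N i) (f i)"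
  shows "analytic_norm_le \<rho> (\<Prod>i\<in>I. N i) (\<lambda>z. \<Prod>i\<in>I. f i z)"
  using assms(1,3)
proof (induction I)
  case empty
  then show ?case using analytic_norm_le_const[OF assms(2), of 1] by simp
next
  case (insert i I)
  then show ?case by (simp add: analytic_norm_le_mult)
qed

lemma analytic_norm_le_monomial:
  assumes "\<rho> > 0" "\<And>i. analytic_norm_le \<rho> R (\<lambda>z. u z $ i)"
  shows "analytic_norm_le \<rho> (R ^ total_degree \<alpha>) (\<lambda>z. monomial \<alpha> (u z))"
  unfolding monomial_def prod_const_power_total_degree[symmetric]
  by (intro analytic_norm_le_prod analytic_norm_le_power assms) simp

text \<open>The norm of the monomial \<open>u\<^sup>\<alpha>\<close> is at most \<open>R\<^bsup>\<bar>\<alpha>\<bar>\<^esup>\<close>, which is the weight of the coefficient of \<open>z\<^sup>\<alpha>\<close> in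
  the norm of \<open>F\<close>.\<close>

lemma analytic_norm_le_compose:
  fixes F :: "real^'b::finite \<Rightarrow> real" and u :: "real^'a::finite \<Rightarrow> real^'b"
  assumes F: "analytic_norm_le R N F" and u: "\<And>i. analytic_norm_le \<rho> R (\<lambda>z. u z $ i)"
  shows "analytic_norm_le \<rho> N (\<lambda>z. F (u z))"
proof -
  have "\<rho> > 0" using u analytic_norm_le_pos by blast
  obtain a s where a: "R > 0" "((\<lambda>\<alpha>. \<bar>a \<alpha>\<bar> * R ^ total_degree \<alpha>) has_sum s) UNIV" "0 \<le> s" "s \<le> N"
    "\<And>z. z \<in> cube R \<Longrightarrow> ((\<lambda>\<alpha>. a \<alpha> * monomial \<alpha> z) has_sum F z) UNIV"
    by (rule analytic_norm_leE[OF F]) blast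
  show ?thesis
  proof (rule analytic_norm_le_infsum[OF _ a(2,4) \<open>\<rho> > 0\<close>])
    show "analytic_norm_le \<rho> (\<bar>a \<alpha>\<bar> * R ^ total_degree \<alpha>) (\<lambda>z. a \<alpha> * monomial \<alpha> (u z))" for \<alpha>
      by (intro analytic_norm_le_cmult analytic_norm_le_monomial \<open>\<rho> > 0\<close> u)
    fix z :: "real^'a" assume "z \<in> cube \<rho>"
    then have "u z \<in> cube R"
      using analytic_norm_le_bound[OF u] by (simp add: cube_def)
    then show "((\<lambda>\<alpha>. a \<alpha> * monomial \<alpha> (u z)) has_sum F (u z)) UNIV" by (rule a(5))
  qed
qed

lemma analytic_norm_le_diff_mult:
  assumes "analytic_norm_le \<rho> A f'" "analytic_norm_le \<rho> B g"
    and "analytic_norm_le \<rho> (K * d) (\<lambda>z. f z - f' z)" "analytic_norm_le \<rho> (L * d) (\<lambda>z. g z - g' z)"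
  shows "analytic_norm_le \<rho> ((K * B + A * L) * d) (\<lambda>z. f z * g z - f' z * g' z)"
proof -
  have "analytic_norm_le \<rho> (K * d * B + A * (L * d)) (\<lambda>z. (f z - f' z) * g z + f' z * (g z - g' z))"
    by (intro analytic_norm_le_add analytic_norm_le_mult assms)
  then show ?thesis by (simp add: algebra_simps)
qed

lemma analytic_norm_le_diff_power:
  assumes "R > 0" "analytic_norm_le \<rho> R f" "analytic_norm_le \<rho> R g" "analytic_norm_le \<rho> d (\<lambda>z. f z - g z)"
  shows "analytic_norm_le \<rho> (real k * R ^ k / R * d) (\<lambda>z. f z ^ k - g z ^ k)"
proof (induction k)
  case 0
  then show ?case using analytic_norm_le_const[OF analytic_norm_le_pos[OF assms(2)], of 0] by simp
next
  case (Suc k)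
  have d: "analytic_norm_le \<rho> (1 * d) (\<lambda>z. f z - g z)" using assms(4) by simp
  have "analytic_norm_le \<rho> ((1 * R ^ k + R * (real k * R ^ k / R)) * d) (\<lambda>z. f z * f z ^ k - g z * g z ^ k)"
    by (rule analytic_norm_le_diff_mult[OF assms(3) analytic_norm_le_power[OF assms(2)] d Suc])
  moreover have "(1 * R ^ k + R * (real k * R ^ k / R)) * d = real (Suc k) * R ^ Suc k / R * d"
    using \<open>R > 0\<close> by (simp add: field_simps)
  ultimately show ?case by (simp only: power_Suc)
qed

text \<open>Telescoping: replacing the factors of \<open>u\<^sup>\<alpha>\<close> one at a time changes one of \<open>\<bar>\<alpha>\<bar>\<close> factors by \<open>d\<close> and keeps
  the others bounded by \<open>R\<close>. The bound is \<open>\<bar>\<alpha>\<bar> R\<^bsup>\<bar>\<alpha>\<bar>-1\<^esup> d\<close>, written so that degree \<open>0\<close> is no special case.\<close>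

lemma analytic_norm_le_diff_monomial:
  assumes "R > 0" "\<And>i. analytic_norm_le \<rho> R (\<lambda>z. u z $ i)" "\<And>i. analytic_norm_le \<rho> R (\<lambda>z. v z $ i)"
    and "\<And>i. analytic_norm_le \<rho> d (\<lambda>z. u z $ i - v z $ i)"
  shows "analytic_norm_le \<rho> (real (total_degree \<alpha>) * R ^ total_degree \<alpha> / R * d)
           (\<lambda>z. monomial \<alpha> (u z) - monomial \<alpha> (v z))"
proof -
  have pos: "\<rho> > 0" using assms(2) analytic_norm_le_pos by blast
  have "analytic_norm_le \<rho> (real (sum \<alpha> I) * R ^ sum \<alpha> I / R * d)
           (\<lambda>z. (\<Prod>i\<in>I. u z $ i ^ \<alpha> i) - (\<Prod>i\<in>I. v z $ i ^ \<alpha> i))" if "finite I" for I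
    using that
  proof (induction I)
    case empty
    then show ?case using analytic_norm_le_const[OF pos, of 0] by simp
  next
    case (insert i I)
    have p: "analytic_norm_le \<rho> (R ^ sum \<alpha> I) (\<lambda>z. \<Prod>i\<in>I. u z $ i ^ \<alpha> i)"
      unfolding power_sum by (intro analytic_norm_le_prod analytic_norm_le_power insert.hyps pos assms)
    have "analytic_norm_le \<rho>
        (((real (\<alpha> i) * R ^ \<alpha> i / R) * R ^ sum \<alpha> I + R ^ \<alpha> i * (real (sum \<alpha> I) * R ^ sum \<alpha> I / R)) * d)
        (\<lambda>z. u z $ i ^ \<alpha> i * (\<Prod>i\<in>I. u z $ i ^ \<alpha> i) - v z $ i ^ \<alpha> i * (\<Prod>i\<in>I. v z $ i ^ \<alpha> i))"
      by (rule analytic_norm_le_diff_mult[OF analytic_norm_le_power[OF assms(3)] p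
            analytic_norm_le_diff_power[OF assms] insert.IH])
    then show ?case using insert.hyps \<open>R > 0\<close> by (simp add: field_simps power_add)
  qed
  from this[of UNIV] show ?thesis by (simp add: monomial_def total_degree_def)
qed

text \<open>Bernoulli's inequality: the derivative of a power at \<open>R\<close> is at most its difference quotient up
  to \<open>R0\<close>. It pays for one differentiation with a smaller radius.\<close>

lemma degree_power_le_larger_radius:
  fixes R R0 :: real
  assumes "0 < R" "R < R0"
  shows "real k * R ^ k / R \<le> R0 ^ k / (R0 - R)"
proof -
  have "real k * R ^ k * (R0 - R) \<le> R * R0 ^ k"
  proof (induction k)
    case (Suc k)
    have "R ^ k \<le> R0 ^ k" using assms by (intro power_mono) auto
    then have "R * (R0 - R) * R ^ k \<le> R * (R0 - R) * R0 ^ k"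
      using assms by (intro mult_left_mono) auto
    moreover have "R * (real k * R ^ k * (R0 - R)) \<le> R * (R * R0 ^ k)"
      using Suc assms by (intro mult_left_mono) auto
    ultimately show ?case by (simp add: algebra_simps)
  qed (use assms in simp)
  then show ?thesis using assms by (simp add: field_simps)
qed

text \<open>Cauchy's estimate for the derivative of \<open>F\<close> at distance \<open>R0 - R\<close> from the boundary, obtained
  termwise.\<close>

lemma analytic_norm_le_lipschitz:
  fixes F :: "real^'b::finite \<Rightarrow> real" and u v :: "real^'a::finite \<Rightarrow> real^'b"
  assumes F: "analytic_norm_le R0 N F" and R: "0 < R" "R < R0"
    and u: "\<And>i. analytic_norm_le \<rho> R (\<lambda>z. u z $ i)" and v: "\<And>i. analytic_norm_le \<rho> R (\<lambda>z. v z $ i)"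
    and d: "\<And>i. analytic_norm_le \<rho> d (\<lambda>z. u z $ i - v z $ i)"
  shows "analytic_norm_le \<rho> (N / (R0 - R) * d) (\<lambda>z. F (u z) - F (v z))"
proof -
  have "\<rho> > 0" "d \<ge> 0" using d analytic_norm_le_pos analytic_norm_le_nonneg by blast+
  obtain a s where a: "R0 > 0" "((\<lambda>\<alpha>. \<bar>a \<alpha>\<bar> * R0 ^ total_degree \<alpha>) has_sum s) UNIV" "0 \<le> s" "s \<le> N"
    "\<And>z. z \<in> cube R0 \<Longrightarrow> ((\<lambda>\<alpha>. a \<alpha> * monomial \<alpha> z) has_sum F z) UNIV"
    by (rule analytic_norm_leE[OF F]) blast
  have sum: "((\<lambda>\<alpha>. d / (R0 - R) * (\<bar>a \<alpha>\<bar> * R0 ^ total_degree \<alpha>)) has_sum (d / (R0 - R) * s)) UNIV"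
    by (rule has_sum_cmult_right[OF a(2)])
  have "s / (R0 - R) \<le> N / (R0 - R)" using a(4) R by (intro divide_right_mono) auto
  then have le: "d / (R0 - R) * s \<le> N / (R0 - R) * d"
    using mult_left_mono[of "s / (R0 - R)" "N / (R0 - R)" d] \<open>d \<ge> 0\<close> by (simp add: mult.commute)
  show ?thesis
  proof (rule analytic_norm_le_infsum[OF _ sum le \<open>\<rho> > 0\<close>])
    fix \<alpha> :: "'b \<Rightarrow> nat"
    have "\<bar>a \<alpha>\<bar> * (real (total_degree \<alpha>) * R ^ total_degree \<alpha> / R * d) \<le> \<bar>a \<alpha>\<bar> * (R0 ^ total_degree \<alpha> / (R0 - R) * d)"
      by (intro mult_left_mono mult_right_mono degree_power_le_larger_radius R \<open>d \<ge> 0\<close>) simp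
    then show "analytic_norm_le \<rho> (d / (R0 - R) * (\<bar>a \<alpha>\<bar> * R0 ^ total_degree \<alpha>))
        (\<lambda>z. a \<alpha> * (monomial \<alpha> (u z) - monomial \<alpha> (v z)))"
      by (intro analytic_norm_le_mono[OF analytic_norm_le_cmult[OF analytic_norm_le_diff_monomial[OF R(1) u v d]]])
         (simp add: mult_ac)
  next
    fix z :: "real^'a" assume z: "z \<in> cube \<rho>"
    have "u z \<in> cube R0" "v z \<in> cube R0"
      using analytic_norm_le_bound[OF u z] analytic_norm_le_bound[OF v z] R
      by (auto simp: cube_def intro: order_trans[OF _ less_imp_le])
    from has_sum_add[OF a(5)[OF this(1)] has_sum_uminusI[OF a(5)[OF this(2)]]]
    show "((\<lambda>\<alpha>. a \<alpha> * (monomial \<alpha> (u z) - monomial \<alpha> (v z))) has_sum F (u z) - F (v z)) UNIV"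
      by (simp add: right_diff_distrib)
  qed
qed

lemma monomial_uniform_limit:
  assumes "((\<lambda>\<alpha>. \<bar>a \<alpha>\<bar> * \<rho> ^ total_degree \<alpha>) has_sum s) UNIV"
    and "\<And>z. z \<in> cube \<rho> \<Longrightarrow> ((\<lambda>\<alpha>. a \<alpha> * monomial \<alpha> z) has_sum f z) UNIV"
  shows "uniform_limit (cube \<rho>) (\<lambda>X z. \<Sum>\<alpha>\<in>X. a \<alpha> * monomial \<alpha> z) f (finite_subsets_at_top UNIV)"
  by (rule Weierstrass_m_test_general'[OF _ assms(2) has_sum_imp_summable[OF assms(1)]])
     (auto simp: abs_mult intro!: mult_left_mono abs_monomial_le)

lemma continuous_on_monomial: "continuous_on S (monomial \<alpha>)"
  unfolding monomial_def[abs_def] by (intro continuous_intros)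

lemma analytic_norm_le_continuous_on:
  assumes "analytic_norm_le \<rho> N f"
  shows "continuous_on (cube \<rho>) f"
proof -
  obtain a s where a: "\<rho> > 0" "((\<lambda>\<alpha>. \<bar>a \<alpha>\<bar> * \<rho> ^ total_degree \<alpha>) has_sum s) UNIV" "0 \<le> s" "s \<le> N"
    "\<And>z. z \<in> cube \<rho> \<Longrightarrow> ((\<lambda>\<alpha>. a \<alpha> * monomial \<alpha> z) has_sum f z) UNIV"
    by (rule analytic_norm_leE[OF assms]) blast
  show ?thesis
    by (rule uniform_limit_theorem[OF _ monomial_uniform_limit[OF a(2,5)]])
       (auto intro!: always_eventually continuous_intros continuous_on_monomial)
qed

lemma monomial_axis_scale: "monomial \<alpha> (axis_scale e s z) = s ^ \<alpha> e * monomial \<alpha> z"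
proof -
  have "monomial \<alpha> (axis_scale e s z) = (s * z $ e) ^ \<alpha> e * (\<Prod>i\<in>UNIV - {e}. z $ i ^ \<alpha> i)"
    unfolding monomial_def by (subst prod.remove[of _ e]) (auto simp: axis_scale_nth intro!: prod.cong)
  also have "\<dots> = s ^ \<alpha> e * monomial \<alpha> z"
    unfolding monomial_def by (subst (2) prod.remove[of _ e]) (auto simp: power_mult_distrib)
  finally show ?thesis .
qed

lemma has_integral_power_unit: "((\<lambda>s::real. s ^ k) has_integral 1 / real (Suc k)) {0..1}"
proof -
  have "((\<lambda>s::real. s ^ k) has_integral 1 ^ Suc k / real (Suc k) - 0 ^ Suc k / real (Suc k)) {0..1}"
    by (rule fundamental_theorem_of_calculus)
       (auto intro!: derivative_eq_intros simp flip: has_real_derivative_iff_has_vector_derivative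
         simp del: of_nat_Suc power_Suc)
  then show ?thesis by simp
qed

text \<open>Integration divides the coefficient of \<open>z\<^sup>\<alpha>\<close> by \<open>\<alpha>\<^sub>e + 1\<close> and raises the degree by one, which costs a
  factor \<open>\<rho>\<close>. The sum and the integral may be interchanged by uniform convergence.\<close>

lemma analytic_norm_le_axis_integral:
  assumes "analytic_norm_le \<rho> N f"
  shows "analytic_norm_le \<rho> (\<rho> * N) (axis_integral e f)"
proof -
  obtain a s where a: "\<rho> > 0" "((\<lambda>\<alpha>. \<bar>a \<alpha>\<bar> * \<rho> ^ total_degree \<alpha>) has_sum s) UNIV" "0 \<le> s" "s \<le> N"
    "\<And>z. z \<in> cube \<rho> \<Longrightarrow> ((\<lambda>\<alpha>. a \<alpha> * monomial \<alpha> z) has_sum f z) UNIV"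
    by (rule analytic_norm_leE[OF assms]) blast
  define c where "c \<alpha> = a \<alpha> / real (Suc (\<alpha> e))" for \<alpha>
  define m where "m \<alpha> = (\<lambda>i. \<alpha> i + (if i = e then 1 else 0::nat))" for \<alpha>
  have deg: "total_degree (m \<alpha>) = Suc (total_degree \<alpha>)" for \<alpha>
    unfolding m_def total_degree_add total_degree_axis by simp
  have mon: "monomial (m \<alpha>) z = monomial \<alpha> z * z $ e" for \<alpha> z
    unfolding m_def monomial_add monomial_axis by simp
  have le: "\<bar>c \<alpha>\<bar> * \<rho> ^ total_degree (m \<alpha>) \<le> \<rho> * (\<bar>a \<alpha>\<bar> * \<rho> ^ total_degree \<alpha>)" for \<alpha>
  proof -
    have "\<bar>c \<alpha>\<bar> \<le> \<bar>a \<alpha>\<bar>" unfolding c_def abs_divide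
      by (rule divide_le_eq[THEN iffD2]) (auto simp: mult_left_mono algebra_simps)
    then have "\<bar>c \<alpha>\<bar> * (\<rho> * \<rho> ^ total_degree \<alpha>) \<le> \<bar>a \<alpha>\<bar> * (\<rho> * \<rho> ^ total_degree \<alpha>)"
      using a(1) by (intro mult_right_mono) auto
    then show ?thesis by (simp add: deg mult_ac)
  qed
  have sum: "((\<lambda>\<alpha>. \<rho> * (\<bar>a \<alpha>\<bar> * \<rho> ^ total_degree \<alpha>)) has_sum \<rho> * s) UNIV"
    by (rule has_sum_cmult_right[OF a(2)])
  have summ: "(\<lambda>\<alpha>. \<bar>c \<alpha>\<bar> * \<rho> ^ total_degree (m \<alpha>)) summable_on UNIV"
    by (rule summable_on_real_comparison[OF has_sum_imp_summable[OF sum]])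
       (use le a(1) in \<open>simp add: abs_mult\<close>)
  show ?thesis
  proof (rule analytic_norm_leI[OF a(1) has_sum_infsum[OF summ]])
    show "infsum (\<lambda>\<alpha>. \<bar>c \<alpha>\<bar> * \<rho> ^ total_degree (m \<alpha>)) UNIV \<le> \<rho> * N"
      using has_sum_mono[OF has_sum_infsum[OF summ] sum le] a(1,4) mult_left_mono[of s N \<rho>] by linarith
    fix z :: "real^'a" assume z: "z \<in> cube \<rho>"
    have "uniform_limit {0..1} (\<lambda>X t. \<Sum>\<alpha>\<in>X. a \<alpha> * monomial \<alpha> (axis_scale e t z))
        (\<lambda>t. f (axis_scale e t z)) (finite_subsets_at_top UNIV)"
      using uniform_limit_compose'[OF monomial_uniform_limit[OF a(2,5)], of "\<lambda>t. axis_scale e t z" "{0..1}"]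
        axis_scale_in_cube[OF _ z] by auto
    then have u: "uniform_limit {0..1} (\<lambda>X t. \<Sum>\<alpha>\<in>X. a \<alpha> * (t ^ \<alpha> e * monomial \<alpha> z))
        (\<lambda>t. f (axis_scale e t z)) (finite_subsets_at_top UNIV)"
      by (simp add: monomial_axis_scale)
    obtain I J where IJ: "\<And>X. ((\<lambda>t. \<Sum>\<alpha>\<in>X. a \<alpha> * (t ^ \<alpha> e * monomial \<alpha> z)) has_integral I X) {0..1}"
      "((\<lambda>t. f (axis_scale e t z)) has_integral J) {0..1}" "(I \<longlongrightarrow> J) (finite_subsets_at_top UNIV)"
      by (rule uniform_limit_integral[OF u]) (auto intro!: continuous_intros)
    have I: "I X = (\<Sum>\<alpha>\<in>X. c \<alpha> * monomial \<alpha> z)" for X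
    proof (cases "finite X")
      case True
      have "((\<lambda>t. \<Sum>\<alpha>\<in>X. a \<alpha> * (t ^ \<alpha> e * monomial \<alpha> z)) has_integral
          (\<Sum>\<alpha>\<in>X. a \<alpha> * (1 / real (Suc (\<alpha> e)) * monomial \<alpha> z))) {0..1}"
        by (intro has_integral_sum True has_integral_mult_right has_integral_mult_left has_integral_power_unit)
      from has_integral_unique[OF IJ(1) this] show ?thesis by (simp add: c_def)
    next
      case False
      then show ?thesis using has_integral_unique[OF IJ(1)[of X], of 0] by simp
    qed
    have "((\<lambda>\<alpha>. c \<alpha> * monomial \<alpha> z) has_sum J) UNIV"
      using IJ(3) unfolding has_sum_def I[abs_def] .
    from has_sum_cmult_right[OF this, of "z $ e"]
    show "((\<lambda>\<alpha>. c \<alpha> * monomial (m \<alpha>) z) has_sum axis_integral e f z) UNIV"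
      using integral_unique[OF IJ(2)] by (simp add: axis_integral_def mon mult_ac)
  qed
qed

text \<open>For \<open>\<alpha> i = 0\<close> the exponent is truncated to \<open>0\<close> and the factor in front makes the value \<open>0\<close>, as it
  should be.\<close>

definition monomial_partial :: "'n \<Rightarrow> ('n \<Rightarrow> nat) \<Rightarrow> real^'n::finite \<Rightarrow> real" where
  "monomial_partial i \<alpha> x = real (\<alpha> i) * monomial (\<alpha>(i := \<alpha> i - 1)) x"

lemma has_derivative_monomial:
  "(monomial \<alpha> has_derivative (\<lambda>h. \<Sum>i\<in>UNIV. monomial_partial i \<alpha> x * h $ i)) (at x)"
proof -
  have "((\<lambda>x. \<Prod>i\<in>UNIV. x $ i ^ \<alpha> i) has_derivative
      (\<lambda>h. \<Sum>i\<in>UNIV. (of_nat (\<alpha> i) * h $ i * x $ i ^ (\<alpha> i - 1)) * (\<Prod>j\<in>UNIV - {i}. x $ j ^ \<alpha> j))) (at x)"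
    by (intro has_derivative_prod has_derivative_power
        bounded_linear_imp_has_derivative[OF bounded_linear_vec_nth])
  also have "(\<lambda>h. \<Sum>i\<in>UNIV. (of_nat (\<alpha> i) * h $ i * x $ i ^ (\<alpha> i - 1)) * (\<Prod>j\<in>UNIV - {i}. x $ j ^ \<alpha> j)) =
      (\<lambda>h. \<Sum>i\<in>UNIV. monomial_partial i \<alpha> x * h $ i)"
  proof (intro ext sum.cong refl)
    fix h :: "real^'a" and i
    show "(of_nat (\<alpha> i) * h $ i * x $ i ^ (\<alpha> i - 1)) * (\<Prod>j\<in>UNIV - {i}. x $ j ^ \<alpha> j) =
        monomial_partial i \<alpha> x * h $ i"
      unfolding monomial_partial_def monomial_def
      by (subst (2) prod.remove[of _ i]) (auto intro!: prod.cong)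
  qed
  finally show ?thesis unfolding monomial_def[abs_def] .
qed

lemma total_degree_lower: "\<alpha> i > 0 \<Longrightarrow> total_degree \<alpha> = Suc (total_degree (\<alpha>(i := \<alpha> i - 1)))"
  unfolding total_degree_def
  by (subst (1 2) sum.remove[of _ i]) (auto intro!: sum.cong)

text \<open>Power series may be differentiated termwise on a smaller cube. An intermediate radius \<open>\<tau>\<close> is
  used because differentiability is a statement about the interior.\<close>

lemma analytic_norm_le_partial:
  fixes f :: "real^'n::finite \<Rightarrow> real"
  assumes f: "analytic_norm_le \<rho> N f" and \<sigma>: "0 < \<sigma>" "\<sigma> < \<rho>"
  shows "\<And>x. x \<in> cube \<sigma> \<Longrightarrow> f differentiable (at x)"
    and "\<exists>N'. analytic_norm_le \<sigma> N' (partial i f)"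
proof -
  obtain a s where a: "\<rho> > 0" "((\<lambda>\<alpha>. \<bar>a \<alpha>\<bar> * \<rho> ^ total_degree \<alpha>) has_sum s) UNIV" "0 \<le> s" "s \<le> N"
    "\<And>z. z \<in> cube \<rho> \<Longrightarrow> ((\<lambda>\<alpha>. a \<alpha> * monomial \<alpha> z) has_sum f z) UNIV"
    by (rule analytic_norm_leE[OF f]) blast
  define \<tau> where "\<tau> = (\<sigma> + \<rho>) / 2"
  have \<tau>: "\<sigma> < \<tau>" "\<tau> < \<rho>" "0 < \<tau>" using \<sigma> by (auto simp: \<tau>_def)
  define M where "M \<alpha> = 1 / (\<rho> - \<tau>) * (\<bar>a \<alpha>\<bar> * \<rho> ^ total_degree \<alpha>)" for \<alpha> :: "'n \<Rightarrow> nat"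
  have M: "(M has_sum (1 / (\<rho> - \<tau>) * s)) UNIV"
    unfolding M_def by (rule has_sum_cmult_right[OF a(2)])
  have le: "\<bar>a \<alpha> * real (\<alpha> i)\<bar> * \<tau> ^ total_degree (\<alpha>(i := \<alpha> i - 1)) \<le> M \<alpha>" for \<alpha> i
  proof (cases "\<alpha> i = 0")
    case True
    then show ?thesis using \<tau> a(1) by (simp add: M_def)
  next
    case False
    then have d: "\<tau> ^ total_degree (\<alpha>(i := \<alpha> i - 1)) = \<tau> ^ total_degree \<alpha> / \<tau>"
      using total_degree_lower[of \<alpha> i] \<tau>(3) by simp
    have "real (\<alpha> i) \<le> real (total_degree \<alpha>)"
      unfolding total_degree_def by (intro of_nat_mono member_le_sum) auto
    then have "real (\<alpha> i) * (\<tau> ^ total_degree \<alpha> / \<tau>) \<le> real (total_degree \<alpha>) * (\<tau> ^ total_degree \<alpha> / \<tau>)"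
      using \<tau>(3) by (intro mult_right_mono) auto
    also have "\<dots> \<le> \<rho> ^ total_degree \<alpha> / (\<rho> - \<tau>)"
      using degree_power_le_larger_radius[OF \<tau>(3,2)] by simp
    finally have "real (\<alpha> i) * (\<tau> ^ total_degree \<alpha> / \<tau>) \<le> \<rho> ^ total_degree \<alpha> / (\<rho> - \<tau>)" .
    from mult_left_mono[OF this, of "\<bar>a \<alpha>\<bar>"] show ?thesis
      unfolding d M_def abs_mult by (simp add: mult_ac)
  qed
  have term_le: "\<bar>a \<alpha> * monomial_partial i \<alpha> x\<bar> \<le> M \<alpha>" if "x \<in> cube \<tau>" for \<alpha> i x
  proof -
    have "\<bar>a \<alpha> * real (\<alpha> i)\<bar> * \<bar>monomial (\<alpha>(i := \<alpha> i - 1)) x\<bar> \<le>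
        \<bar>a \<alpha> * real (\<alpha> i)\<bar> * \<tau> ^ total_degree (\<alpha>(i := \<alpha> i - 1))"
      by (intro mult_left_mono abs_monomial_le that) simp
    with le[of \<alpha> i] show ?thesis by (simp add: monomial_partial_def abs_mult mult.assoc)
  qed
  define G where "G i x = infsum (\<lambda>\<alpha>. a \<alpha> * monomial_partial i \<alpha> x) UNIV" for i x
  have G: "((\<lambda>\<alpha>. a \<alpha> * monomial_partial i \<alpha> x) has_sum G i x) UNIV" if "x \<in> cube \<tau>" for i x
    unfolding G_def
    by (rule has_sum_infsum[OF summable_on_real_comparison[OF has_sum_imp_summable[OF M] term_le[OF that]]])
  have G_anl: "analytic_norm_le \<tau> (1 / (\<rho> - \<tau>) * s) (G i)" for i
  proof -
    have summ: "(\<lambda>\<alpha>. \<bar>a \<alpha> * real (\<alpha> i)\<bar> * \<tau> ^ total_degree (\<alpha>(i := \<alpha> i - 1))) summable_on UNIV"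
      by (rule summable_on_real_comparison[OF has_sum_imp_summable[OF M]])
         (use le \<tau>(3) in \<open>simp add: abs_mult\<close>)
    show ?thesis
    proof (rule analytic_norm_leI[OF \<tau>(3) has_sum_infsum[OF summ]])
      show "infsum (\<lambda>\<alpha>. \<bar>a \<alpha> * real (\<alpha> i)\<bar> * \<tau> ^ total_degree (\<alpha>(i := \<alpha> i - 1))) UNIV \<le> 1 / (\<rho> - \<tau>) * s"
        by (rule has_sum_mono[OF has_sum_infsum[OF summ] M le])
      show "((\<lambda>\<alpha>. a \<alpha> * real (\<alpha> i) * monomial (\<alpha>(i := \<alpha> i - 1)) z) has_sum G i z) UNIV" if "z \<in> cube \<tau>" for z
        using G[OF that, of i] by (simp add: monomial_partial_def mult.assoc)
    qed
  qed
  \<comment> \<open>an enumeration of the multi-indices turns the power series into a sequence of partial sums\<close>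
  define e where "e = from_nat_into (UNIV :: ('n \<Rightarrow> nat) set)"
  have "inj (\<lambda>k::nat. (\<lambda>_::'n. k))" by (auto simp: inj_def fun_eq_iff)
  then have "infinite (UNIV :: ('n \<Rightarrow> nat) set)"
    using finite_subset[OF subset_UNIV, of "range (\<lambda>k::nat. (\<lambda>_::'n. k))"] finite_imageD by blast
  then have e: "bij_betw e UNIV UNIV"
    unfolding e_def by (intro bij_betw_from_nat_into) auto
  have sums: "(\<lambda>n. g (e n)) sums t" if "(g has_sum t) UNIV" for g :: "('n \<Rightarrow> nat) \<Rightarrow> real" and t
    using has_sum_imp_sums has_sum_reindex_bij_betw[OF e, of g t] that by blast
  have unif: "uniform_limit (cube \<tau>) (\<lambda>n x. \<Sum>k<n. a (e k) * monomial_partial i (e k) x) (G i) sequentially" for i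
  proof -
    have "uniform_limit (cube \<tau>) (\<lambda>n x. \<Sum>k<n. a (e k) * monomial_partial i (e k) x)
        (\<lambda>x. \<Sum>k. a (e k) * monomial_partial i (e k) x) sequentially"
      by (rule Weierstrass_m_test[where M = "\<lambda>k. M (e k)"])
         (use term_le sums[OF M] in \<open>auto simp: sums_iff\<close>)
    moreover have "(\<Sum>k. a (e k) * monomial_partial i (e k) x) = G i x" if "x \<in> cube \<tau>" for x
      using sums_unique[OF sums[OF G[OF that]]] by simp
    ultimately show ?thesis
      using uniform_limit_cong'[of "cube \<tau>"] by (metis (no_types, lifting))
  qed
  have cube: "open_cube \<tau> \<subseteq> (cube \<tau> :: (real^'n) set)" "open_cube \<tau> \<subseteq> (cube \<rho> :: (real^'n) set)"
    using open_cube_subset_cube[of \<tau>] cube_mono[of \<tau> \<rho>] \<tau>(2) by auto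
  have "0 \<in> (open_cube \<tau> :: (real^'n) set)" using \<tau>(3) by (simp add: open_cube_def)
  have "\<exists>g. \<forall>x\<in>open_cube \<tau>. (\<lambda>n. a (e n) * monomial (e n) x) sums g x \<and>
      (g has_derivative (\<lambda>h. \<Sum>i\<in>UNIV. G i x * h $ i)) (at x within open_cube \<tau>)"
  proof (rule has_derivative_series[OF convex_open_cube])
    show "((\<lambda>x. a (e n) * monomial (e n) x) has_derivative
        (\<lambda>h. a (e n) * (\<Sum>i\<in>UNIV. monomial_partial i (e n) x * h $ i))) (at x within open_cube \<tau>)" for n x
      by (rule has_derivative_mult_right[OF has_derivative_at_withinI[OF has_derivative_monomial]])
    show "(\<lambda>n. a (e n) * monomial (e n) 0) sums f 0"
      by (rule sums[OF a(5)]) (use \<open>0 \<in> open_cube \<tau>\<close> cube in auto)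
    fix \<epsilon> :: real assume "\<epsilon> > 0"
    define C where "C = real CARD('n)"
    have "C > 0" by (simp add: C_def)
    have "\<forall>\<^sub>F n in sequentially. \<forall>i. \<forall>x\<in>cube \<tau>.
        dist (\<Sum>k<n. a (e k) * monomial_partial i (e k) x) (G i x) < \<epsilon> / C"
      by (intro eventually_all_finite uniform_limitD[OF unif] divide_pos_pos \<open>\<epsilon> > 0\<close> \<open>C > 0\<close>)
    then show "\<forall>\<^sub>F n in sequentially. \<forall>x\<in>open_cube \<tau>. \<forall>h.
        norm ((\<Sum>k<n. a (e k) * (\<Sum>i\<in>UNIV. monomial_partial i (e k) x * h $ i)) -
          (\<Sum>i\<in>UNIV. G i x * h $ i)) \<le> \<epsilon> * norm h"
    proof (rule eventually_mono, intro ballI allI)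
      fix n and x h :: "real^'n"
      assume n: "\<forall>i. \<forall>x\<in>cube \<tau>. dist (\<Sum>k<n. a (e k) * monomial_partial i (e k) x) (G i x) < \<epsilon> / C"
        and x: "x \<in> open_cube \<tau>"
      have "(\<Sum>k<n. a (e k) * (\<Sum>i\<in>UNIV. monomial_partial i (e k) x * h $ i)) =
          (\<Sum>i\<in>UNIV. (\<Sum>k<n. a (e k) * monomial_partial i (e k) x) * h $ i)"
        by (simp add: sum_distrib_left sum_distrib_right mult.assoc sum.swap[of _ "{..<n}"])
      then have "norm ((\<Sum>k<n. a (e k) * (\<Sum>i\<in>UNIV. monomial_partial i (e k) x * h $ i)) -
          (\<Sum>i\<in>UNIV. G i x * h $ i)) =
          \<bar>\<Sum>i\<in>UNIV. ((\<Sum>k<n. a (e k) * monomial_partial i (e k) x) - G i x) * h $ i\<bar>"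
        by (simp add: left_diff_distrib sum_subtractf)
      also have "\<dots> \<le> C * (\<epsilon> / C) * norm h"
        unfolding C_def
        by (rule abs_sum_mult_nth_le)
           (use n x cube in \<open>force simp: dist_real_def C_def intro: less_imp_le\<close>)
      also have "\<dots> = \<epsilon> * norm h" using \<open>C > 0\<close> by simp
      finally show "norm ((\<Sum>k<n. a (e k) * (\<Sum>i\<in>UNIV. monomial_partial i (e k) x * h $ i)) -
          (\<Sum>i\<in>UNIV. G i x * h $ i)) \<le> \<epsilon> * norm h" .
    qed
  qed (use \<open>0 \<in> open_cube \<tau>\<close> in auto)
  then obtain g where g: "\<And>x. x \<in> open_cube \<tau> \<Longrightarrow> (\<lambda>n. a (e n) * monomial (e n) x) sums g x"
    and g': "\<And>x. x \<in> open_cube \<tau> \<Longrightarrow>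
      (g has_derivative (\<lambda>h. \<Sum>i\<in>UNIV. G i x * h $ i)) (at x within open_cube \<tau>)"
    by blast
  have fg: "g x = f x" if "x \<in> open_cube \<tau>" for x
    using sums_unique2[OF g[OF that] sums[OF a(5)]] that cube by blast
  have f': "(f has_derivative (\<lambda>h. \<Sum>i\<in>UNIV. G i x * h $ i)) (at x)" if "x \<in> open_cube \<tau>" for x
    using g'[OF that] has_derivative_transform_within_open[of g _ x UNIV "open_cube \<tau>" f]
      at_within_open[OF that open_open_cube] fg that open_open_cube by auto
  have sub: "cube \<sigma> \<subseteq> (open_cube \<tau> :: (real^'n) set)" by (rule cube_subset_open_cube[OF \<tau>(1)])
  show "f differentiable (at x)" if "x \<in> cube \<sigma>" for x
    using f' sub that unfolding differentiable_def by blast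
  have "partial i f x = G i x" if "x \<in> cube \<sigma>" for x
    using partial_eqI[OF f', of x i] sub that by (auto simp: axis_def if_distrib cong: if_cong)
  then show "\<exists>N'. analytic_norm_le \<sigma> N' (partial i f)"
    using analytic_norm_le_cong[OF analytic_norm_le_radius[OF G_anl \<sigma>(1) less_imp_le[OF \<tau>(1)]]] by metis
qed

text \<open>A function is analytic at \<open>p\<close> if \<open>\<lambda>z. f (p + z)\<close> has this property (\<open>real_analytic_on_iff\<close>).\<close>

definition analytic_at_0 :: "(real^'n::finite \<Rightarrow> real) \<Rightarrow> bool" where
  "analytic_at_0 f \<longleftrightarrow> (\<exists>\<rho> N. analytic_norm_le \<rho> N f)"

lemma real_analytic_on_iff: "real_analytic_on S f \<longleftrightarrow> (\<forall>p\<in>S. analytic_at_0 (\<lambda>z. f (p + z)))"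
  unfolding real_analytic_on_def
proof (intro ball_cong refl iffI)
  fix p :: "real^'a"
  assume "\<exists>\<epsilon>>0. \<exists>a. \<forall>x\<in>ball p \<epsilon>. ((\<lambda>\<alpha>. a \<alpha> * (\<Prod>i\<in>UNIV. (x $ i - p $ i) ^ \<alpha> i)) has_sum f x) UNIV"
  then obtain \<epsilon> a where "\<epsilon> > 0"
    and a: "\<And>x. x \<in> ball p \<epsilon> \<Longrightarrow> ((\<lambda>\<alpha>. a \<alpha> * monomial \<alpha> (x - p)) has_sum f x) UNIV"
    unfolding monomial_def vector_minus_component by blast
  define \<rho> where "\<rho> = \<epsilon> / (2 * real CARD('a))"
  have "\<rho> > 0" using \<open>\<epsilon> > 0\<close> by (simp add: \<rho>_def)
  have ball: "p + z \<in> ball p \<epsilon>" if "z \<in> cube \<rho>" for z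
    using norm_less_of_cube[OF \<open>\<epsilon> > 0\<close>] that by (simp add: \<rho>_def dist_norm)
  \<comment> \<open>convergence at a corner of the cube bounds all coefficients simultaneously\<close>
  define c where "c = (\<chi> i::'a. \<rho>)"
  have "((\<lambda>\<alpha>. a \<alpha> * monomial \<alpha> c) has_sum f (p + c)) UNIV"
    using a[OF ball[of c]] \<open>\<rho> > 0\<close> by (simp add: c_def cube_def)
  from has_sum_real_summable_abs[OF this]
  have summ: "(\<lambda>\<alpha>. \<bar>a \<alpha>\<bar> * \<rho> ^ total_degree \<alpha>) summable_on UNIV"
    using \<open>\<rho> > 0\<close> by (simp add: c_def monomial_def prod_const_power_total_degree abs_mult)
  have "analytic_norm_le \<rho> (infsum (\<lambda>\<alpha>. \<bar>a \<alpha>\<bar> * \<rho> ^ total_degree \<alpha>) UNIV) (\<lambda>z. f (p + z))"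
    by (rule analytic_norm_leI[OF \<open>\<rho> > 0\<close> has_sum_infsum[OF summ] order_refl]) (use a[OF ball] in simp)
  then show "analytic_at_0 (\<lambda>z. f (p + z))"
    unfolding analytic_at_0_def by blast
next
  fix p :: "real^'a"
  assume "analytic_at_0 (\<lambda>z. f (p + z))"
  then obtain \<rho> a where "\<rho> > 0"
    and a: "\<And>z. z \<in> cube \<rho> \<Longrightarrow> ((\<lambda>\<alpha>. a \<alpha> * monomial \<alpha> z) has_sum f (p + z)) UNIV"
    unfolding analytic_at_0_def analytic_norm_le_def by blast
  have "x - p \<in> cube \<rho>" if "x \<in> ball p \<rho>" for x
    using component_le_norm_cart[of "x - p"] that
    by (auto simp: cube_def dist_norm norm_minus_commute intro: order_trans less_imp_le)
  from a[OF this]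
  show "\<exists>\<epsilon>>0. \<exists>a. \<forall>x\<in>ball p \<epsilon>. ((\<lambda>\<alpha>. a \<alpha> * (\<Prod>i\<in>UNIV. (x $ i - p $ i) ^ \<alpha> i)) has_sum f x) UNIV"
    using \<open>\<rho> > 0\<close> unfolding monomial_def by (intro exI[of _ \<rho>] conjI exI[of _ a]) auto
qed

section \<open>Picard iteration for the geodesic equation\<close>

text \<open>The properties of a norm that the contraction estimate needs. \<open>nrm N f\<close> says that \<open>f\<close> has norm at
  most \<open>N\<close>. The instances are the supremum norm of continuous functions on the cube and
  \<open>analytic_norm_le\<close>.\<close>

locale function_norm =
  fixes e :: "'n::finite" and \<rho> :: real and nrm :: "real \<Rightarrow> (real^'n \<Rightarrow> real) \<Rightarrow> bool"
  assumes pos: "\<rho> > 0"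
    and const: "nrm \<bar>c\<bar> (\<lambda>_. c)"
    and nth: "nrm \<rho> (\<lambda>z. z $ i)"
    and add: "nrm M f \<Longrightarrow> nrm N g \<Longrightarrow> nrm (M + N) (\<lambda>z. f z + g z)"
    and mult: "nrm M f \<Longrightarrow> nrm N g \<Longrightarrow> nrm (M * N) (\<lambda>z. f z * g z)"
    and mono: "nrm M f \<Longrightarrow> M \<le> N \<Longrightarrow> nrm N f"
    and cong: "nrm M f \<Longrightarrow> (\<And>z. z \<in> cube \<rho> \<Longrightarrow> f z = g z) \<Longrightarrow> nrm M g"
    and integral: "nrm M f \<Longrightarrow> nrm (\<rho> * M) (axis_integral e f)"
    and continuous: "nrm M f \<Longrightarrow> continuous_on (cube \<rho>) f"
    and bound: "nrm M f \<Longrightarrow> z \<in> cube \<rho> \<Longrightarrow> \<bar>f z\<bar> \<le> M"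
begin

lemma nonneg: "nrm M f \<Longrightarrow> 0 \<le> M"
  using bound[of M f 0] pos by (auto simp: cube_def)

lemma uminus: "nrm M f \<Longrightarrow> nrm M (\<lambda>z. - f z)"
  using mult[OF const[of "-1"], of M f] by simp

lemma sum:
  assumes "finite A" "\<And>a. a \<in> A \<Longrightarrow> nrm (M a) (f a)"
  shows "nrm (\<Sum>a\<in>A. M a) (\<lambda>z. \<Sum>a\<in>A. f a z)"
  using assms
proof (induction A)
  case empty
  show ?case using const[of 0] by simp
next
  case (insert a A)
  then show ?case using add[of "M a" "f a"] by simp
qed

lemma integral_diff:
  assumes "nrm M f" "nrm M' g" "nrm d (\<lambda>z. f z - g z)"
  shows "nrm (\<rho> * d) (\<lambda>z. axis_integral e f z - axis_integral e g z)"
  by (rule cong[OF integral[OF assms(3)]])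
     (use axis_integral_diff[OF continuous[OF assms(1)] continuous[OF assms(2)]] axis_scale_in_cube in blast)

lemma diff_mult:
  assumes "nrm A f'" "nrm B g" "nrm K (\<lambda>z. f z - f' z)" "nrm L (\<lambda>z. g z - g' z)"
  shows "nrm (K * B + A * L) (\<lambda>z. f z * g z - f' z * g' z)"
proof -
  have "nrm (K * B + A * L) (\<lambda>z. (f z - f' z) * g z + f' z * (g z - g' z))"
    by (intro add mult assms)
  then show ?thesis by (simp add: algebra_simps)
qed

end

text \<open>If \<open>w\<close> is the acceleration of the curves in direction \<open>e\<close>, which start on the hyperplane
  \<open>z $ e = 0\<close> with velocity \<open>axis e 1\<close>, then this is their velocity at \<open>z\<close>.\<close>

definition geodesic_velocity :: "'n \<Rightarrow> (real^'n::finite \<Rightarrow> real^'n) \<Rightarrow> real^'n \<Rightarrow> real^'n" where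
  "geodesic_velocity e w z = (\<chi> a. (if a = e then 1 else 0) + axis_integral e (\<lambda>y. w y $ a) z)"

text \<open>The position relative to \<open>q\<close>. The summand \<open>z\<close> combines the starting point on the hyperplane
  with the contribution of the initial velocity.\<close>

definition geodesic_displacement :: "'n \<Rightarrow> (real^'n::finite \<Rightarrow> real^'n) \<Rightarrow> real^'n \<Rightarrow> real^'n" where
  "geodesic_displacement e w z = (\<chi> a. z $ a + axis_integral e (axis_integral e (\<lambda>y. w y $ a)) z)"

definition geodesic_acceleration ::
    "'n::finite components \<Rightarrow> real^'n \<Rightarrow> 'n \<Rightarrow> (real^'n \<Rightarrow> real^'n) \<Rightarrow> real^'n \<Rightarrow> real^'n" where
  "geodesic_acceleration \<Gamma> q e w z = (\<chi> h. - (\<Sum>i\<in>UNIV. \<Sum>j\<in>UNIV.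
     \<Gamma> h i j (q + geodesic_displacement e w z) * geodesic_velocity e w z $ i * geodesic_velocity e w z $ j))"

definition picard :: "'n::finite components \<Rightarrow> real^'n \<Rightarrow> 'n \<Rightarrow> nat \<Rightarrow> real^'n \<Rightarrow> real^'n" where
  "picard \<Gamma> q e m = (geodesic_acceleration \<Gamma> q e ^^ m) (\<lambda>_. 0)"

lemma picard_0: "picard \<Gamma> q e 0 = (\<lambda>_. 0)"
  and picard_Suc: "picard \<Gamma> q e (Suc m) = geodesic_acceleration \<Gamma> q e (picard \<Gamma> q e m)"
  by (simp_all add: picard_def)

text \<open>The smallness conditions keep velocities within \<open>2\<close>, displacements within \<open>R0\<close> and accelerations
  within \<open>R\<close>, and make the acceleration depend on its predecessor with Lipschitz constant
  \<open>1 / 2\<close>.\<close>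

locale geodesic_contraction = function_norm e \<rho> nrm
  for e :: "'n::finite" and \<rho> nrm +
  fixes \<Gamma> :: "'n components" and q :: "real^'n" and N L R0 R :: real
  assumes \<Gamma>_bound: "\<And>u h i j. (\<And>a. nrm R0 (\<lambda>z. u z $ a)) \<Longrightarrow> nrm N (\<lambda>z. \<Gamma> h i j (q + u z))"
    and \<Gamma>_lipschitz: "\<And>u v d h i j. (\<And>a. nrm R0 (\<lambda>z. u z $ a)) \<Longrightarrow> (\<And>a. nrm R0 (\<lambda>z. v z $ a)) \<Longrightarrow>
      (\<And>a. nrm d (\<lambda>z. u z $ a - v z $ a)) \<Longrightarrow> nrm (L * d) (\<lambda>z. \<Gamma> h i j (q + u z) - \<Gamma> h i j (q + v z))"
    and N: "0 \<le> N" and R: "R = 4 * (real CARD('n))\<^sup>2 * N"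
    and \<rho>R: "\<rho> * R \<le> 1" and \<rho>R0: "2 * \<rho> \<le> R0"
    and contraction: "(real CARD('n))\<^sup>2 * (4 * L * \<rho>\<^sup>2 + 4 * N * \<rho>) \<le> 1 / 2"
begin

lemma velocity_bound:
  assumes "\<And>a. nrm R (\<lambda>z. w z $ a)"
  shows "nrm 2 (\<lambda>z. geodesic_velocity e w z $ a)"
proof -
  have "nrm (1 + \<rho> * R) (\<lambda>z. (if a = e then 1 else 0) + axis_integral e (\<lambda>y. w y $ a) z)"
    by (intro add integral assms mono[OF const]) auto
  then show ?thesis
    using \<rho>R by (auto simp: geodesic_velocity_def intro: mono)
qed

lemma displacement_bound:
  assumes "\<And>a. nrm R (\<lambda>z. w z $ a)"
  shows "nrm R0 (\<lambda>z. geodesic_displacement e w z $ a)"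
proof -
  have "nrm (\<rho> + \<rho> * (\<rho> * R)) (\<lambda>z. z $ a + axis_integral e (axis_integral e (\<lambda>y. w y $ a)) z)"
    by (intro add integral assms nth)
  moreover have "\<rho> + \<rho> * (\<rho> * R) \<le> R0"
    using mult_left_mono[OF \<rho>R less_imp_le[OF pos]] \<rho>R0 by simp
  ultimately show ?thesis
    by (auto simp: geodesic_displacement_def intro: mono)
qed

lemma velocity_diff:
  assumes "\<And>a. nrm R (\<lambda>z. w z $ a)" "\<And>a. nrm R (\<lambda>z. w' z $ a)" "\<And>a. nrm d (\<lambda>z. w z $ a - w' z $ a)"
  shows "nrm (\<rho> * d) (\<lambda>z. geodesic_velocity e w z $ a - geodesic_velocity e w' z $ a)"
  using integral_diff[OF assms] by (simp add: geodesic_velocity_def)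

lemma displacement_diff:
  assumes "\<And>a. nrm R (\<lambda>z. w z $ a)" "\<And>a. nrm R (\<lambda>z. w' z $ a)" "\<And>a. nrm d (\<lambda>z. w z $ a - w' z $ a)"
  shows "nrm (\<rho> * (\<rho> * d)) (\<lambda>z. geodesic_displacement e w z $ a - geodesic_displacement e w' z $ a)"
  using integral_diff[OF integral[OF assms(1)] integral[OF assms(2)] integral_diff[OF assms]]
  by (simp add: geodesic_displacement_def)

lemma acceleration_bound:
  assumes "\<And>a. nrm R (\<lambda>z. w z $ a)"
  shows "nrm R (\<lambda>z. geodesic_acceleration \<Gamma> q e w z $ h)"
proof -
  have "nrm (\<Sum>i\<in>(UNIV::'n set). \<Sum>j\<in>(UNIV::'n set). N * 2 * 2)
     (\<lambda>z. - (\<Sum>i\<in>UNIV. \<Sum>j\<in>UNIV. \<Gamma> h i j (q + geodesic_displacement e w z) *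
        geodesic_velocity e w z $ i * geodesic_velocity e w z $ j))"
    by (intro uminus sum mult \<Gamma>_bound displacement_bound velocity_bound assms) auto
  then show ?thesis
    by (simp add: geodesic_acceleration_def R power2_eq_square algebra_simps)
qed

text \<open>The summand \<open>\<Gamma> v v\<close> is a product of three factors. A change of size \<open>d\<close> of the acceleration
  changes the first by \<open>L \<rho>\<^sup>2 d\<close> and each of the others by \<open>\<rho> d\<close>.\<close>

lemma acceleration_contraction:
  assumes w: "\<And>a. nrm R (\<lambda>z. w z $ a)" and w': "\<And>a. nrm R (\<lambda>z. w' z $ a)"
    and d: "\<And>a. nrm d (\<lambda>z. w z $ a - w' z $ a)"
  shows "nrm (d / 2) (\<lambda>z. geodesic_acceleration \<Gamma> q e w z $ h - geodesic_acceleration \<Gamma> q e w' z $ h)"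
proof -
  have "0 \<le> d" by (rule nonneg[OF d])
  let ?v = "geodesic_velocity e w" and ?v' = "geodesic_velocity e w'"
  let ?G = "\<lambda>h i j z. \<Gamma> h i j (q + geodesic_displacement e w z)"
  let ?G' = "\<lambda>h i j z. \<Gamma> h i j (q + geodesic_displacement e w' z)"
  have "nrm ((L * (\<rho> * (\<rho> * d)) * 2 + N * (\<rho> * d)) * 2 + N * 2 * (\<rho> * d))
    (\<lambda>z. ?G h i j z * ?v z $ i * ?v z $ j - ?G' h i j z * ?v' z $ i * ?v' z $ j)" for i j
    by (intro diff_mult mult \<Gamma>_bound \<Gamma>_lipschitz displacement_bound velocity_bound w w'
        displacement_diff[OF w w' d] velocity_diff[OF w w' d])
  then have "nrm (\<Sum>i\<in>(UNIV::'n set). \<Sum>j\<in>(UNIV::'n set). (L * (\<rho> * (\<rho> * d)) * 2 + N * (\<rho> * d)) * 2 + N * 2 * (\<rho> * d))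
    (\<lambda>z. - (\<Sum>i\<in>UNIV. \<Sum>j\<in>UNIV. ?G h i j z * ?v z $ i * ?v z $ j - ?G' h i j z * ?v' z $ i * ?v' z $ j))"
    by (intro uminus sum) auto
  moreover have "(\<Sum>i\<in>(UNIV::'n set). \<Sum>j\<in>(UNIV::'n set). (L * (\<rho> * (\<rho> * d)) * 2 + N * (\<rho> * d)) * 2 + N * 2 * (\<rho> * d)) =
      (real CARD('n))\<^sup>2 * (4 * L * \<rho>\<^sup>2 + 4 * N * \<rho>) * d"
    by (simp add: power2_eq_square algebra_simps)
  moreover have "\<dots> \<le> 1 / 2 * d"
    by (rule mult_right_mono[OF contraction \<open>0 \<le> d\<close>])
  ultimately show ?thesis
    by (auto simp: geodesic_acceleration_def sum_subtractf intro: mono)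
qed

lemma picard_bound: "nrm R (\<lambda>z. picard \<Gamma> q e m z $ h)"
proof (induction m arbitrary: h)
  case 0
  show ?case using mono[OF const[of 0], of R] N R by (simp add: picard_0)
next
  case (Suc m)
  then show ?case unfolding picard_Suc by (rule acceleration_bound)
qed

lemma picard_diff: "nrm (R / 2 ^ m) (\<lambda>z. picard \<Gamma> q e (Suc m) z $ h - picard \<Gamma> q e m z $ h)"
proof (induction m arbitrary: h)
  case 0
  show ?case using picard_bound[of "Suc 0" h] by (simp add: picard_0)
next
  case (Suc m)
  then show ?case
    using acceleration_contraction[OF picard_bound picard_bound Suc] by (simp add: picard_Suc field_simps)
qed

end

lemma sup_function_norm:
  assumes "\<rho> > 0"
  shows "function_norm e \<rho> (\<lambda>M f. continuous_on (cube \<rho>) f \<and> (\<forall>z\<in>cube \<rho>. \<bar>f z\<bar> \<le> M))"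
proof
  show "\<rho> > 0" by fact
  fix f g :: "real^'a \<Rightarrow> real" and M N :: real
  assume f: "continuous_on (cube \<rho>) f \<and> (\<forall>z\<in>cube \<rho>. \<bar>f z\<bar> \<le> M)"
  {
    assume g: "continuous_on (cube \<rho>) g \<and> (\<forall>z\<in>cube \<rho>. \<bar>g z\<bar> \<le> N)"
    show "continuous_on (cube \<rho>) (\<lambda>z. f z + g z) \<and> (\<forall>z\<in>cube \<rho>. \<bar>f z + g z\<bar> \<le> M + N)"
      using f g by (auto intro!: continuous_intros order_trans[OF abs_triangle_ineq] add_mono)
    show "continuous_on (cube \<rho>) (\<lambda>z. f z * g z) \<and> (\<forall>z\<in>cube \<rho>. \<bar>f z * g z\<bar> \<le> M * N)"
      using f g by (auto intro!: continuous_intros mult_mono simp: abs_mult intro: order_trans[OF abs_ge_zero])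
  }
  show "continuous_on (cube \<rho>) f \<and> (\<forall>z\<in>cube \<rho>. \<bar>f z\<bar> \<le> N)" if "M \<le> N"
    using f that by force
  show "continuous_on (cube \<rho>) g \<and> (\<forall>z\<in>cube \<rho>. \<bar>g z\<bar> \<le> M)" if "\<And>z. z \<in> cube \<rho> \<Longrightarrow> f z = g z"
    using f that by (simp cong: continuous_on_cong)
  have "\<bar>axis_integral e f z\<bar> \<le> \<rho> * M" if "z \<in> cube \<rho>" for z
    using axis_integral_uniform[of \<rho> f "\<lambda>_. 0" M z e] f that \<open>\<rho> > 0\<close> by simp
  moreover have "continuous_on (cube \<rho>) (axis_integral e f)"
    by (rule continuous_on_axis_integral[OF _ axis_scale_in_cube]) (use f in auto)
  ultimately show "continuous_on (cube \<rho>) (axis_integral e f) \<and> (\<forall>z\<in>cube \<rho>. \<bar>axis_integral e f z\<bar> \<le> \<rho> * M)"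
    by blast
  show "continuous_on (cube \<rho>) f" using f by blast
  show "\<bar>f z\<bar> \<le> M" if "z \<in> cube \<rho>" for z using f that by blast
qed (auto simp: cube_def intro!: continuous_intros continuous_on_component)

lemma analytic_function_norm: "\<rho> > 0 \<Longrightarrow> function_norm e \<rho> (analytic_norm_le \<rho>)"
  by unfold_locales
     (blast intro: analytic_norm_le_const analytic_norm_le_nth analytic_norm_le_add analytic_norm_le_mult
        analytic_norm_le_mono analytic_norm_le_cong analytic_norm_le_axis_integral
        analytic_norm_le_continuous_on analytic_norm_le_bound)+

context geodesic_contraction
begin

definition limit_acceleration :: "real^'n \<Rightarrow> real^'n" where
  "limit_acceleration z = (\<chi> h. \<Sum>m. picard \<Gamma> q e (Suc m) z $ h - picard \<Gamma> q e m z $ h)"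

lemma R_nonneg: "0 \<le> R"
  using N by (simp add: R)

lemma picard_uniform_limit:
  "uniform_limit (cube \<rho>) (\<lambda>m z. picard \<Gamma> q e m z $ h) (\<lambda>z. limit_acceleration z $ h) sequentially"
proof -
  have "uniform_limit (cube \<rho>) (\<lambda>n z. \<Sum>m<n. picard \<Gamma> q e (Suc m) z $ h - picard \<Gamma> q e m z $ h)
      (\<lambda>z. \<Sum>m. picard \<Gamma> q e (Suc m) z $ h - picard \<Gamma> q e m z $ h) sequentially"
  proof (rule Weierstrass_m_test)
    show "norm (picard \<Gamma> q e (Suc m) z $ h - picard \<Gamma> q e m z $ h) \<le> R * (1 / 2) ^ m"
      if "z \<in> cube \<rho>" for m z
      using bound[OF picard_diff that, of m h] by (simp add: power_divide)
    show "summable (\<lambda>m. R * (1 / 2) ^ m)"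
      by (intro summable_mult summable_geometric) simp
  qed
  moreover have "(\<Sum>m<n. picard \<Gamma> q e (Suc m) z $ h - picard \<Gamma> q e m z $ h) = picard \<Gamma> q e n z $ h" for n z
    using sum_lessThan_telescope[of "\<lambda>m. picard \<Gamma> q e m z $ h" n] by (simp add: picard_0)
  ultimately show ?thesis
    by (simp add: limit_acceleration_def)
qed

lemma picard_continuous: "continuous_on (cube \<rho>) (\<lambda>z. picard \<Gamma> q e m z $ h)"
  by (rule continuous[OF picard_bound])

lemma picard_tendsto: "z \<in> cube \<rho> \<Longrightarrow> (\<lambda>m. picard \<Gamma> q e m z $ h) \<longlonglongrightarrow> limit_acceleration z $ h"
  by (rule tendsto_uniform_limitI[OF picard_uniform_limit])

lemma picard_integral_uniform_limit:
  "uniform_limit (cube \<rho>) (\<lambda>m. axis_integral e (\<lambda>z. picard \<Gamma> q e m z $ h))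
     (axis_integral e (\<lambda>z. limit_acceleration z $ h)) sequentially"
  "uniform_limit (cube \<rho>) (\<lambda>m. axis_integral e (axis_integral e (\<lambda>z. picard \<Gamma> q e m z $ h)))
     (axis_integral e (axis_integral e (\<lambda>z. limit_acceleration z $ h))) sequentially"
proof -
  show 1: "uniform_limit (cube \<rho>) (\<lambda>m. axis_integral e (\<lambda>z. picard \<Gamma> q e m z $ h))
     (axis_integral e (\<lambda>z. limit_acceleration z $ h)) sequentially"
    by (rule uniform_limit_axis_integral[OF picard_continuous pos picard_uniform_limit])
  show "uniform_limit (cube \<rho>) (\<lambda>m. axis_integral e (axis_integral e (\<lambda>z. picard \<Gamma> q e m z $ h)))
     (axis_integral e (axis_integral e (\<lambda>z. limit_acceleration z $ h))) sequentially"
    by (rule uniform_limit_axis_integral[OF continuous_on_axis_integral[OF picard_continuous axis_scale_in_cube] pos 1])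
qed

lemma picard_velocity_tendsto:
  "z \<in> cube \<rho> \<Longrightarrow> (\<lambda>m. geodesic_velocity e (picard \<Gamma> q e m) z $ a) \<longlonglongrightarrow> geodesic_velocity e limit_acceleration z $ a"
  unfolding geodesic_velocity_def
  using tendsto_uniform_limitI[OF picard_integral_uniform_limit(1)] by (auto intro!: tendsto_intros)

lemma picard_displacement_tendsto:
  "z \<in> cube \<rho> \<Longrightarrow>
     (\<lambda>m. geodesic_displacement e (picard \<Gamma> q e m) z $ a) \<longlonglongrightarrow> geodesic_displacement e limit_acceleration z $ a"
  unfolding geodesic_displacement_def
  using tendsto_uniform_limitI[OF picard_integral_uniform_limit(2)] by (auto intro!: tendsto_intros)

lemma picard_displacement_in_cube: "z \<in> cube \<rho> \<Longrightarrow> geodesic_displacement e (picard \<Gamma> q e m) z \<in> cube R0"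
  using bound[OF displacement_bound[OF picard_bound]] by (simp add: cube_def)

lemma limit_displacement_in_cube:
  assumes z: "z \<in> cube \<rho>"
  shows "geodesic_displacement e limit_acceleration z \<in> cube R0"
proof -
  have "\<bar>geodesic_displacement e limit_acceleration z $ a\<bar> \<le> R0" for a
    by (rule LIMSEQ_le_const2[OF tendsto_rabs[OF picard_displacement_tendsto[OF z]]])
       (use picard_displacement_in_cube[OF z] in \<open>auto simp: cube_def\<close>)
  then show ?thesis by (simp add: cube_def)
qed

text \<open>Both sides are limits of the same Picard iterates, because the integrals converge uniformly
  and \<open>\<Gamma>\<close> is continuous.\<close>

lemma limit_acceleration_fixed_point:
  assumes \<Gamma>_cont: "\<And>h i j. continuous_on (cube R0) (\<lambda>x. \<Gamma> h i j (q + x))" and z: "z \<in> cube \<rho>"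
  shows "geodesic_acceleration \<Gamma> q e limit_acceleration z = limit_acceleration z"
proof -
  have "(\<lambda>m. geodesic_displacement e (picard \<Gamma> q e m) z) \<longlonglongrightarrow> geodesic_displacement e limit_acceleration z"
    by (rule vec_tendstoI) (rule picard_displacement_tendsto[OF z])
  then have \<Gamma>: "(\<lambda>m. \<Gamma> h i j (q + geodesic_displacement e (picard \<Gamma> q e m) z))
      \<longlonglongrightarrow> \<Gamma> h i j (q + geodesic_displacement e limit_acceleration z)" for h i j
    by (rule continuous_on_tendsto_compose[OF \<Gamma>_cont])
       (use picard_displacement_in_cube[OF z] limit_displacement_in_cube[OF z] in auto)
  have "(\<lambda>m. geodesic_acceleration \<Gamma> q e (picard \<Gamma> q e m) z $ h)
      \<longlonglongrightarrow> geodesic_acceleration \<Gamma> q e limit_acceleration z $ h" for h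
    unfolding geodesic_acceleration_def vec_lambda_beta
    by (intro tendsto_intros \<Gamma> picard_velocity_tendsto z)
  moreover have "(\<lambda>m. geodesic_acceleration \<Gamma> q e (picard \<Gamma> q e m) z $ h) \<longlonglongrightarrow> limit_acceleration z $ h" for h
    using LIMSEQ_Suc[OF picard_tendsto[OF z, of h]] by (simp add: picard_Suc)
  ultimately show ?thesis
    using LIMSEQ_unique by (fastforce simp: vec_eq_iff)
qed

lemma converges_continuously_cube:
  fixes f :: "nat \<Rightarrow> real^'n \<Rightarrow> real"
  assumes "\<And>m. continuous_on (cube \<rho>) (f m)" "uniform_limit (cube \<rho>) f l sequentially"
  shows "converges_continuously (open_cube \<rho>) f l"
  using continuous_on_subset[OF assms(1) open_cube_subset_cube] open_open_cube
    uniform_limit_on_subset[OF assms(2) open_cube_subset_cube]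
  by (intro converges_continuouslyI) blast+

lemma picard_Ck_on:
  assumes V: "open V" "\<And>x. x \<in> cube R0 \<Longrightarrow> q + x \<in> V" and \<Gamma>: "\<And>h i j. Ck_on k V (\<Gamma> h i j)"
  shows "Ck_on k (open_cube \<rho>) (\<lambda>z. picard \<Gamma> q e m z $ h)"
proof (induction m arbitrary: h)
  case 0
  show ?case by (simp add: picard_0)
next
  case (Suc m)
  note op = open_open_cube[of \<rho>]
  have v: "Ck_on k (open_cube \<rho>) (\<lambda>z. geodesic_velocity e (picard \<Gamma> q e m) z $ a)" for a
    unfolding geodesic_velocity_def vec_lambda_beta
    by (rule Ck_on_add[OF op Ck_on_const Ck_on_axis_integral[OF Suc]])
  have u: "Ck_on k (open_cube \<rho>) (\<lambda>z. (q + geodesic_displacement e (picard \<Gamma> q e m) z) $ a)" for a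
    unfolding geodesic_displacement_def vec_lambda_beta vector_add_component
    by (rule Ck_on_add[OF op Ck_on_const Ck_on_add[OF op Ck_on_nth Ck_on_axis_integral[OF Ck_on_axis_integral[OF Suc]]]])
  have "q + geodesic_displacement e (picard \<Gamma> q e m) z \<in> V" if "z \<in> open_cube \<rho>" for z
    using picard_displacement_in_cube that open_cube_subset_cube V(2) by blast
  then have "Ck_on k (open_cube \<rho>) (\<lambda>z. \<Gamma> h i j (q + geodesic_displacement e (picard \<Gamma> q e m) z))" for i j
    by (intro Ck_on_compose[OF op V(1) \<Gamma> u])
  then have "Ck_on k (open_cube \<rho>) (\<lambda>z. -1 * (\<Sum>i\<in>UNIV. \<Sum>j\<in>UNIV.
      \<Gamma> h i j (q + geodesic_displacement e (picard \<Gamma> q e m) z) *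
        geodesic_velocity e (picard \<Gamma> q e m) z $ i * geodesic_velocity e (picard \<Gamma> q e m) z $ j))"
    by (intro Ck_on_mult[OF op] Ck_on_sum[OF op] Ck_on_const v)
  then show ?case
    by (simp add: picard_Suc geodesic_acceleration_def)
qed

text \<open>Differentiating \<open>w\<^sub>m\<^sub>+\<^sub>1 = - \<Gamma>(x\<^sub>m)(v\<^sub>m, v\<^sub>m)\<close> gives \<open>\<partial>\<^sub>cw\<^sub>m\<^sub>+\<^sub>1 = A\<^sub>m \<partial>\<^sub>cx\<^sub>m + C\<^sub>m \<partial>\<^sub>cv\<^sub>m\<close>, where \<open>x\<^sub>m\<close> and \<open>v\<^sub>m\<close> are
  the position and the velocity, \<open>A\<close> contains first derivatives of \<open>\<Gamma>\<close> and \<open>C\<close> contains \<open>\<Gamma>\<close> itself.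
  If \<open>\<Gamma>\<close> is \<open>C\<^sup>k\<^sup>+\<^sup>1\<close> and the iterates converge in \<open>C\<^sup>k\<close>, then \<open>A\<close> and \<open>C\<close> converge in \<open>C\<^sup>k\<close>, and the result on affine
  recursions applies to \<open>\<partial>\<^sub>cw\<close>. Nothing is lost at the highest order since \<open>A\<close> needs to be merely
  continuous there.\<close>

lemma picard_Ck_convergent:
  assumes V: "open V" "\<And>x. x \<in> cube R0 \<Longrightarrow> q + x \<in> V"
    and \<Gamma>_le: "\<And>h i j x. x \<in> cube R0 \<Longrightarrow> \<bar>\<Gamma> h i j (q + x)\<bar> \<le> N"
    and d\<Gamma>_le: "\<And>a h i j x. x \<in> cube R0 \<Longrightarrow> \<bar>partial a (\<Gamma> h i j) (q + x)\<bar> \<le> B"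
    and B: "real CARD('n) * B \<le> L"
    and \<Gamma>: "\<And>h i j. Ck_on k V (\<Gamma> h i j)"
  shows "Ck_convergent k (open_cube \<rho>) (\<lambda>m z. picard \<Gamma> q e m z $ h)"
  using \<Gamma>
proof (induction k arbitrary: h)
  case 0
  have "continuous_on (open_cube \<rho>) (\<lambda>z. picard \<Gamma> q e m z $ h)" for m
    by (rule continuous_on_subset[OF picard_continuous open_cube_subset_cube])
  then show ?case
    using converges_continuously_cube[OF picard_continuous picard_uniform_limit] by auto
next
  case (Suc k)
  let ?S = "open_cube \<rho> :: (real^'n) set"
  let ?I = "axis_integral e"
  note op = open_open_cube[of \<rho>]
  define w where "w h m z = picard \<Gamma> q e m z $ h" for h m z
  define v where "v a m z = geodesic_velocity e (picard \<Gamma> q e m) z $ a" for a m z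
  define x where "x m z = q + geodesic_displacement e (picard \<Gamma> q e m) z" for m z
  have w: "Ck_convergent k ?S (w h)" for h
    unfolding w_def[abs_def] by (rule Suc.IH[OF Ck_on_mono[OF V(1) Suc.prems]]) simp
  have w': "Ck_on (Suc k) ?S (w h m)" for h m
    unfolding w_def[abs_def] by (rule picard_Ck_on[OF V Suc.prems])
  have v_eq: "v a m = (\<lambda>z. (if a = e then 1 else 0) + ?I (w a m) z)" for a m
    by (simp add: v_def[abs_def] w_def[abs_def] geodesic_velocity_def)
  have x_eq: "(\<lambda>z. x m z $ a) = (\<lambda>z. q $ a + (z $ a + ?I (?I (w a m)) z))" for a m
    by (simp add: x_def w_def[abs_def] geodesic_displacement_def)
  have v: "Ck_convergent k ?S (v a)" for a
    unfolding v_eq[abs_def]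
    by (intro Ck_convergent_add[OF op] Ck_convergent_const_seq[OF op] Ck_on_const Ck_convergent_axis_integral w)
  have x: "Ck_convergent k ?S (\<lambda>m z. x m z $ a)" for a
    unfolding x_eq
    by (intro Ck_convergent_add[OF op] Ck_convergent_const_seq[OF op] Ck_on_const Ck_on_nth Ck_convergent_axis_integral w)
  have v': "Ck_on (Suc k) ?S (v a m)" and x': "Ck_on (Suc k) ?S (\<lambda>z. x m z $ a)" for a m
    unfolding v_eq x_eq by (intro Ck_on_add[OF op] Ck_on_const Ck_on_nth Ck_on_axis_integral w')+
  have diff: "f differentiable (at z)" if "Ck_on (Suc k) T f" "z \<in> T" for f T z
    using that by simp
  have xV: "x m z \<in> V" if "z \<in> ?S" for m z
    using picard_displacement_in_cube that open_cube_subset_cube V(2) unfolding x_def by blast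
  have \<Gamma>x: "Ck_convergent k ?S (\<lambda>m z. F (x m z))" if F: "Ck_on k V F" for F
  proof (rule Ck_convergent_compose[OF op V(1) F x])
    show "converges_continuously ?S (\<lambda>m y. x m y $ a) (\<lambda>y. (q + geodesic_displacement e limit_acceleration y) $ a)" for a
    proof (rule converges_continuously_cube)
      have "continuous_on (cube \<rho>) (?I (?I (\<lambda>z. picard \<Gamma> q e m z $ a)))" for m
        by (intro continuous_on_axis_integral picard_continuous axis_scale_in_cube)
      then show "continuous_on (cube \<rho>) (\<lambda>z. x m z $ a)" for m
        unfolding x_eq w_def[abs_def] by (intro continuous_intros continuous_on_component)
      show "uniform_limit (cube \<rho>) (\<lambda>m z. x m z $ a) (\<lambda>z. (q + geodesic_displacement e limit_acceleration z) $ a) sequentially"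
        unfolding x_eq w_def[abs_def] geodesic_displacement_def vec_lambda_beta vector_add_component
        by (intro uniform_limit_intros picard_integral_uniform_limit)
    qed
    show "q + geodesic_displacement e limit_acceleration y \<in> V" if "y \<in> ?S" for y
      using limit_displacement_in_cube that open_cube_subset_cube V(2) by blast
  qed (rule xV)
  \<comment> \<open>the derivatives of \<open>- \<Gamma>(x)(v, v)\<close> with respect to \<open>x\<close> and to \<open>v\<close>\<close>
  define A where "A h a m z = -1 * (\<Sum>i\<in>UNIV. \<Sum>j\<in>UNIV. partial a (\<Gamma> h i j) (x m z) * v i m z * v j m z)" for h a m z
  define C where "C h a m z = -1 * ((\<Sum>j\<in>UNIV. \<Gamma> h a j (x m z) * v j m z) + (\<Sum>i\<in>UNIV. \<Gamma> h i a (x m z) * v i m z))" for h a m z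
  have A: "Ck_convergent k ?S (A h a)" for h a
    unfolding A_def[abs_def]
    by (intro Ck_convergent_mult[OF op] Ck_convergent_const_seq[OF op] Ck_on_const Ck_convergent_sum[OF op] v
          \<Gamma>x[OF Ck_on_partial[OF Suc.prems]])
  have \<Gamma>k: "Ck_on k V (\<Gamma> h i j)" for h i j
    by (rule Ck_on_mono[OF V(1) Suc.prems]) simp
  have C: "Ck_convergent k ?S (C h a)" for h a
    unfolding C_def[abs_def]
    by (intro Ck_convergent_mult[OF op] Ck_convergent_const_seq[OF op] Ck_on_const Ck_convergent_sum[OF op]
          Ck_convergent_add[OF op] v \<Gamma>x[OF \<Gamma>k])
  have v_le: "\<bar>v a m z\<bar> \<le> 2" if "z \<in> ?S" for a m z
    using bound[OF velocity_bound[OF picard_bound]] that open_cube_subset_cube unfolding v_def by blast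
  have x_in: "\<exists>y\<in>cube R0. x m z = q + y" if "z \<in> ?S" for m z
    using picard_displacement_in_cube that open_cube_subset_cube unfolding x_def by blast
  have "0 \<in> cube R0" using \<rho>R0 pos by (simp add: cube_def)
  from d\<Gamma>_le[OF this] have "B \<ge> 0" using order_trans[OF abs_ge_zero] by blast
  define n where "n = real CARD('n)"
  have A_le: "\<bar>A h a m z\<bar> \<le> n * (n * (B * 2 * 2))" if zS: "z \<in> ?S" for h a m z
  proof -
    have "\<bar>partial a (\<Gamma> h i j) (x m z) * v i m z * v j m z\<bar> \<le> B * 2 * 2" for i j
    proof -
      obtain y where "y \<in> cube R0" "x m z = q + y" using x_in[OF zS] by blast
      then have "\<bar>partial a (\<Gamma> h i j) (x m z)\<bar> \<le> B" using d\<Gamma>_le by simp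
      then show ?thesis
        unfolding abs_mult using v_le[OF zS] \<open>B \<ge> 0\<close> by (intro mult_mono) auto
    qed
    then have "\<bar>\<Sum>i\<in>UNIV. \<Sum>j\<in>UNIV. partial a (\<Gamma> h i j) (x m z) * v i m z * v j m z\<bar>
        \<le> (\<Sum>i\<in>(UNIV::'n set). \<Sum>j\<in>(UNIV::'n set). B * 2 * 2)"
      by (intro order_trans[OF sum_abs] sum_mono)
    then show ?thesis by (simp add: A_def n_def)
  qed
  have C_le: "\<bar>C h a m z\<bar> \<le> n * (N * 2) + n * (N * 2)" if zS: "z \<in> ?S" for h a m z
  proof -
    have "\<bar>\<Gamma> h i j (x m z) * v k m z\<bar> \<le> N * 2" for i j k
    proof -
      obtain y where "y \<in> cube R0" "x m z = q + y" using x_in[OF zS] by blast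
      then have "\<bar>\<Gamma> h i j (x m z)\<bar> \<le> N" using \<Gamma>_le by simp
      then show ?thesis
        unfolding abs_mult using v_le[OF zS] N by (intro mult_mono) auto
    qed
    then have S: "\<bar>\<Sum>j\<in>UNIV. \<Gamma> h a j (x m z) * v j m z\<bar> \<le> (\<Sum>j\<in>(UNIV::'n set). N * 2)"
      "\<bar>\<Sum>i\<in>UNIV. \<Gamma> h i a (x m z) * v i m z\<bar> \<le> (\<Sum>i\<in>(UNIV::'n set). N * 2)"
      by (intro order_trans[OF sum_abs] sum_mono; simp)+
    have "\<bar>-1 * (s + t)\<bar> \<le> b + b" if "\<bar>s\<bar> \<le> b" "\<bar>t\<bar> \<le> b" for s t b :: real
      using that by argo
    from this[OF S] show ?thesis
      unfolding C_def n_def by simp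
  qed
  have small: "real CARD('n) * (n * (n * (B * 2 * 2)) * \<rho>\<^sup>2 + (n * (N * 2) + n * (N * 2)) * \<rho>) \<le> 1 / 2"
  proof -
    have "n\<^sup>2 * (4 * (n * B) * \<rho>\<^sup>2 + 4 * N * \<rho>) \<le> n\<^sup>2 * (4 * L * \<rho>\<^sup>2 + 4 * N * \<rho>)"
      using B by (intro mult_left_mono add_right_mono mult_right_mono) (auto simp: n_def)
    then show ?thesis
      using contraction by (simp add: n_def power2_eq_square algebra_simps)
  qed
  have dw: "partial c (w h (Suc m)) z = (\<Sum>a\<in>UNIV. A h a m z * partial c (\<lambda>z. x m z $ a) z + C h a m z * partial c (v a m) z)"
    if "z \<in> ?S" for c h m z
  proof -
    have \<Gamma>d: "\<Gamma> h i j differentiable (at (x m z))" for h i j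
      by (rule diff[OF Suc.prems xV[OF that]])
    have xd: "(\<lambda>z. x m z $ a) differentiable (at z)" and vd: "v a m differentiable (at z)" for a
      by (rule diff[OF x' that] diff[OF v' that])+
    have \<Gamma>xd: "(\<lambda>z. \<Gamma> h i j (x m z)) differentiable (at z)" for i j
      using has_derivative_comp_partials[OF \<Gamma>d xd] by (auto simp: differentiable_def)
    have td: "(\<lambda>z. \<Gamma> h i j (x m z) * v i m z * v j m z) differentiable (at z)" for i j
      by (intro differentiable_mult \<Gamma>xd vd)
    have w_eq: "w h (Suc m) = (\<lambda>z. -1 * (\<Sum>i\<in>UNIV. \<Sum>j\<in>UNIV. \<Gamma> h i j (x m z) * v i m z * v j m z))"
      by (simp add: w_def[abs_def] picard_Suc geodesic_acceleration_def x_def v_def)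
    have "partial c (w h (Suc m)) z = - (\<Sum>i\<in>UNIV. \<Sum>j\<in>UNIV. partial c (\<lambda>z. \<Gamma> h i j (x m z) * v i m z * v j m z) z)"
      unfolding w_eq
      by (subst partial_mult) (auto simp: partial_sum td differentiable_sum intro!: differentiable_sum td)
    also have "\<dots> = - (\<Sum>i\<in>UNIV. \<Sum>j\<in>UNIV.
        (\<Sum>a\<in>UNIV. partial a (\<Gamma> h i j) (x m z) * v i m z * v j m z * partial c (\<lambda>z. x m z $ a) z) +
        \<Gamma> h i j (x m z) * v j m z * partial c (v i m) z + \<Gamma> h i j (x m z) * v i m z * partial c (v j m) z)"
      by (simp add: partial_mult \<Gamma>xd vd differentiable_mult partial_chain[OF \<Gamma>d xd] algebra_simps sum_distrib_left)
    also have "\<dots> = (\<Sum>a\<in>UNIV. A h a m z * partial c (\<lambda>z. x m z $ a) z + C h a m z * partial c (v a m) z)"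
    proof -
      have 1: "(\<Sum>i\<in>UNIV. \<Sum>j\<in>UNIV. \<Sum>a\<in>UNIV. partial a (\<Gamma> h i j) (x m z) * v i m z * v j m z * partial c (\<lambda>z. x m z $ a) z) =
          (\<Sum>a\<in>UNIV. - A h a m z * partial c (\<lambda>z. x m z $ a) z)"
      proof -
        have "(\<Sum>i\<in>UNIV. \<Sum>j\<in>UNIV. \<Sum>a\<in>UNIV. partial a (\<Gamma> h i j) (x m z) * v i m z * v j m z * partial c (\<lambda>z. x m z $ a) z) =
          (\<Sum>i\<in>UNIV. \<Sum>a\<in>UNIV. \<Sum>j\<in>UNIV. partial a (\<Gamma> h i j) (x m z) * v i m z * v j m z * partial c (\<lambda>z. x m z $ a) z)"
          by (intro sum.cong refl sum.swap)
        also have "\<dots> = (\<Sum>a\<in>UNIV. \<Sum>i\<in>UNIV. \<Sum>j\<in>UNIV. partial a (\<Gamma> h i j) (x m z) * v i m z * v j m z * partial c (\<lambda>z. x m z $ a) z)"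
          by (rule sum.swap)
        finally show ?thesis by (simp add: A_def sum_distrib_right)
      qed
      have 2: "(\<Sum>i\<in>UNIV. \<Sum>j\<in>UNIV. \<Gamma> h i j (x m z) * v i m z * partial c (v j m) z) =
          (\<Sum>a\<in>UNIV. (\<Sum>i\<in>UNIV. \<Gamma> h i a (x m z) * v i m z) * partial c (v a m) z)"
        by (subst sum.swap) (simp add: sum_distrib_right)
      have 3: "(\<Sum>i\<in>UNIV. \<Sum>j\<in>UNIV. \<Gamma> h i j (x m z) * v j m z * partial c (v i m) z) =
          (\<Sum>a\<in>UNIV. (\<Sum>j\<in>UNIV. \<Gamma> h a j (x m z) * v j m z) * partial c (v a m) z)"
        by (simp add: sum_distrib_right)
      show ?thesis
        unfolding sum.distrib 1 2 3 by (simp add: C_def sum.distrib sum_negf sum_subtractf algebra_simps)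
    qed
    finally show ?thesis .
  qed
  have C1: "Ck_on (Suc 0) ?S f" if "Ck_on (Suc k) ?S f" for f
    by (rule Ck_on_mono[OF op that]) simp
  have Id: "?I (w a m) differentiable (at z)" "?I (?I (w a m)) differentiable (at z)" if "z \<in> ?S" for a m z
    by (rule diff[OF _ that], intro Ck_on_axis_integral w')+
  have dI: "partial i (?I (w a m)) z = (if i = e then w a m z else ?I (partial i (w a m)) z)"
    if "z \<in> ?S" for i a m z
    by (rule axis_integral_derivatives(2)[OF C1[OF w'] that])
  have dII: "partial i (?I (?I (w a m))) z = (if i = e then ?I (w a m) z else ?I (?I (partial i (w a m))) z)"
    if "z \<in> ?S" for i a m z
    by (rule partial_axis_integral_twice[OF C1[OF w'] that])
  have dv: "partial c (v a m) z = partial c (?I (w a m)) z" if "z \<in> ?S" for c a m z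
    unfolding v_eq by (subst partial_add) (use Id[OF that] in auto)
  have nd: "(\<lambda>z::real^'n. z $ a) differentiable (at z)" for a z
    using has_derivative_nth by (auto simp: differentiable_def)
  have dx: "partial c (\<lambda>z. x m z $ a) z = (if c = a then 1 else 0) + partial c (?I (?I (w a m))) z"
    if "z \<in> ?S" for c a m z
    unfolding x_eq using Id[OF that] nd
    by (simp add: partial_add differentiable_add partial_nth)
  have "Ck_convergent k ?S (\<lambda>m. partial c (w h m))" for c h
  proof (cases "c = e")
    case True
    show ?thesis
    proof (rule Ck_convergent_shift)
      have "Ck_convergent k ?S (\<lambda>m z. \<Sum>a\<in>UNIV. A h a m z * v a m z + C h a m z * w a m z)"
        by (intro Ck_convergent_sum[OF op] Ck_convergent_add[OF op] Ck_convergent_mult[OF op] A C v w)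
      moreover have "Ck_convergent k ?S (\<lambda>m. partial c (w h (Suc m))) =
          Ck_convergent k ?S (\<lambda>m z. \<Sum>a\<in>UNIV. A h a m z * v a m z + C h a m z * w a m z)"
      proof (rule Ck_convergent_cong[OF op])
        fix m z assume z: "z \<in> ?S"
        have "partial e (\<lambda>z. x m z $ a) z = v a m z" "partial e (v a m) z = w a m z" for a
          using dx[OF z] dv[OF z] dI[OF z] dII[OF z] by (auto simp: v_eq)
        then show "partial c (w h (Suc m)) z = (\<Sum>a\<in>UNIV. A h a m z * v a m z + C h a m z * w a m z)"
          unfolding True dw[OF z] by simp
      qed
      ultimately show "Ck_convergent k ?S (\<lambda>m. partial c (w h (Suc m)))" by blast
    qed (use w'[of h 0] in simp)
  next
    case False
    show ?thesis
    proof (rule affine_recursion_Ck_convergent[where W = "\<lambda>h m. partial c (w h m)" and B = "\<lambda>h. A h c",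
          OF A C A A_le C_le small])
      show "partial c (w h (Suc m)) z = (\<Sum>a\<in>UNIV. A h a m z * ?I (?I (partial c (w a m))) z +
          C h a m z * ?I (partial c (w a m)) z) + A h c m z" if "z \<in> ?S" for h m z
      proof -
        have "A h a m z * partial c (\<lambda>z. x m z $ a) z + C h a m z * partial c (v a m) z =
            (A h a m z * ?I (?I (partial c (w a m))) z + C h a m z * ?I (partial c (w a m)) z) +
            (if c = a then A h a m z else 0)" for a
          using False by (simp add: dx[OF that] dv[OF that] dI[OF that] dII[OF that] distrib_left)
        then show ?thesis
          unfolding dw[OF that] by (simp add: sum.distrib)
      qed
      show "Ck_on k ?S (partial c (w h 0))" for h
        using w'[of h 0] by simp
    qed
  qed
  moreover obtain l where "converges_continuously ?S (w h) l"
    using Ck_convergent_limit[OF w] .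
  ultimately have "Ck_convergent (Suc k) ?S (w h)"
    using diff[OF w'] by auto
  then show ?case unfolding w_def[abs_def] .
qed

end

section \<open>Solving the geodesic equation with parameters\<close>

text \<open>All smallness conditions hold for small radii, since they bound quantities that are \<open>O(\<rho>)\<close>.\<close>

lemma contraction_radius:
  fixes N L R R0 c :: real
  assumes "0 \<le> N" "0 \<le> L" "0 \<le> R" "0 < R0" "0 \<le> c"
  obtains \<rho> where "\<rho> > 0" "\<rho> * R \<le> 1" "2 * \<rho> \<le> R0" "c * (4 * L * \<rho>\<^sup>2 + 4 * N * \<rho>) \<le> 1 / 2"
proof -
  \<comment> \<open>each condition says that \<open>\<rho>\<close> times one of these summands is at most \<open>1\<close>\<close>
  define D where "D = 1 + R + 2 / R0 + 8 * c * (L + N)"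
  have D: "D \<ge> 1" "D \<ge> R" "D \<ge> 2 / R0" "D \<ge> 8 * c * (L + N)"
    using assms by (auto simp: D_def)
  define \<rho> where "\<rho> = 1 / D"
  have \<rho>: "\<rho> > 0" "\<rho> \<le> 1" using D(1) by (auto simp: \<rho>_def)
  show ?thesis
  proof (rule that[OF \<rho>(1)])
    show "\<rho> * R \<le> 1" "2 * \<rho> \<le> R0"
      using D assms(4) by (auto simp: \<rho>_def field_simps)
    have "\<rho>\<^sup>2 \<le> \<rho>" using \<rho> by (simp add: power2_eq_square mult_left_le)
    then have "4 * L * \<rho>\<^sup>2 + 4 * N * \<rho> \<le> 4 * L * \<rho> + 4 * N * \<rho>"
      using assms(2) by (intro add_right_mono mult_left_mono) auto
    then have "c * (4 * L * \<rho>\<^sup>2 + 4 * N * \<rho>) \<le> c * (4 * L * \<rho> + 4 * N * \<rho>)"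
      using assms(5) by (rule mult_left_mono)
    also have "\<dots> = 8 * c * (L + N) * \<rho> / 2" by (simp add: algebra_simps)
    also have "\<dots> \<le> 1 / 2" using D(1,4) by (simp add: \<rho>_def)
    finally show "c * (4 * L * \<rho>\<^sup>2 + 4 * N * \<rho>) \<le> 1 / 2" .
  qed
qed

lemma lipschitz_of_partial_bound:
  fixes F :: "real^'n::finite \<Rightarrow> real"
  assumes "convex S" "\<And>x. x \<in> S \<Longrightarrow> F differentiable (at x)"
    and B: "\<And>a x. x \<in> S \<Longrightarrow> \<bar>partial a F x\<bar> \<le> B"
    and xy: "x \<in> S" "y \<in> S" and d: "\<And>a. \<bar>x $ a - y $ a\<bar> \<le> d"
  shows "\<bar>F x - F y\<bar> \<le> (real CARD('n))\<^sup>2 * B * d"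
proof -
  have "0 \<le> B" using B[OF xy(1)] order_trans[OF abs_ge_zero] by blast
  have "norm (F x - F y) \<le> (real CARD('n) * B) * norm (x - y)"
  proof (rule differentiable_bound[OF assms(1) _ _ xy])
    fix z assume z: "z \<in> S"
    show "(F has_derivative (\<lambda>h. \<Sum>i\<in>UNIV. partial i F z * h $ i)) (at z within S)"
      by (rule has_derivative_at_withinI[OF has_derivative_partials[OF assms(2)[OF z]]])
    show "onorm (\<lambda>h. \<Sum>i\<in>UNIV. partial i F z * h $ i) \<le> real CARD('n) * B"
    proof (rule onorm_bound)
      show "norm (\<Sum>i\<in>UNIV. partial i F z * h $ i) \<le> real CARD('n) * B * norm h" for h :: "real^'n"
        using abs_sum_mult_nth_le[where c = "\<lambda>i. partial i F z", OF B[OF z]] by simp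
    qed (use \<open>0 \<le> B\<close> in simp)
  qed
  also have "norm (x - y) \<le> real CARD('n) * d"
  proof -
    have "norm (x - y) \<le> (\<Sum>i\<in>UNIV. \<bar>(x - y) $ i\<bar>)" by (rule norm_le_l1_cart)
    also have "\<dots> \<le> (\<Sum>i\<in>(UNIV::'n set). d)" using d by (intro sum_mono) simp
    finally show ?thesis by simp
  qed
  then have "(real CARD('n) * B) * norm (x - y) \<le> (real CARD('n) * B) * (real CARD('n) * d)"
    using \<open>0 \<le> B\<close> by (intro mult_left_mono) auto
  finally show ?thesis by (simp add: power2_eq_square mult_ac)
qed

text \<open>The cube is found from bounds for \<open>\<Gamma>\<close> and its first derivatives near \<open>q\<close>; afterwards the
  regularity holds on this cube for every \<open>k\<close>.\<close>

theorem smooth_geodesic_acceleration: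
  fixes \<Gamma> :: "'n::finite components"
  assumes V: "open V" "q \<in> V" and \<Gamma>1: "\<And>h i j. Ck_on (Suc 0) V (\<Gamma> h i j)"
  obtains \<rho> w where "\<rho> > 0"
    "\<And>z. z \<in> open_cube \<rho> \<Longrightarrow> q + geodesic_displacement e w z \<in> V"
    "\<And>z. z \<in> open_cube \<rho> \<Longrightarrow> geodesic_acceleration \<Gamma> q e w z = w z"
    "\<And>k h. (\<And>h i j. Ck_on k V (\<Gamma> h i j)) \<Longrightarrow> Ck_on k (open_cube \<rho>) (\<lambda>z. w z $ h)"
proof -
  obtain R0 where "R0 > 0" and R0: "\<And>x. x \<in> cube R0 \<Longrightarrow> q + x \<in> V"
    using open_contains_translated_cube[OF V] by blast
  have \<Gamma>_cont: "continuous_on (cube R0) (\<lambda>x. F (q + x))" if "continuous_on V F" for F :: "real^'n \<Rightarrow> real"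
    by (rule continuous_on_compose2[OF that]) (use R0 in \<open>auto intro!: continuous_intros\<close>)
  note \<Gamma>c = \<Gamma>_cont[OF Ck_on_imp_continuous_on[OF \<Gamma>1]]
  have pc: "continuous_on V (partial a (\<Gamma> h i j))" for a h i j
    using \<Gamma>1 by simp
  obtain N where N: "N \<ge> 0" and N_le: "\<And>k x. x \<in> cube R0 \<Longrightarrow> \<bar>(\<lambda>(h, i, j) x. \<Gamma> h i j (q + x)) k x\<bar> \<le> N"
    by (rule finite_family_bounded_on_compact[OF compact_cube, of R0 "\<lambda>(h, i, j) x. \<Gamma> h i j (q + x)"])
       (use \<Gamma>c in auto)
  obtain B where B: "B \<ge> 0" and B_le: "\<And>k x. x \<in> cube R0 \<Longrightarrow> \<bar>(\<lambda>(a, h, i, j) x. partial a (\<Gamma> h i j) (q + x)) k x\<bar> \<le> B"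
    by (rule finite_family_bounded_on_compact[OF compact_cube, of R0 "\<lambda>(a, h, i, j) x. partial a (\<Gamma> h i j) (q + x)"])
       (use \<Gamma>_cont[OF pc] in auto)
  have N_le: "\<bar>\<Gamma> h i j (q + x)\<bar> \<le> N" if "x \<in> cube R0" for h i j x
    using N_le[OF that, of "(h, i, j)"] by simp
  have B_le: "\<bar>partial a (\<Gamma> h i j) (q + x)\<bar> \<le> B" if "x \<in> cube R0" for a h i j x
    using B_le[OF that, of "(a, h, i, j)"] by simp
  define n where "n = real CARD('n)"
  have "n \<ge> 1" unfolding n_def by (simp add: Suc_leI)
  define L where "L = n\<^sup>2 * B"
  define R where "R = 4 * n\<^sup>2 * N"
  have "0 \<le> L" "0 \<le> R" using N B by (auto simp: L_def R_def)
  then obtain \<rho> where \<rho>: "\<rho> > 0" "\<rho> * R \<le> 1" "2 * \<rho> \<le> R0" "n\<^sup>2 * (4 * L * \<rho>\<^sup>2 + 4 * N * \<rho>) \<le> 1 / 2"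
    using contraction_radius[OF N, of L R R0 "n\<^sup>2"] \<open>R0 > 0\<close> by auto
  define nrm where "nrm = (\<lambda>M (f :: real^'n \<Rightarrow> real). continuous_on (cube \<rho>) f \<and> (\<forall>z\<in>cube \<rho>. \<bar>f z\<bar> \<le> M))"
  interpret function_norm e \<rho> nrm
    unfolding nrm_def by (rule sup_function_norm[OF \<rho>(1)])
  have in_cube: "u z \<in> cube R0" if "\<And>a. nrm R0 (\<lambda>z. u z $ a)" "z \<in> cube \<rho>" for u z
    using bound[OF that(1) that(2)] by (simp add: cube_def)
  have \<Gamma>u: "continuous_on (cube \<rho>) (\<lambda>z. \<Gamma> h i j (q + u z))" if u: "\<And>a. nrm R0 (\<lambda>z. u z $ a)" for u h i j
  proof (rule continuous_on_compose2[OF \<Gamma>c])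
    have "continuous_on (cube \<rho>) (\<lambda>z. \<chi> a. u z $ a)"
      by (intro continuous_on_vec_lambda continuous[OF u])
    then show "continuous_on (cube \<rho>) u" by simp
  qed (use in_cube[OF u] in blast)
  interpret geodesic_contraction e \<rho> nrm \<Gamma> q N L R0 R
  proof
    show "nrm N (\<lambda>z. \<Gamma> h i j (q + u z))" if "\<And>a. nrm R0 (\<lambda>z. u z $ a)" for u h i j
      using \<Gamma>u[OF that] N_le in_cube[OF that] by (simp add: nrm_def)
    show "nrm (L * d) (\<lambda>z. \<Gamma> h i j (q + u z) - \<Gamma> h i j (q + v z))"
      if u: "\<And>a. nrm R0 (\<lambda>z. u z $ a)" and v: "\<And>a. nrm R0 (\<lambda>z. v z $ a)"
        and d: "\<And>a. nrm d (\<lambda>z. u z $ a - v z $ a)" for u v d h i j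
      unfolding nrm_def
    proof (intro conjI ballI continuous_intros \<Gamma>u u v)
      fix z :: "real^'n" assume z: "z \<in> cube \<rho>"
      have "\<bar>\<Gamma> h i j (q + u z) - \<Gamma> h i j (q + v z)\<bar> \<le> (real CARD('n))\<^sup>2 * B * d"
      proof (rule lipschitz_of_partial_bound)
        show "convex ((+) q ` cube R0)" by (rule convex_translation[OF convex_cube])
        show "\<Gamma> h i j differentiable (at x)" if "x \<in> (+) q ` cube R0" for x
          using that R0 \<Gamma>1[of h i j] by auto
        show "\<bar>partial a (\<Gamma> h i j) x\<bar> \<le> B" if "x \<in> (+) q ` cube R0" for a x
          using that B_le by auto
        show "\<bar>(q + u z) $ a - (q + v z) $ a\<bar> \<le> d" for a
          using bound[OF d z] by simp
      qed (use in_cube u v z in auto)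
      then show "\<bar>\<Gamma> h i j (q + u z) - \<Gamma> h i j (q + v z)\<bar> \<le> L * d"
        by (simp add: L_def n_def)
    qed
  qed (use N \<rho> in \<open>auto simp: R_def n_def\<close>)
  show ?thesis
  proof (rule that[OF \<rho>(1)])
    fix z :: "real^'n" assume "z \<in> open_cube \<rho>"
    then have z: "z \<in> cube \<rho>" using open_cube_subset_cube by blast
    show "q + geodesic_displacement e limit_acceleration z \<in> V"
      by (rule R0[OF limit_displacement_in_cube[OF z]])
    show "geodesic_acceleration \<Gamma> q e limit_acceleration z = limit_acceleration z"
      by (rule limit_acceleration_fixed_point[OF \<Gamma>c z])
  next
    fix k h assume "\<And>h i j. Ck_on k V (\<Gamma> h i j)"
    moreover have "n * B \<le> L"
      using mult_right_mono[OF \<open>n \<ge> 1\<close>, of "n * B"] \<open>n \<ge> 1\<close> B by (simp add: L_def power2_eq_square mult.assoc)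
    ultimately have "Ck_convergent k (open_cube \<rho>) (\<lambda>m z. picard \<Gamma> q e m z $ h)"
      by (intro picard_Ck_convergent[OF V(1) R0 N_le B_le]) (auto simp: n_def)
    then show "Ck_on k (open_cube \<rho>) (\<lambda>z. limit_acceleration z $ h)"
      by (rule Ck_on_limit[OF open_open_cube _ converges_continuously_cube[OF picard_continuous picard_uniform_limit]])
  qed
qed

text \<open>A sequence whose increments decay like \<open>R / 2^m\<close> has a limit, which is again a power series.\<close>

lemma analytic_norm_le_telescope:
  assumes "\<rho> > 0" "R \<ge> 0" and d: "\<And>m. analytic_norm_le \<rho> (R / 2 ^ m) (\<lambda>z. f (Suc m) z - f m z)"
  shows "analytic_norm_le \<rho> (2 * R) (\<lambda>z. \<Sum>m. f (Suc m) z - f m z)"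
    and "z \<in> cube \<rho> \<Longrightarrow> (\<lambda>m. f m z) \<longlonglongrightarrow> f 0 z + (\<Sum>m. f (Suc m) z - f m z)"
proof -
  have geo: "(\<lambda>m. R * (1 / 2) ^ m) sums (R * 2)"
    using sums_mult[OF geometric_sums[of "1 / 2 :: real"], of R] by simp
  then have geo': "((\<lambda>m. R / 2 ^ m) has_sum 2 * R) UNIV"
    using \<open>R \<ge> 0\<close> by (intro sums_nonneg_imp_has_sum) (auto simp: power_divide mult.commute)
  have summ: "summable (\<lambda>m. norm (f (Suc m) z - f m z))" if z: "z \<in> cube \<rho>" for z
  proof (rule summable_comparison_test'[OF sums_summable[OF geo], of 0])
    show "norm (norm (f (Suc m) z - f m z)) \<le> R * (1 / 2) ^ m" for m
      using analytic_norm_le_bound[OF d z, of m] by (simp add: power_divide)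
  qed
  show "analytic_norm_le \<rho> (2 * R) (\<lambda>z. \<Sum>m. f (Suc m) z - f m z)"
    by (rule analytic_norm_le_infsum[OF d geo' order_refl assms(1)])
       (rule norm_summable_imp_has_sum[OF summ summable_sums[OF summable_norm_cancel[OF summ]]])
  show "(\<lambda>m. f m z) \<longlonglongrightarrow> f 0 z + (\<Sum>m. f (Suc m) z - f m z)" if z: "z \<in> cube \<rho>"
  proof -
    have "(\<lambda>n. f 0 z + (\<Sum>m<n. f (Suc m) z - f m z)) \<longlonglongrightarrow> f 0 z + (\<Sum>m. f (Suc m) z - f m z)"
      using summable_LIMSEQ[OF summable_norm_cancel[OF summ[OF z]]] by (intro tendsto_intros)
    moreover have "f 0 z + (\<Sum>m<n. f (Suc m) z - f m z) = f n z" for n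
      using sum_lessThan_telescope[of "\<lambda>m. f m z" n] by simp
    ultimately show ?thesis by simp
  qed
qed

text \<open>\<open>\<Gamma>\<close> is a power series near \<open>q\<close>, so substitution into it is bounded and Lipschitz
  by \<open>analytic_norm_le_compose\<close> and \<open>analytic_norm_le_lipschitz\<close>.\<close>

theorem analytic_geodesic_acceleration:
  fixes \<Gamma> :: "'n::finite components"
  assumes V: "open V" "q \<in> V" and \<Gamma>: "\<And>h i j. real_analytic_on V (\<Gamma> h i j)"
  obtains \<rho> w R where "\<rho> > 0"
    "\<And>z. z \<in> open_cube \<rho> \<Longrightarrow> q + geodesic_displacement e w z \<in> V"
    "\<And>z. z \<in> open_cube \<rho> \<Longrightarrow> geodesic_acceleration \<Gamma> q e w z = w z"
    "\<And>h. analytic_norm_le \<rho> R (\<lambda>z. w z $ h)"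
proof -
  have "\<exists>\<rho> N. analytic_norm_le \<rho> N (\<lambda>x. \<Gamma> h i j (q + x))" for h i j
    using \<Gamma> V(2) unfolding real_analytic_on_iff analytic_at_0_def by blast
  then obtain P M where PM: "\<And>h i j. analytic_norm_le (P h i j) (M h i j) (\<lambda>x. \<Gamma> h i j (q + x))"
    by metis
  obtain R1 where "R1 > 0" and R1: "\<And>x. x \<in> cube R1 \<Longrightarrow> q + x \<in> V"
    using open_contains_translated_cube[OF V] by blast
  let ?P = "\<lambda>(h, i, j). P h i j" and ?M = "\<lambda>(h, i, j). M h i j"
  define R2 where "R2 = min R1 (Min (range ?P))"
  define N where "N = (\<Sum>k\<in>UNIV. ?M k)"
  have P: "P h i j > 0" and M: "M h i j \<ge> 0" for h i j
    using analytic_norm_le_pos[OF PM] analytic_norm_le_nonneg[OF PM] by auto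
  have "R2 > 0" using \<open>R1 > 0\<close> P by (auto simp: R2_def)
  have "N \<ge> 0" unfolding N_def using M by (intro sum_nonneg) auto
  have \<Gamma>2: "analytic_norm_le R2 N (\<lambda>x. \<Gamma> h i j (q + x))" for h i j
  proof (rule analytic_norm_le_mono[OF analytic_norm_le_radius[OF PM \<open>R2 > 0\<close>]])
    have "Min (range ?P) \<le> ?P (h, i, j)" by (rule Min_le[OF _ rangeI]) simp
    then show "R2 \<le> P h i j" by (simp add: R2_def)
    have "?M (h, i, j) \<le> N"
      unfolding N_def using M by (intro member_le_sum) auto
    then show "M h i j \<le> N" by simp
  qed
  define R0 where "R0 = R2 / 2"
  have R0: "0 < R0" "R0 < R2" using \<open>R2 > 0\<close> by (auto simp: R0_def)
  define L where "L = N / (R2 - R0)"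
  define n where "n = real CARD('n)"
  define R where "R = 4 * n\<^sup>2 * N"
  have "0 \<le> L" "0 \<le> R" using \<open>N \<ge> 0\<close> R0 by (auto simp: L_def R_def)
  then obtain \<rho> where \<rho>: "\<rho> > 0" "\<rho> * R \<le> 1" "2 * \<rho> \<le> R0" "n\<^sup>2 * (4 * L * \<rho>\<^sup>2 + 4 * N * \<rho>) \<le> 1 / 2"
    using contraction_radius[OF \<open>N \<ge> 0\<close>, of L R R0 "n\<^sup>2"] R0(1) by auto
  interpret function_norm e \<rho> "analytic_norm_le \<rho>"
    by (rule analytic_function_norm[OF \<rho>(1)])
  interpret geodesic_contraction e \<rho> "analytic_norm_le \<rho>" \<Gamma> q N L R0 R
  proof
    show "analytic_norm_le \<rho> N (\<lambda>z. \<Gamma> h i j (q + u z))" if "\<And>a. analytic_norm_le \<rho> R0 (\<lambda>z. u z $ a)" for u h i j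
      by (rule analytic_norm_le_compose[OF analytic_norm_le_radius[OF \<Gamma>2] that]) (use R0 in auto)
    show "analytic_norm_le \<rho> (L * d) (\<lambda>z. \<Gamma> h i j (q + u z) - \<Gamma> h i j (q + v z))"
      if "\<And>a. analytic_norm_le \<rho> R0 (\<lambda>z. u z $ a)" "\<And>a. analytic_norm_le \<rho> R0 (\<lambda>z. v z $ a)"
        "\<And>a. analytic_norm_le \<rho> d (\<lambda>z. u z $ a - v z $ a)" for u v d h i j
      unfolding L_def by (rule analytic_norm_le_lipschitz[OF \<Gamma>2 R0 that])
  qed (use \<open>N \<ge> 0\<close> \<rho> in \<open>auto simp: R_def n_def\<close>)
  show ?thesis
  proof (rule that[OF \<rho>(1)])
    fix z :: "real^'n" assume "z \<in> open_cube \<rho>"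
    then have z: "z \<in> cube \<rho>" using open_cube_subset_cube by blast
    have sub: "cube R0 \<subseteq> (cube R2 :: (real^'n) set)" "cube R0 \<subseteq> (cube R1 :: (real^'n) set)"
      by (intro cube_mono; use R0 in \<open>simp add: R0_def R2_def\<close>)+
    show "q + geodesic_displacement e limit_acceleration z \<in> V"
      using R1 limit_displacement_in_cube[OF z] sub by blast
    show "geodesic_acceleration \<Gamma> q e limit_acceleration z = limit_acceleration z"
      by (rule limit_acceleration_fixed_point[OF continuous_on_subset[OF analytic_norm_le_continuous_on[OF \<Gamma>2] sub(1)] z])
  next
    fix h
    show "analytic_norm_le \<rho> (2 * R) (\<lambda>z. limit_acceleration z $ h)"
      using analytic_norm_le_telescope(1)[where f = "\<lambda>m z. picard \<Gamma> q e m z $ h", OF \<rho>(1) R_nonneg picard_diff]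
      by (simp add: limit_acceleration_def)
  qed
qed

section \<open>Calculus of analytic functions and of the classes \<open>C\<^sup>r\<close>\<close>

lemma analytic_at_0_const: "analytic_at_0 (\<lambda>_. c)"
  unfolding analytic_at_0_def using analytic_norm_le_const[of 1 c] by auto

lemma analytic_at_0_common_radius:
  assumes "analytic_at_0 f" "analytic_at_0 g"
  obtains \<rho> M N where "analytic_norm_le \<rho> M f" "analytic_norm_le \<rho> N g"
proof -
  obtain \<rho> M \<sigma> N where f: "analytic_norm_le \<rho> M f" and g: "analytic_norm_le \<sigma> N g"
    using assms unfolding analytic_at_0_def by blast
  have "min \<rho> \<sigma> > 0" using analytic_norm_le_pos[OF f] analytic_norm_le_pos[OF g] by simp
  then show ?thesis
    using that[of "min \<rho> \<sigma>" M N] analytic_norm_le_radius[OF f] analytic_norm_le_radius[OF g] by simp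
qed

lemma analytic_at_0_add: "analytic_at_0 f \<Longrightarrow> analytic_at_0 g \<Longrightarrow> analytic_at_0 (\<lambda>z. f z + g z)"
  by (rule analytic_at_0_common_radius[of f g])
     (auto simp: analytic_at_0_def dest: analytic_norm_le_add)

lemma analytic_at_0_mult: "analytic_at_0 f \<Longrightarrow> analytic_at_0 g \<Longrightarrow> analytic_at_0 (\<lambda>z. f z * g z)"
  by (rule analytic_at_0_common_radius[of f g])
     (auto simp: analytic_at_0_def dest: analytic_norm_le_mult)

lemma analytic_norm_le_small:
  assumes "analytic_norm_le \<rho> N f" "f 0 = 0" "R > 0"
  obtains \<sigma> where "0 < \<sigma>" "\<And>\<tau>. 0 < \<tau> \<Longrightarrow> \<tau> \<le> \<sigma> \<Longrightarrow> analytic_norm_le \<tau> R f"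
proof -
  have pos: "\<rho> > 0" "N \<ge> 0" using analytic_norm_le_pos[OF assms(1)] analytic_norm_le_nonneg[OF assms(1)] .
  define \<sigma> where "\<sigma> = min \<rho> (\<rho> * R / (N + 1))"
  have \<sigma>: "0 < \<sigma>" "\<sigma> \<le> \<rho>" using pos assms(3) by (auto simp: \<sigma>_def)
  have "analytic_norm_le \<tau> R f" if "0 < \<tau>" "\<tau> \<le> \<sigma>" for \<tau>
  proof (rule analytic_norm_le_mono[OF analytic_norm_le_vanishing[OF assms(1,2) that(1)]])
    show "\<tau> \<le> \<rho>" using that \<sigma> by simp
    have "\<tau> \<le> \<rho> * R / (N + 1)" using that by (simp add: \<sigma>_def)
    then have "\<tau> / \<rho> * N \<le> R / (N + 1) * N"
      using pos by (intro mult_right_mono) (auto simp: field_simps)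
    also have "\<dots> \<le> R" using pos assms(3) by (simp add: field_simps)
    finally show "\<tau> / \<rho> * N \<le> R" .
  qed
  with \<sigma>(1) that show ?thesis by blast
qed

text \<open>The inner function minus its value at \<open>0\<close> vanishes at \<open>0\<close>, so on a small cube its norm is
  below the radius of the outer series.\<close>

lemma analytic_at_0_compose:
  fixes F :: "real^'b::finite \<Rightarrow> real" and g :: "real^'a::finite \<Rightarrow> real^'b"
  assumes F: "analytic_at_0 (\<lambda>y. F (g 0 + y))" and g: "\<And>a. analytic_at_0 (\<lambda>z. g z $ a)"
  shows "analytic_at_0 (\<lambda>z. F (g z))"
proof -
  obtain R N where RN: "analytic_norm_le R N (\<lambda>y. F (g 0 + y))"
    using F unfolding analytic_at_0_def by blast
  have "\<exists>\<sigma>>0. \<forall>\<tau>. 0 < \<tau> \<longrightarrow> \<tau> \<le> \<sigma> \<longrightarrow> analytic_norm_le \<tau> R (\<lambda>z. g z $ a - g 0 $ a)" for a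
  proof -
    obtain \<rho> M where "analytic_norm_le \<rho> M (\<lambda>z. g z $ a + - g 0 $ a)"
      using analytic_at_0_add[OF g analytic_at_0_const, of a "- g 0 $ a"] unfolding analytic_at_0_def by auto
    then have "analytic_norm_le \<rho> M (\<lambda>z. g z $ a - g 0 $ a)" by simp
    from analytic_norm_le_small[OF this _ analytic_norm_le_pos[OF RN]] show ?thesis
      by (metis cancel_comm_monoid_add_class.diff_cancel)
  qed
  then obtain \<sigma> where \<sigma>: "\<And>a. \<sigma> a > 0"
    "\<And>a \<tau>. 0 < \<tau> \<Longrightarrow> \<tau> \<le> \<sigma> a \<Longrightarrow> analytic_norm_le \<tau> R (\<lambda>z. g z $ a - g 0 $ a)"
    by metis
  define \<tau> where "\<tau> = Min (range \<sigma>)"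
  have "\<tau> > 0" using \<sigma>(1) by (auto simp: \<tau>_def)
  have "\<tau> \<le> \<sigma> a" for a unfolding \<tau>_def by (rule Min_le[OF _ rangeI]) simp
  then have "analytic_norm_le \<tau> R (\<lambda>z. (g z - g 0) $ a)" for a
    using \<sigma>(2)[OF \<open>\<tau> > 0\<close>, of a] by simp
  from analytic_norm_le_compose[OF RN this] show ?thesis
    unfolding analytic_at_0_def by auto
qed

text \<open>A power series can be expanded around each point of its open cube: substitute \<open>p + z\<close>, whose
  components have norm at most \<open>\<rho>\<close> on a small cube.\<close>

lemma analytic_at_0_translate:
  assumes f: "analytic_norm_le \<rho> N f" and p: "p \<in> open_cube \<rho>"
  shows "analytic_at_0 (\<lambda>z. f (p + z))"
proof -
  obtain \<sigma> where \<sigma>: "0 < \<sigma>" "\<sigma> < \<rho>" "p \<in> open_cube \<sigma>"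
    using open_cube_cube_between[OF p] .
  have "analytic_norm_le (\<rho> - \<sigma>) \<rho> (\<lambda>z. (p + z) $ i)" for i
  proof (rule analytic_norm_le_mono)
    show "analytic_norm_le (\<rho> - \<sigma>) (\<bar>p $ i\<bar> + (\<rho> - \<sigma>)) (\<lambda>z. (p + z) $ i)"
      unfolding vector_add_component
      by (intro analytic_norm_le_add analytic_norm_le_const analytic_norm_le_nth) (use \<sigma> in auto)
    show "\<bar>p $ i\<bar> + (\<rho> - \<sigma>) \<le> \<rho>"
      using \<sigma>(3) by (simp add: open_cube_def less_imp_le)
  qed
  from analytic_norm_le_compose[OF f this] show ?thesis
    unfolding analytic_at_0_def by blast
qed

lemma analytic_norm_le_imp_real_analytic_on: "analytic_norm_le \<rho> N f \<Longrightarrow> real_analytic_on (open_cube \<rho>) f"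
  unfolding real_analytic_on_iff using analytic_at_0_translate by blast

lemma real_analytic_on_const: "real_analytic_on S (\<lambda>_. c)"
  by (simp add: real_analytic_on_iff analytic_at_0_const)

lemma real_analytic_on_nth: "real_analytic_on S (\<lambda>x. x $ i)"
proof -
  have "analytic_at_0 (\<lambda>z::real^'a. z $ i)" for i
    unfolding analytic_at_0_def using analytic_norm_le_nth[of 1 i] by auto
  then show ?thesis
    by (simp add: real_analytic_on_iff analytic_at_0_add analytic_at_0_const)
qed

lemma real_analytic_on_add:
  "real_analytic_on S f \<Longrightarrow> real_analytic_on S g \<Longrightarrow> real_analytic_on S (\<lambda>x. f x + g x)"
  by (simp add: real_analytic_on_iff analytic_at_0_add)

lemma real_analytic_on_mult:
  "real_analytic_on S f \<Longrightarrow> real_analytic_on S g \<Longrightarrow> real_analytic_on S (\<lambda>x. f x * g x)"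
  by (simp add: real_analytic_on_iff analytic_at_0_mult)

lemma real_analytic_on_compose:
  fixes F :: "real^'b::finite \<Rightarrow> real" and g :: "real^'a::finite \<Rightarrow> real^'b"
  assumes "real_analytic_on V F" "\<And>a. real_analytic_on S (\<lambda>x. g x $ a)" "\<And>x. x \<in> S \<Longrightarrow> g x \<in> V"
  shows "real_analytic_on S (\<lambda>x. F (g x))"
  unfolding real_analytic_on_iff
proof
  fix p assume "p \<in> S"
  show "analytic_at_0 (\<lambda>z. F (g (p + z)))"
    by (rule analytic_at_0_compose[where g = "\<lambda>z. g (p + z)"])
       (use assms \<open>p \<in> S\<close> in \<open>auto simp: real_analytic_on_iff\<close>)
qed

lemma real_analytic_on_cong:
  assumes "open S" "\<And>x. x \<in> S \<Longrightarrow> f x = g x" "real_analytic_on S f"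
  shows "real_analytic_on S g"
  unfolding real_analytic_on_iff
proof
  fix p assume "p \<in> S"
  then obtain \<rho> N where f: "analytic_norm_le \<rho> N (\<lambda>z. f (p + z))"
    using assms(3) unfolding real_analytic_on_iff analytic_at_0_def by blast
  obtain \<sigma> where \<sigma>: "\<sigma> > 0" "\<And>x. x \<in> cube \<sigma> \<Longrightarrow> p + x \<in> S"
    using open_contains_translated_cube[OF assms(1) \<open>p \<in> S\<close>] by blast
  have "analytic_norm_le (min \<rho> \<sigma>) N (\<lambda>z. f (p + z))"
    by (rule analytic_norm_le_radius[OF f]) (use \<sigma>(1) analytic_norm_le_pos[OF f] in auto)
  then have "analytic_norm_le (min \<rho> \<sigma>) N (\<lambda>z. g (p + z))"
  proof (rule analytic_norm_le_cong)
    fix z :: "real^'a" assume "z \<in> cube (min \<rho> \<sigma>)"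
    then have "z \<in> cube \<sigma>" using cube_mono[of "min \<rho> \<sigma>" \<sigma>] by auto
    then show "f (p + z) = g (p + z)" using \<sigma>(2) assms(2) by simp
  qed
  then show "analytic_at_0 (\<lambda>z. g (p + z))" unfolding analytic_at_0_def by blast
qed

lemma real_analytic_on_partial:
  assumes f: "real_analytic_on S f"
  shows "\<And>x. x \<in> S \<Longrightarrow> f differentiable (at x)" and "real_analytic_on S (partial i f)"
proof -
  have *: "f differentiable (at p) \<and> analytic_at_0 (\<lambda>z. partial i f (p + z))" if "p \<in> S" for p i
  proof -
    obtain \<rho> N where \<rho>: "analytic_norm_le \<rho> N (\<lambda>z. f (p + z))"
      using f \<open>p \<in> S\<close> unfolding real_analytic_on_iff analytic_at_0_def by blast
    then have "\<rho> > 0" by (rule analytic_norm_le_pos)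
    then have "0 < \<rho> / 2" "\<rho> / 2 < \<rho>" by auto
    note part = analytic_norm_le_partial[OF \<rho> this]
    have "(\<lambda>z. f (p + z)) differentiable (at 0)"
      by (rule part(1)) (use \<open>\<rho> > 0\<close> in \<open>simp add: cube_def\<close>)
    then have "f differentiable (at p)"
      using has_derivative_translate[of f p _ 0] unfolding differentiable_def by auto
    moreover have "(\<lambda>z. partial i f (p + z)) = partial i (\<lambda>z. f (p + z))"
      by (simp add: fun_eq_iff partial_translate)
    ultimately show ?thesis
      using part(2)[of i] unfolding analytic_at_0_def by auto
  qed
  show "f differentiable (at x)" if "x \<in> S" for x
    using *[OF that] by blast
  show "real_analytic_on S (partial i f)"
    unfolding real_analytic_on_iff using * by blast
qed

lemma real_analytic_on_imp_Ck_on: "real_analytic_on S f \<Longrightarrow> Ck_on k S f"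
proof (induction k arbitrary: f)
  case 0
  then show ?case
    using real_analytic_on_partial(1)[OF 0]
    by (auto intro!: continuous_at_imp_continuous_on differentiable_imp_continuous_within)
next
  case (Suc k)
  then show ?case using real_analytic_on_partial[OF Suc.prems] by simp
qed

lemma of_class_const: "of_class r S (\<lambda>_. c)"
  by (cases r) (simp_all add: real_analytic_on_const)

lemma of_class_add: "open S \<Longrightarrow> of_class r S f \<Longrightarrow> of_class r S g \<Longrightarrow> of_class r S (\<lambda>x. f x + g x)"
  by (cases r) (simp_all add: real_analytic_on_add Ck_on_add)

lemma of_class_mult: "open S \<Longrightarrow> of_class r S f \<Longrightarrow> of_class r S g \<Longrightarrow> of_class r S (\<lambda>x. f x * g x)"
  by (cases r) (simp_all add: real_analytic_on_mult Ck_on_mult)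

lemma of_class_sum:
  assumes "open S" "\<And>a. a \<in> A \<Longrightarrow> of_class r S (f a)"
  shows "of_class r S (\<lambda>x. \<Sum>a\<in>A. f a x)"
  using assms(2)
proof (induction A rule: infinite_finite_induct)
  case (insert a A)
  then show ?case using of_class_add[OF assms(1)] by simp
qed (simp_all add: of_class_const)

lemma of_class_compose:
  fixes F :: "real^'b::finite \<Rightarrow> real" and g :: "real^'a::finite \<Rightarrow> real^'b"
  assumes "open S" "open V" "of_class r V F" "\<And>a. of_class r S (\<lambda>x. g x $ a)" "\<And>x. x \<in> S \<Longrightarrow> g x \<in> V"
  shows "of_class r S (\<lambda>x. F (g x))"
  using assms Ck_on_compose[OF assms(1,2)] real_analytic_on_compose
  by (cases r) fastforce+

lemma of_class_subset: "of_class r S f \<Longrightarrow> T \<subseteq> S \<Longrightarrow> of_class r T f"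
  by (cases r) (auto intro: Ck_on_subset simp: real_analytic_on_def)

lemma of_class_cong:
  assumes "open S" "\<And>x. x \<in> S \<Longrightarrow> f x = g x"
  shows "of_class r S f = of_class r S g"
proof (cases r)
  case C_omega
  show ?thesis
    using real_analytic_on_cong[OF assms] real_analytic_on_cong[OF assms(1), of g f] assms(2)
    by (auto simp: C_omega)
qed (use Ck_on_cong[OF assms] in auto)

lemma of_class_imp_Ck_on_2: "class_at_least_2 r \<Longrightarrow> open S \<Longrightarrow> of_class r S f \<Longrightarrow> Ck_on 2 S f"
  by (cases r) (auto intro: Ck_on_mono real_analytic_on_imp_Ck_on)

text \<open>The three ways in which \<open>f\<close> enters the transformation law.\<close>

lemma of_class_minus_2:
  assumes "class_at_least_2 r" "open S" "of_class r S f"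
  shows "of_class (class_minus_2 r) S f" "of_class (class_minus_2 r) S (partial i f)"
    "of_class (class_minus_2 r) S (partial i (partial j f))"
proof -
  have Ck: "Ck_on k S f \<and> Ck_on k S (partial i f) \<and> Ck_on k S (partial i (partial j f))"
    if "Ck_on (Suc (Suc k)) S f" for k
    using that Ck_on_mono[OF assms(2) that, of k] Ck_on_mono[OF assms(2), of "Suc k" "partial i f" k] by simp
  have "of_class (class_minus_2 r) S f \<and> of_class (class_minus_2 r) S (partial i f) \<and>
    of_class (class_minus_2 r) S (partial i (partial j f))"
  proof (cases r)
    case (C_fin k)
    then have "k = Suc (Suc (k - 2))" using assms(1) by simp
    then show ?thesis using Ck[of "k - 2"] assms(3) C_fin by simp
  next
    case C_infty
    then have "Ck_on k S f" for k
      using assms(3) by simp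
    from Ck[OF this] show ?thesis using C_infty by (simp del: Ck_on.simps)
  next
    case C_omega
    then have "real_analytic_on S f" using assms(3) by simp
    note part = real_analytic_on_partial(2)[OF this]
    show ?thesis
      using \<open>real_analytic_on S f\<close> part[of i] real_analytic_on_partial(2)[OF part[of j], of i] C_omega by simp
  qed
  then show "of_class (class_minus_2 r) S f" "of_class (class_minus_2 r) S (partial i f)"
    "of_class (class_minus_2 r) S (partial i (partial j f))" by blast+
qed

section \<open>Regularity of inverse functions\<close>

text \<open>The equation \<open>u + h(u) = z\<close> is solved by iterating \<open>u \<mapsto> z - h(u)\<close>. The norm of \<open>h\<close> is of second
  order in the radius, hence by \<open>analytic_norm_le_lipschitz\<close> its Lipschitz constant is of first order, so the
  iteration contracts on a small cube.\<close>

lemma analytic_local_inverse: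
  fixes h :: "real^'n::finite \<Rightarrow> real^'n"
  assumes "\<rho> > 0" "R \<ge> 0" "h 0 = 0"
    and h: "\<And>\<tau> a. 0 < \<tau> \<Longrightarrow> \<tau> \<le> \<rho> \<Longrightarrow> analytic_norm_le \<tau> (\<tau>\<^sup>2 * R) (\<lambda>z. h z $ a)"
  obtains \<sigma> u N where "\<sigma> > 0" "u 0 = 0" "\<And>a. analytic_norm_le \<sigma> N (\<lambda>z. u z $ a)"
    "\<And>z. z \<in> cube \<sigma> \<Longrightarrow> u z + h (u z) = z"
proof -
  \<comment> \<open>for this radius \<open>h\<close> has norm at most \<open>\<tau> / 8\<close> and, on half of it, Lipschitz constant at most \<open>1 / 4\<close>\<close>
  define \<tau> where "\<tau> = min \<rho> (1 / (8 * (R + 1)))"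
  have \<tau>: "0 < \<tau>" "\<tau> \<le> \<rho>" using assms(1,2) by (auto simp: \<tau>_def)
  have "\<tau> * R \<le> 1 / (8 * (R + 1)) * R"
    using assms(2) by (intro mult_right_mono) (auto simp: \<tau>_def)
  also have "\<dots> \<le> 1 / 8" using assms(2) by (simp add: field_simps)
  finally have \<tau>R: "\<tau> * R \<le> 1 / 8" .
  have \<tau>2R: "\<tau>\<^sup>2 * R \<le> \<tau> / 8"
    using mult_left_mono[OF \<tau>R less_imp_le[OF \<tau>(1)]] by (simp add: power2_eq_square mult.assoc)
  note h\<tau> = h[OF \<tau>]
  define \<sigma> where "\<sigma> = \<tau> / 4"
  have \<sigma>: "\<sigma> > 0" using \<tau>(1) by (simp add: \<sigma>_def)
  define T where "T u z = z - h (u z)" for u :: "real^'n \<Rightarrow> real^'n" and z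
  define U where "U m = (T ^^ m) (\<lambda>_. 0)" for m
  have U0: "U 0 z = 0" and USuc: "U (Suc m) z = z - h (U m z)" for m z
    by (simp_all add: U_def T_def)
  have bound: "analytic_norm_le \<sigma> (\<tau> / 2) (\<lambda>z. U m z $ a)" for m a
  proof (induction m arbitrary: a)
    case 0
    show ?case using analytic_norm_le_mono[OF analytic_norm_le_const[OF \<sigma>, of 0], of "\<tau> / 2"] \<tau>(1) by (simp add: U0)
  next
    case (Suc m)
    have "analytic_norm_le \<sigma> (\<tau>\<^sup>2 * R) (\<lambda>z. h (U m z) $ a)"
      by (rule analytic_norm_le_compose[OF h\<tau>]) (use analytic_norm_le_mono[OF Suc] \<tau>(1) in simp)
    then have "analytic_norm_le \<sigma> (\<sigma> + \<bar>-1\<bar> * (\<tau>\<^sup>2 * R)) (\<lambda>z. z $ a + -1 * h (U m z) $ a)"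
      by (intro analytic_norm_le_add analytic_norm_le_nth analytic_norm_le_cmult \<sigma>)
    then show ?case
      using \<tau>2R \<tau>(1) by (auto simp: USuc \<sigma>_def elim!: analytic_norm_le_mono)
  qed
  have diff: "analytic_norm_le \<sigma> (\<tau> / 2 / 2 ^ m) (\<lambda>z. U (Suc m) z $ a - U m z $ a)" for m a
  proof (induction m arbitrary: a)
    case 0
    show ?case using bound[of "Suc 0" a] by (simp add: U0)
  next
    case (Suc m)
    have "analytic_norm_le \<sigma> (\<tau>\<^sup>2 * R / (\<tau> - \<tau> / 2) * (\<tau> / 2 / 2 ^ m))
        (\<lambda>z. h (U (Suc m) z) $ a - h (U m z) $ a)"
      by (rule analytic_norm_le_lipschitz[OF h\<tau> _ _ bound bound Suc]) (use \<tau>(1) in auto)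
    from analytic_norm_le_cmult[OF this, of "-1"]
    have "analytic_norm_le \<sigma> (\<tau>\<^sup>2 * R / (\<tau> - \<tau> / 2) * (\<tau> / 2 / 2 ^ m))
        (\<lambda>z. U (Suc (Suc m)) z $ a - U (Suc m) z $ a)"
      by (simp add: USuc)
    moreover have "\<tau>\<^sup>2 * R / (\<tau> - \<tau> / 2) * (\<tau> / 2 / 2 ^ m) \<le> 1 / 2 * (\<tau> / 2 / 2 ^ m)"
    proof (rule mult_right_mono)
      have "\<tau>\<^sup>2 * R / (\<tau> - \<tau> / 2) = 2 * (\<tau> * R)" using \<tau>(1) by (simp add: power2_eq_square field_simps)
      then show "\<tau>\<^sup>2 * R / (\<tau> - \<tau> / 2) \<le> 1 / 2" using \<tau>R by simp
    qed (use \<tau>(1) in simp)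
    ultimately show ?case
      by (auto elim!: analytic_norm_le_mono)
  qed
  define u where "u z = (\<chi> a. \<Sum>m. U (Suc m) z $ a - U m z $ a)" for z
  have "0 \<le> \<tau> / 2" using \<tau>(1) by simp
  note tel = analytic_norm_le_telescope[where f = "\<lambda>m z. U m z $ a" for a, OF \<sigma> this diff]
  have u_anl: "analytic_norm_le \<sigma> (2 * (\<tau> / 2)) (\<lambda>z. u z $ a)" for a
    using tel(1)[of a] by (simp add: u_def)
  have lim: "(\<lambda>m. U m z) \<longlonglongrightarrow> u z" if "z \<in> cube \<sigma>" for z
    by (rule vec_tendstoI) (use tel(2)[OF that] in \<open>simp add: u_def U0\<close>)
  have in_cube: "U m z \<in> cube \<tau>" "u z \<in> cube \<tau>" if "z \<in> cube \<sigma>" for m z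
    using order_trans[OF analytic_norm_le_bound[OF bound that], of \<tau>]
      analytic_norm_le_bound[OF u_anl that] \<tau>(1)
    by (auto simp: cube_def)
  have h_cont: "continuous_on (cube \<tau>) h"
    using continuous_on_vec_lambda[of "cube \<tau>" "\<lambda>a z. h z $ a"] analytic_norm_le_continuous_on[OF h\<tau>] by simp
  have fixed: "u z + h (u z) = z" if z: "z \<in> cube \<sigma>" for z
  proof -
    have "(\<lambda>m. z - h (U m z)) \<longlonglongrightarrow> z - h (u z)"
      by (intro tendsto_intros continuous_on_tendsto_compose[OF h_cont lim[OF z]])
         (use in_cube[OF z] in auto)
    moreover have "(\<lambda>m. z - h (U m z)) \<longlonglongrightarrow> u z"
      using LIMSEQ_Suc[OF lim[OF z]] by (simp add: USuc)
    ultimately have "z - h (u z) = u z" by (rule LIMSEQ_unique)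
    then show ?thesis by (simp add: algebra_simps)
  qed
  have "U m 0 = 0" for m
    by (induction m) (simp_all add: U0 USuc assms(3))
  then have "u 0 = 0" by (simp add: u_def vec_eq_iff)
  then show ?thesis
    using that[OF \<sigma> _ u_anl fixed] by blast
qed

lemma Ck_on_det:
  assumes "open S" "\<And>i j. Ck_on k S (\<lambda>x. A x $ i $ j)"
  shows "Ck_on k S (\<lambda>x. det (A x))"
  unfolding det_def
  by (intro Ck_on_sum[OF assms(1)] Ck_on_mult[OF assms(1)] Ck_on_prod[OF assms(1)] Ck_on_const assms(2))

text \<open>By Cramer's rule the partial derivatives of the inverse function \<open>f\<close> are rational functions of
  those of \<open>g\<close>, evaluated at \<open>f\<close>. If \<open>f\<close> is \<open>C\<^sup>j\<close> and \<open>g\<close> is \<open>C\<^sup>j\<^sup>+\<^sup>1\<close>, they are \<open>C\<^sup>j\<close>, so \<open>f\<close> is \<open>C\<^sup>j\<^sup>+\<^sup>1\<close>.\<close>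

lemma Ck_on_inverse_function:
  fixes f g :: "real^'n::finite \<Rightarrow> real^'n"
  assumes W: "open W" and Y: "open Y" and fY: "\<And>x. x \<in> W \<Longrightarrow> f x \<in> Y" and gf: "\<And>x. x \<in> W \<Longrightarrow> g (f x) = x"
    and f_diff: "\<And>i x. x \<in> W \<Longrightarrow> (\<lambda>x. f x $ i) differentiable (at x)"
    and g: "\<And>a. Ck_on (Suc k) Y (\<lambda>y. g y $ a)"
  shows "Ck_on (Suc k) W (\<lambda>x. f x $ i)"
proof -
  define G where "G y = (\<chi> b a. partial a (\<lambda>z. g z $ b) y)" for y
  define F where "F x = (\<chi> a j. partial j (\<lambda>z. f z $ a) x)" for x
  have GF: "G (f x) ** F x = mat 1" if x: "x \<in> W" for x
  proof -
    have "(\<Sum>a\<in>UNIV. partial a (\<lambda>z. g z $ b) (f x) * partial j (\<lambda>z. f z $ a) x) = (if b = j then 1 else 0)" for b j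
    proof -
      have "(\<Sum>a\<in>UNIV. partial a (\<lambda>z. g z $ b) (f x) * partial j (\<lambda>z. f z $ a) x) = partial j (\<lambda>x. g (f x) $ b) x"
        using g[of b] fY[OF x] f_diff[OF x]
        by (intro partial_chain[where F = "\<lambda>z. g z $ b", symmetric]) auto
      also have "\<dots> = partial j (\<lambda>x. x $ b) x"
        by (rule partial_cong[OF W x]) (simp add: gf)
      finally show ?thesis by (simp add: partial_nth)
    qed
    then show ?thesis
      by (simp add: G_def F_def matrix_matrix_mult_def mat_def vec_eq_iff)
  qed
  have detG: "det (G (f x)) \<noteq> 0" if "x \<in> W" for x
    using arg_cong[OF GF[OF that], of det] by (auto simp: det_mul)
  \<comment> \<open>the numerator in Cramer's rule\<close>
  define M where "M i j y = (\<chi> b a. if a = i then axis j 1 $ b else G y $ b $ a)" for i j :: 'n and y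
  have F_eq: "partial j (\<lambda>z. f z $ i) x = det (M i j (f x)) * inverse (det (G (f x)))" if x: "x \<in> W" for i j x
  proof -
    have "G (f x) *v column j (F x) = axis j 1"
      using GF[OF x]
      by (simp add: vec_eq_iff matrix_matrix_mult_def matrix_vector_mult_def column_def mat_def axis_def)
    then have "column j (F x) = (\<chi> k. det (\<chi> b a. if a = k then axis j 1 $ b else G (f x) $ b $ a) / det (G (f x)))"
      using cramer[OF detG[OF x]] by blast
    from arg_cong[OF this, of "\<lambda>v. v $ i"] show ?thesis
      by (simp add: column_def F_def M_def divide_inverse)
  qed
  have "Ck_on j W (\<lambda>x. f x $ i)" if "j \<le> Suc k" for j i
    using that
  proof (induction j arbitrary: i)
    case 0
    show ?case
      using f_diff by (auto intro!: continuous_at_imp_continuous_on differentiable_imp_continuous_within)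
  next
    case (Suc j)
    have G: "Ck_on j Y (\<lambda>y. G y $ b $ a)" for b a
      using Ck_on_mono[OF Y Ck_on_partial[OF g], of j a b] Suc.prems by (simp add: G_def)
    have M: "Ck_on j Y (\<lambda>y. M i c y $ b $ a)" for i c b a
      using G by (cases "a = i") (simp_all add: M_def)
    have f: "Ck_on j W (\<lambda>x. f x $ i)" for i
      by (rule Suc.IH) (use Suc.prems in simp)
    have "Ck_on j W (\<lambda>x. det (M i c (f x)) * inverse (det (G (f x))))" for c
      by (rule Ck_on_mult[OF W Ck_on_compose[OF W Y Ck_on_det[OF Y M] f fY]
            Ck_on_inverse[OF W Ck_on_compose[OF W Y Ck_on_det[OF Y G] f fY] detG]])
    moreover have "Ck_on j W (partial c (\<lambda>x. f x $ i)) = Ck_on j W (\<lambda>x. det (M i c (f x)) * inverse (det (G (f x))))" for c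
      by (rule Ck_on_cong[OF W F_eq])
    ultimately show ?case using f_diff by simp
  qed
  then show ?thesis by blast
qed

section \<open>Coordinates adapted to a family of geodesics\<close>

text \<open>In the analytic case the expansion on the whole cube is recorded too; inverting \<open>g\<close> relies on it.\<close>

lemma geodesic_acceleration_of_class:
  fixes \<Gamma> :: "'n::finite components"
  assumes r: "class_at_least_2 r" and V: "open V" "q \<in> V" and \<Gamma>: "\<And>h i j. of_class r V (\<Gamma> h i j)"
  obtains \<rho> w where "\<rho> > 0"
    "\<And>z. z \<in> open_cube \<rho> \<Longrightarrow> q + geodesic_displacement e w z \<in> V"
    "\<And>z. z \<in> open_cube \<rho> \<Longrightarrow> geodesic_acceleration \<Gamma> q e w z = w z"
    "\<And>h. of_class r (open_cube \<rho>) (\<lambda>z. w z $ h)"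
    "r = C_omega \<Longrightarrow> \<exists>R. \<forall>h. analytic_norm_le \<rho> R (\<lambda>z. w z $ h)"
proof (cases "r = C_omega")
  case True
  then have \<Gamma>': "real_analytic_on V (\<Gamma> h i j)" for h i j using \<Gamma>[of h i j] by simp
  obtain \<rho> w R where w: "\<rho> > 0"
    "\<And>z. z \<in> open_cube \<rho> \<Longrightarrow> q + geodesic_displacement e w z \<in> V"
    "\<And>z. z \<in> open_cube \<rho> \<Longrightarrow> geodesic_acceleration \<Gamma> q e w z = w z"
    "\<And>h. analytic_norm_le \<rho> R (\<lambda>z. w z $ h)"
    by (rule analytic_geodesic_acceleration[where \<Gamma> = \<Gamma> and e = e, OF V \<Gamma>']) blast+
  show ?thesis
    by (rule that[OF w(1-3)]) (use w(4) True analytic_norm_le_imp_real_analytic_on[OF w(4)] in auto)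
next
  case False
  have \<Gamma>': "Ck_on (Suc 0) V (\<Gamma> h i j)" for h i j
    by (rule Ck_on_mono[OF V(1) of_class_imp_Ck_on_2[OF r V(1) \<Gamma>]]) simp
  obtain \<rho> w where w: "\<rho> > 0"
    "\<And>z. z \<in> open_cube \<rho> \<Longrightarrow> q + geodesic_displacement e w z \<in> V"
    "\<And>z. z \<in> open_cube \<rho> \<Longrightarrow> geodesic_acceleration \<Gamma> q e w z = w z"
    "\<And>k h. (\<And>h i j. Ck_on k V (\<Gamma> h i j)) \<Longrightarrow> Ck_on k (open_cube \<rho>) (\<lambda>z. w z $ h)"
    by (rule smooth_geodesic_acceleration[where \<Gamma> = \<Gamma> and e = e, OF V \<Gamma>']) blast+
  have "of_class r (open_cube \<rho>) (\<lambda>z. w z $ h)" for h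
    using \<Gamma> False w(4) by (cases r) auto
  with False show ?thesis
    by (intro that[OF w(1-3)]) auto
qed

lemma geodesic_displacement_of_class:
  fixes w :: "real^'n::finite \<Rightarrow> real^'n"
  assumes w: "\<And>h. of_class r (open_cube \<rho>) (\<lambda>z. w z $ h)"
    and an: "r = C_omega \<Longrightarrow> \<exists>R. \<forall>h. analytic_norm_le \<rho> R (\<lambda>z. w z $ h)"
  shows "of_class r (open_cube \<rho>) (\<lambda>z. geodesic_displacement e w z $ a)"
proof (cases "r = C_omega")
  case True
  then obtain R where R: "\<And>h. analytic_norm_le \<rho> R (\<lambda>z. w z $ h)" using an by blast
  have "analytic_norm_le \<rho> (\<rho> + \<rho> * (\<rho> * R)) (\<lambda>z. z $ a + axis_integral e (axis_integral e (\<lambda>y. w y $ a)) z)"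
    by (intro analytic_norm_le_add analytic_norm_le_nth analytic_norm_le_axis_integral R analytic_norm_le_pos[OF R])
  from analytic_norm_le_imp_real_analytic_on[OF this] show ?thesis
    using True by (simp add: geodesic_displacement_def)
next
  case False
  have "Ck_on k (open_cube \<rho>) (\<lambda>z. geodesic_displacement e w z $ a)"
    if "Ck_on k (open_cube \<rho>) (\<lambda>z. w z $ a)" for k
    unfolding geodesic_displacement_def vec_lambda_beta
    by (intro Ck_on_add[OF open_open_cube] Ck_on_nth Ck_on_axis_integral that)
  then show ?thesis using w[of a] False by (cases r) auto
qed

text \<open>In the direction \<open>e\<close> each derivative removes one integral. At the origin the integrals vanish
  in all directions, which makes the Jacobian matrix there the identity.\<close>

lemma geodesic_displacement_partials:
  fixes w :: "real^'n::finite \<Rightarrow> real^'n"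
  assumes w: "\<And>h. Ck_on (Suc 0) (open_cube \<rho>) (\<lambda>z. w z $ h)" and z: "z \<in> open_cube \<rho>"
  shows "partial e (\<lambda>z. geodesic_displacement e w z $ a) z = geodesic_velocity e w z $ a"
    and "partial e (partial e (\<lambda>z. geodesic_displacement e w z $ a)) z = w z $ a"
    and "z = 0 \<Longrightarrow> partial c (\<lambda>z. geodesic_displacement e w z $ a) z = (if c = a then 1 else 0)"
proof -
  let ?S = "open_cube \<rho> :: (real^'n) set" and ?I = "axis_integral e" and ?w = "\<lambda>z. w z $ a"
  have I: "Ck_on (Suc 0) ?S (?I ?w)" and II: "Ck_on (Suc 0) ?S (?I (?I ?w))"
    by (intro Ck_on_axis_integral w)+
  have d: "(\<lambda>z::real^'n. z $ a) differentiable (at x)" for x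
    using has_derivative_nth by (auto simp: differentiable_def)
  have p: "partial c (\<lambda>z. geodesic_displacement e w z $ a) x =
      (if c = a then 1 else 0) + (if c = e then ?I ?w x else ?I (partial c (?I ?w)) x)" if "x \<in> ?S" for c x
  proof -
    have "partial c (\<lambda>z. geodesic_displacement e w z $ a) x = partial c (\<lambda>z. z $ a + ?I (?I ?w) z) x"
      by (simp add: geodesic_displacement_def)
    also have "\<dots> = (if c = a then 1 else 0) + partial c (?I (?I ?w)) x"
      using partial_add[OF d, of "?I (?I ?w)" x c] II that by (simp add: partial_nth)
    finally show ?thesis using axis_integral_derivatives(2)[OF I that] by simp
  qed
  have v: "partial e (\<lambda>z. geodesic_displacement e w z $ a) x = geodesic_velocity e w x $ a" if "x \<in> ?S" for x
    using p[OF that, of e] by (simp add: geodesic_velocity_def)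
  show "partial e (\<lambda>z. geodesic_displacement e w z $ a) z = geodesic_velocity e w z $ a"
    by (rule v[OF z])
  have "partial e (partial e (\<lambda>z. geodesic_displacement e w z $ a)) z =
      partial e (\<lambda>x. (if a = e then 1 else 0) + ?I ?w x) z"
    by (rule partial_cong[OF open_open_cube z]) (simp add: v geodesic_velocity_def)
  also have "\<dots> = partial e (?I ?w) z"
    using I z by (subst partial_add) auto
  also have "\<dots> = w z $ a"
    using axis_integral_derivatives(2)[OF w z] by simp
  finally show "partial e (partial e (\<lambda>z. geodesic_displacement e w z $ a)) z = w z $ a" .
  show "partial c (\<lambda>z. geodesic_displacement e w z $ a) z = (if c = a then 1 else 0)" if "z = 0"
    using p[OF z, of c] that by (simp add: axis_integral_at_0)
qed

lemma C1_local_inverse: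
  fixes g :: "real^'n::finite \<Rightarrow> real^'n"
  assumes S: "open S" "y0 \<in> S" and g: "\<And>a. Ck_on (Suc 0) S (\<lambda>y. g y $ a)"
    and g0: "\<And>c a. partial c (\<lambda>y. g y $ a) y0 = (if c = a then 1 else 0)"
  obtains W Y f where "open W" "open Y" "Y \<subseteq> S" "y0 \<in> Y" "homeomorphism Y W g f"
    "\<And>i x. x \<in> W \<Longrightarrow> (\<lambda>x. f x $ i) differentiable (at x)"
proof -
  define E where "E i a = Blinfun (\<lambda>h :: real^'n. h $ i *\<^sub>R (axis a 1 :: real^'n))" for i a
  have E: "blinfun_apply (E i a) h = h $ i *\<^sub>R axis a 1" for i a h
    unfolding E_def
    by (subst bounded_linear_Blinfun_apply)
       (auto intro!: bounded_linear_scaleR_left bounded_linear_compose[OF bounded_linear_scaleR_left bounded_linear_vec_nth])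
  \<comment> \<open>the Jacobian matrix of \<open>g\<close> as a bounded linear map\<close>
  define D where "D y = (\<Sum>a\<in>UNIV. \<Sum>i\<in>UNIV. partial i (\<lambda>y. g y $ a) y *\<^sub>R E i a)" for y
  have D_nth: "blinfun_apply (D y) h $ b = (\<Sum>i\<in>UNIV. partial i (\<lambda>y. g y $ b) y * h $ i)" for y h b
  proof -
    have "blinfun_apply (D y) h $ b =
        (\<Sum>a\<in>UNIV. \<Sum>i\<in>UNIV. partial i (\<lambda>y. g y $ a) y * (h $ i * axis a 1 $ b))"
      by (simp add: D_def blinfun.sum_left blinfun.scaleR_left E mult.assoc)
    also have "\<dots> = (\<Sum>a\<in>UNIV. if a = b then (\<Sum>i\<in>UNIV. partial i (\<lambda>y. g y $ a) y * h $ i) else 0)"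
      by (intro sum.cong refl) (auto simp: axis_def)
    finally show ?thesis by simp
  qed
  have D_deriv: "(g has_derivative blinfun_apply (D y)) (at y)" if "y \<in> S" for y
  proof -
    have "blinfun_apply (D y) = (\<lambda>h. \<chi> a. \<Sum>i\<in>UNIV. partial i (\<lambda>y. g y $ a) y * h $ i)"
      by (simp add: fun_eq_iff vec_eq_iff D_nth)
    then show ?thesis
      using has_derivative_vec_components[of g y] g that by simp
  qed
  have D_cont: "continuous_on S D"
    unfolding D_def using g by (intro continuous_intros) simp
  have D0: "id_blinfun o\<^sub>L D y0 = id_blinfun"
  proof (rule blinfun_eqI)
    fix h show "blinfun_apply (id_blinfun o\<^sub>L D y0) h = blinfun_apply id_blinfun h"
      by (simp add: vec_eq_iff D_nth g0 if_distrib[of "\<lambda>c. c * _"] cong: if_cong)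
  qed
  obtain U' V' f f' where IFT: "open U'" "U' \<subseteq> S" "y0 \<in> U'" "open V'" "g y0 \<in> V'" "homeomorphism U' V' g f"
    "\<And>x. x \<in> V' \<Longrightarrow> (f has_derivative (f' x)) (at x)"
    by (rule inverse_function_theorem[OF S(1) D_deriv D_cont S(2) D0]) blast+
  have "(\<lambda>x. f x $ i) differentiable (at x)" if "x \<in> V'" for i x
    using bounded_linear.has_derivative[OF bounded_linear_vec_nth IFT(7)[OF that], of i]
    by (auto simp: differentiable_def)
  then show ?thesis
    using that IFT(1-6) by blast
qed

text \<open>The map \<open>g(y) = q + y + IIw\<close> and its local inverse. In the analytic case the domain is shrunk to
  a neighbourhood of \<open>q\<close> on which \<open>f\<close> coincides with the power series that solves
  \<open>u(z) + (IIw)(u(z)) = z\<close>.\<close>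

theorem geodesic_coordinates_exist:
  fixes \<Gamma> :: "'n::finite components" and e :: 'n
  assumes r: "class_at_least_2 r" and V: "open V" "q \<in> V" and \<Gamma>: "\<And>h i j. of_class r V (\<Gamma> h i j)"
  obtains W Y f g where "open W" "q \<in> W" "W \<subseteq> V" "open Y" "homeomorphism W Y f g"
    "\<And>a. of_class r W (\<lambda>x. f x $ a)" "\<And>a. of_class r Y (\<lambda>y. g y $ a)"
    "\<And>y \<gamma>. y \<in> Y \<Longrightarrow> (\<Sum>i\<in>UNIV. \<Sum>j\<in>UNIV.
        \<Gamma> \<gamma> i j (g y) * partial e (\<lambda>z. g z $ i) y * partial e (\<lambda>z. g z $ j) y) +
        partial e (partial e (\<lambda>z. g z $ \<gamma>)) y = 0"
proof -
  obtain \<rho> w where \<rho>: "\<rho> > 0"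
    and inV: "\<And>z. z \<in> open_cube \<rho> \<Longrightarrow> q + geodesic_displacement e w z \<in> V"
    and fixed: "\<And>z. z \<in> open_cube \<rho> \<Longrightarrow> geodesic_acceleration \<Gamma> q e w z = w z"
    and w: "\<And>h. of_class r (open_cube \<rho>) (\<lambda>z. w z $ h)"
    and w_an: "r = C_omega \<Longrightarrow> \<exists>R. \<forall>h. analytic_norm_le \<rho> R (\<lambda>z. w z $ h)"
    by (rule geodesic_acceleration_of_class[where \<Gamma> = \<Gamma> and e = e, OF r V \<Gamma>]) blast+
  let ?S = "open_cube \<rho> :: (real^'n) set"
  define g where "g y = q + geodesic_displacement e w y" for y
  have g_nth: "(\<lambda>y. g y $ a) = (\<lambda>y. q $ a + geodesic_displacement e w y $ a)" for a
    by (simp add: g_def)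
  have w1: "Ck_on (Suc 0) ?S (\<lambda>z. w z $ h)" for h
    by (rule Ck_on_mono[OF open_open_cube of_class_imp_Ck_on_2[OF r open_open_cube w]]) simp
  have g_class: "of_class r ?S (\<lambda>y. g y $ a)" for a
    unfolding g_nth
    by (rule of_class_add[OF open_open_cube of_class_const geodesic_displacement_of_class[OF w w_an]])
  have gp: "partial c (\<lambda>y. g y $ a) = partial c (\<lambda>y. geodesic_displacement e w y $ a)" for c a
    unfolding g_nth by (simp add: fun_eq_iff partial_const_add)
  have ode: "(\<Sum>i\<in>UNIV. \<Sum>j\<in>UNIV.
        \<Gamma> \<gamma> i j (g y) * partial e (\<lambda>z. g z $ i) y * partial e (\<lambda>z. g z $ j) y) +
        partial e (partial e (\<lambda>z. g z $ \<gamma>)) y = 0" if "y \<in> ?S" for y \<gamma>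
    using arg_cong[OF fixed[OF that], of "\<lambda>v. v $ \<gamma>"]
    unfolding gp geodesic_displacement_partials[OF w1 that]
    by (simp add: geodesic_acceleration_def g_def)
  have zero: "0 \<in> ?S" using \<rho> by (simp add: open_cube_def)
  have g0: "g 0 = q"
    by (simp add: g_def geodesic_displacement_def axis_integral_at_0 vec_eq_iff)
  have g1: "Ck_on (Suc 0) ?S (\<lambda>y. g y $ a)" for a
    by (rule Ck_on_mono[OF open_open_cube of_class_imp_Ck_on_2[OF r open_open_cube g_class]]) simp
  obtain W Y f where W: "open W" and Y: "open Y" "Y \<subseteq> ?S" "0 \<in> Y" and hom: "homeomorphism Y W g f"
    and f_diff: "\<And>i x. x \<in> W \<Longrightarrow> (\<lambda>x. f x $ i) differentiable (at x)"
    by (rule C1_local_inverse[OF open_open_cube zero g1])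
       (use geodesic_displacement_partials(3)[OF w1 zero refl] gp in auto)
  have fY: "f x \<in> Y" and gf: "g (f x) = x" if "x \<in> W" for x
    using hom that by (auto simp: homeomorphism_def)
  have gW: "g y \<in> W" and fg: "f (g y) = y" if "y \<in> Y" for y
    using hom that by (auto simp: homeomorphism_def)
  have qW: "q \<in> W" using gW[OF Y(3)] g0 by simp
  have WV: "W \<subseteq> V" using inV fY gf Y(2) by (metis g_def subset_eq)
  have "\<exists>W'. open W' \<and> q \<in> W' \<and> W' \<subseteq> W \<and> (\<forall>a. of_class r W' (\<lambda>x. f x $ a))"
  proof (cases "r = C_omega")
    case False
    have "Ck_on (Suc k) W (\<lambda>x. f x $ a)" if "\<And>a. Ck_on (Suc k) ?S (\<lambda>y. g y $ a)" for k a
      by (rule Ck_on_inverse_function[OF W Y(1) fY gf f_diff Ck_on_subset[OF that Y(2)]])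
    then have Ck: "Ck_on (Suc k) W (\<lambda>x. f x $ a)" if "\<And>a. Ck_on (Suc k) ?S (\<lambda>y. g y $ a)" for k a
      using that by blast
    have "of_class r W (\<lambda>x. f x $ a)" for a
    proof (cases r)
      case (C_fin k)
      then obtain j where j: "k = Suc j" using r not0_implies_Suc by (metis class_at_least_2.simps(1) not_numeral_le_zero)
      show ?thesis using Ck[of j a] g_class by (simp add: C_fin j)
    next
      case C_infty
      have "Ck_on (Suc k) ?S (\<lambda>y. g y $ a)" for k a
        using g_class[of a] C_infty by (simp del: Ck_on.simps)
      from Ck_on_mono[OF W Ck[OF this]] show ?thesis
        using C_infty by (metis le_Suc_eq of_class.simps(2) order_refl)
    qed (use False in simp)
    then show ?thesis using W qW by blast
  next
    case True
    then obtain R where R: "\<And>h. analytic_norm_le \<rho> R (\<lambda>z. w z $ h)" using w_an by blast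
    define h where "h z = (\<chi> a. axis_integral e (axis_integral e (\<lambda>y. w y $ a)) z)" for z
    have g_h: "g z = q + (z + h z)" for z
      by (simp add: g_def geodesic_displacement_def h_def vec_eq_iff)
    have h_an: "analytic_norm_le \<tau> (\<tau>\<^sup>2 * R) (\<lambda>z. h z $ a)" if "0 < \<tau>" "\<tau> \<le> \<rho>" for \<tau> a
      using analytic_norm_le_axis_integral[OF analytic_norm_le_axis_integral[OF analytic_norm_le_radius[OF R that]]]
      by (simp add: h_def power2_eq_square mult.assoc)
    have "h 0 = 0" by (simp add: h_def axis_integral_at_0 vec_eq_iff)
    then obtain \<sigma> u N where \<sigma>: "\<sigma> > 0" "u 0 = 0" and u: "\<And>a. analytic_norm_le \<sigma> N (\<lambda>z. u z $ a)"
      and u_eq: "\<And>z. z \<in> cube \<sigma> \<Longrightarrow> u z + h (u z) = z"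
      by (rule analytic_local_inverse[where h = h, OF \<rho> analytic_norm_le_nonneg[OF R] _ h_an]) blast+
    have "continuous_on (cube \<sigma>) (\<lambda>z. \<chi> a. u z $ a)"
      by (intro continuous_on_vec_lambda analytic_norm_le_continuous_on[OF u])
    then have "continuous_on (cube \<sigma>) u" by simp
    then have "continuous_on (open_cube \<sigma>) u"
      by (rule continuous_on_subset[OF _ open_cube_subset_cube])
    then have O: "open (open_cube \<sigma> \<inter> u -` Y)"
      by (rule continuous_open_preimage[OF _ open_open_cube Y(1)])
    define W' where "W' = (+) q ` (open_cube \<sigma> \<inter> u -` Y)"
    have "open W'" unfolding W'_def by (rule open_translation[OF O])
    moreover have "q \<in> W'"
      unfolding W'_def using \<sigma> Y(3) by (intro image_eqI[of _ _ 0]) (auto simp: open_cube_def)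
    moreover have W'_D: "x - q \<in> open_cube \<sigma> \<and> x \<in> W \<and> f x = u (x - q)" if xW': "x \<in> W'" for x
    proof -
      obtain z where z: "z \<in> open_cube \<sigma>" "u z \<in> Y" "x = q + z" using xW' by (auto simp: W'_def)
      have "g (u z) = x"
        using u_eq[of z] z open_cube_subset_cube by (auto simp: g_h)
      then show ?thesis using gW[OF z(2)] fg[OF z(2)] z by simp
    qed
    moreover have "of_class r W' (\<lambda>x. f x $ a)" for a
    proof -
      have "real_analytic_on W' (\<lambda>x. (x - q) $ i)" for i
        using real_analytic_on_add[OF real_analytic_on_nth real_analytic_on_const[of _ "- q $ i"]] by simp
      then have "real_analytic_on W' (\<lambda>x. u (x - q) $ a)"
        by (rule real_analytic_on_compose[OF analytic_norm_le_imp_real_analytic_on[OF u]]) (use W'_D in blast)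
      then have "real_analytic_on W' (\<lambda>x. f x $ a)"
        by (rule real_analytic_on_cong[OF \<open>open W'\<close>, rotated]) (use W'_D in simp)
      then show ?thesis using True by simp
    qed
    ultimately show ?thesis by blast
  qed
  then obtain W' where W': "open W'" "q \<in> W'" "W' \<subseteq> W" "\<And>a. of_class r W' (\<lambda>x. f x $ a)" by blast
  define Y' where "Y' = Y \<inter> g -` W'"
  have "continuous_on Y g" using hom by (simp add: homeomorphism_def)
  then have "open Y'" unfolding Y'_def by (rule continuous_open_preimage[OF _ Y(1) W'(1)])
  have "f ` W' = Y'"
    using fY gf fg W'(3) by (force simp: Y'_def)
  then have hom': "homeomorphism W' Y' f g"
    using homeomorphism_of_subsets[OF homeomorphism_symD[OF hom] W'(3), of Y' Y'] by (auto simp: Y'_def)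
  have "Y' \<subseteq> ?S" using Y(2) by (auto simp: Y'_def)
  have ode': "(\<Sum>i\<in>UNIV. \<Sum>j\<in>UNIV.
        \<Gamma> \<gamma> i j (g y) * partial e (\<lambda>z. g z $ i) y * partial e (\<lambda>z. g z $ j) y) +
        partial e (partial e (\<lambda>z. g z $ \<gamma>)) y = 0" if "y \<in> Y'" for y \<gamma>
    using ode \<open>Y' \<subseteq> ?S\<close> that by blast
  show ?thesis
    by (rule that[OF W'(1,2) order_trans[OF W'(3) WV] \<open>open Y'\<close> hom' W'(4) of_class_subset[OF g_class \<open>Y' \<subseteq> ?S\<close>] ode'])
qed

section \<open>Coordinate transformations and the transformation law\<close>

lemma jacobian_compose:
  fixes f :: "real^'a::finite \<Rightarrow> real^'b::finite" and g :: "real^'b \<Rightarrow> real^'c::finite"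
  assumes "f differentiable (at x)" "g differentiable (at (f x))"
  shows "jacobian (g \<circ> f) (at x) = jacobian g (at (f x)) ** jacobian f (at x)"
  unfolding jacobian_def frechet_derivative_compose[OF assms]
  by (intro matrix_compose has_derivative_linear[OF frechet_derivative_works[THEN iffD1]] assms)

lemma jacobian_cong:
  assumes "open S" "x \<in> S" "\<And>z. z \<in> S \<Longrightarrow> f z = g z"
  shows "jacobian f (at x) = jacobian g (at x)"
proof -
  have "(f has_derivative D) (at x) \<longleftrightarrow> (g has_derivative D) (at x)" for D
    using has_derivative_transform_within_open[of f D x UNIV S g]
      has_derivative_transform_within_open[of g D x UNIV S f] assms by fastforce
  then show ?thesis
    by (simp add: jacobian_def frechet_derivative_def)
qed

lemma coord_transformation_cong:
  assumes "open S" "\<And>z. z \<in> S \<Longrightarrow> f z = g z" "coord_transformation r S f"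
  shows "coord_transformation r S g"
proof -
  have "of_class r S (\<lambda>x. g x $ h)" for h
    using of_class_cong[OF assms(1), of "\<lambda>x. f x $ h" "\<lambda>x. g x $ h" r] assms(2,3)
    by (simp add: coord_transformation_def)
  moreover have "inj_on g S"
    using assms(2,3) by (simp add: coord_transformation_def cong: inj_on_cong)
  moreover have "det (jacobian g (at x)) \<noteq> 0" if "x \<in> S" for x
  proof -
    have "det (jacobian f (at x)) \<noteq> 0" using assms(3) that by (simp add: coord_transformation_def)
    then show ?thesis using jacobian_cong[where f = f and g = g, OF assms(1) that assms(2)] by simp
  qed
  ultimately show ?thesis by (simp add: coord_transformation_def)
qed

lemma coord_transformation_subset:
  "coord_transformation r S f \<Longrightarrow> T \<subseteq> S \<Longrightarrow> coord_transformation r T f"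
  unfolding coord_transformation_def by (auto intro: of_class_subset inj_on_subset)

lemma coord_transformation_2_differentiable:
  assumes "coord_transformation (C_fin 2) S f" "x \<in> S"
  shows "f differentiable (at x)"
  by (rule differentiable_components)
     (use assms in \<open>simp add: coord_transformation_def numeral_2_eq_2\<close>)

lemma coord_transformation_2_compose:
  assumes "open S" "open T" "coord_transformation (C_fin 2) S f" "coord_transformation (C_fin 2) T g" "f ` S \<subseteq> T"
  shows "coord_transformation (C_fin 2) S (g \<circ> f)"
proof -
  have "of_class (C_fin 2) S (\<lambda>x. (g \<circ> f) x $ h)" for h
    unfolding o_def
    by (rule of_class_compose[OF assms(1,2), where F = "\<lambda>y. g y $ h"])
       (use assms(3,4,5) in \<open>auto simp: coord_transformation_def\<close>)
  moreover have "inj_on (g \<circ> f) S"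
    by (rule comp_inj_on) (use assms(3,4,5) in \<open>auto simp: coord_transformation_def intro: inj_on_subset\<close>)
  moreover have "det (jacobian (g \<circ> f) (at x)) \<noteq> 0" if "x \<in> S" for x
  proof -
    have "f x \<in> T" using assms(5) that by blast
    then show ?thesis
      using jacobian_compose[OF coord_transformation_2_differentiable[OF assms(3) that]
          coord_transformation_2_differentiable[OF assms(4) \<open>f x \<in> T\<close>]] assms(3,4) that
      by (simp add: det_mul coord_transformation_def)
  qed
  ultimately show ?thesis by (simp add: coord_transformation_def)
qed

text \<open>The Jacobian matrices of \<open>f\<close> and \<open>g\<close> are inverse to each other by the chain rule.\<close>

lemma coord_transformation_of_homeomorphism:
  assumes r: "class_at_least_2 r" and W: "open W" and Y: "open Y" and hom: "homeomorphism W Y f g"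
    and f: "\<And>a. of_class r W (\<lambda>x. f x $ a)" and g: "\<And>a. of_class r Y (\<lambda>y. g y $ a)"
  shows "coord_transformation r W f"
proof -
  have diff: "F differentiable (at x)" if "open S" "\<And>a. of_class r S (\<lambda>x. F x $ a)" "x \<in> S" for F S x
    by (rule differentiable_components)
       (use of_class_imp_Ck_on_2[OF r that(1,2)] that(3) in \<open>simp add: numeral_2_eq_2\<close>)
  have gf: "g (f x) = x" "f x \<in> Y" if "x \<in> W" for x
    using hom that by (auto simp: homeomorphism_def)
  have "det (jacobian f (at x)) \<noteq> 0" if x: "x \<in> W" for x
  proof -
    have "jacobian (g \<circ> f) (at x) = jacobian g (at (f x)) ** jacobian f (at x)"
      by (rule jacobian_compose[OF diff[OF W f x] diff[OF Y g gf(2)[OF x]]])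
    moreover have "jacobian (g \<circ> f) (at x) = jacobian (\<lambda>x. x) (at x)"
      by (rule jacobian_cong[OF W x]) (simp add: gf)
    moreover have "jacobian (\<lambda>x. x) (at x) = (mat 1 :: real^'a^'a)"
      by (simp add: jacobian_def frechet_derivative_ident matrix_id_mat_1 flip: id_def)
    ultimately have "det (jacobian g (at (f x))) * det (jacobian f (at x)) = 1"
      by (metis det_I det_mul)
    then show ?thesis by auto
  qed
  moreover have "inj_on f W" using gf by (metis inj_onI)
  ultimately show ?thesis using f by (simp add: coord_transformation_def)
qed

lemma coord_transformation_imp_2:
  "class_at_least_2 r \<Longrightarrow> open S \<Longrightarrow> coord_transformation r S f \<Longrightarrow> coord_transformation (C_fin 2) S f"
  using of_class_imp_Ck_on_2 by (auto simp: coord_transformation_def)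

lemma transform_components_cong:
  assumes "open W" "open Y" "\<And>x. x \<in> W \<Longrightarrow> f x = f' x" "\<And>y. y \<in> Y \<Longrightarrow> g y = g' y" "y \<in> Y" "g y \<in> W"
  shows "transform_components f g \<Gamma> h i j y = transform_components f' g' \<Gamma> h i j y"
proof -
  have 1: "partial k (\<lambda>z. g z $ \<alpha>) z = partial k (\<lambda>z. g' z $ \<alpha>) z" if "z \<in> Y" for k \<alpha> z
    by (rule partial_cong[OF assms(2) that]) (simp add: assms(4))
  have 2: "partial i (partial j (\<lambda>z. g z $ \<gamma>)) y = partial i (partial j (\<lambda>z. g' z $ \<gamma>)) y" for \<gamma>
    by (rule partial_cong[OF assms(2,5) 1])
  have 3: "partial \<gamma> (\<lambda>z. f z $ h) (g y) = partial \<gamma> (\<lambda>z. f' z $ h) (g y)" for \<gamma>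
    by (rule partial_cong[OF assms(1,6)]) (simp add: assms(3))
  show ?thesis
    unfolding transform_components_def 2 3 1[OF assms(5)] assms(4)[OF assms(5), symmetric] ..
qed

text \<open>The second derivatives of \<open>g\<close> are the only terms that lose two orders; the
  others contain at most first derivatives.\<close>

lemma transform_components_of_class:
  assumes r: "class_at_least_2 r" and W: "open W" and Y: "open Y"
    and f: "\<And>a. of_class r W (\<lambda>x. f x $ a)" and g: "\<And>a. of_class r Y (\<lambda>y. g y $ a)"
    and \<Gamma>: "\<And>h i j. of_class r W (\<Gamma> h i j)" and gW: "\<And>y. y \<in> Y \<Longrightarrow> g y \<in> W"
  shows "of_class (class_minus_2 r) Y (transform_components f g \<Gamma> h i j)"
  unfolding transform_components_def[abs_def]
  by (intro of_class_sum[OF Y] of_class_mult[OF Y] of_class_add[OF Y]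
      of_class_minus_2(2,3)[OF r Y g] of_class_compose[OF Y W of_class_minus_2(1)[OF r W \<Gamma>] of_class_minus_2(1)[OF r Y g] gW]
      of_class_compose[OF Y W of_class_minus_2(2)[OF r W f] of_class_minus_2(1)[OF r Y g] gW])

text \<open>Along an \<open>e\<close>-line the velocity is constant, so the geodesic equation reduces to \<open>\<Gamma>\<^sup>h\<^sub>e\<^sub>e = 0\<close>.\<close>

lemma pre_semigeodesicI:
  fixes e :: "'n::finite"
  assumes "\<And>h y. y \<in> V \<Longrightarrow> \<Gamma> h e e y = 0"
  shows "pre_semigeodesic e V \<Gamma>"
  unfolding pre_semigeodesic_def Let_def geodesic_def
proof (intro allI exI ballI conjI)
  fix a :: "real^'n" and \<tau> :: real and h
  let ?l = "\<lambda>\<tau>. \<chi> i. if i = e then \<tau> else a $ i"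
  have l: "?l = (\<lambda>\<tau>. ?l 0 + \<tau> *\<^sub>R axis e 1)"
    by (auto simp: fun_eq_iff vec_eq_iff axis_def)
  show "(?l has_vector_derivative axis e 1) (at \<tau>)"
    by (subst l) (auto intro!: derivative_eq_intros simp: has_vector_derivative_def)
  show "((\<lambda>_. axis e 1 :: real^'n) has_vector_derivative 0) (at \<tau>)"
    by (auto intro!: derivative_eq_intros)
  assume "\<tau> \<in> {\<tau>. ?l \<tau> \<in> V}"
  then have "\<Gamma> h i j (?l \<tau>) * (axis e 1 :: real^'n) $ i * (axis e 1 :: real^'n) $ j = 0" for i j
    using assms by (cases "i = e"; cases "j = e") (auto simp: axis_def)
  then show "(0::real^'n) $ h + (\<Sum>i\<in>UNIV. \<Sum>j\<in>UNIV. \<Gamma> h i j (?l \<tau>) * (axis e 1 :: real^'n) $ i * (axis e 1 :: real^'n) $ j) = 0"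
    by (simp only: sum.neutral_const zero_index)
qed

section \<open>Charts\<close>

lemma homeomorphic_map_of_homeomorphism:
  "homeomorphism S T f g \<Longrightarrow> homeomorphic_map (top_of_set S) (top_of_set T) f"
  by (rule homeomorphic_maps_imp_map[of _ _ _ g])
     (auto simp: homeomorphic_maps_def homeomorphism_def continuous_map_in_subtopology)

text \<open>The class \<open>C\<^sup>k\<close> is meaningful on open sets; this provides them for overlaps of charts.\<close>

lemma chart_image_open:
  assumes "is_chart M (U, x)" "openin M S" "S \<subseteq> U"
  shows "open (x ` S)"
proof -
  have "openin (subtopology M U) S"
    using assms(2,3) by (simp add: openin_subtopology_Int2 openin_subset_topspace_eq openin_subtopology) blast
  moreover have "open_map (subtopology M U) (top_of_set (x ` U)) x"
    using assms(1) homeomorphic_imp_open_map by (auto simp: is_chart_def)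
  ultimately have "openin (top_of_set (x ` U)) (x ` S)"
    unfolding open_map_def by blast
  then show ?thesis
    using assms(1) openin_open_eq by (auto simp: is_chart_def)
qed

lemma chart_inj: "is_chart M (U, x) \<Longrightarrow> inj_on x U"
proof -
  assume c: "is_chart M (U, x)"
  then have "U \<subseteq> topspace M" by (auto simp: is_chart_def openin_subset)
  then show "inj_on x U"
    using c homeomorphic_imp_injective_map[of "subtopology M U" _ x]
    by (auto simp: is_chart_def Int_absorb1)
qed

lemma transition_apply: "inj_on x U \<Longrightarrow> m \<in> U \<Longrightarrow> transition (U, x) c' (x m) = snd c' m"
  by (simp add: transition_def)

lemma recoordinatized_chart:
  assumes c: "is_chart M (U, x)" and W: "open W" "W \<subseteq> x ` U" and Y: "open Y" and hom: "homeomorphism W Y f g"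
  defines "U' \<equiv> {m \<in> U. x m \<in> W}"
  shows "is_chart M (U', f \<circ> x)" "x ` U' = W" "(f \<circ> x) ` U' = Y"
proof -
  have UM: "openin M U" and x: "homeomorphic_map (subtopology M U) (top_of_set (x ` U)) x"
    using c by (auto simp: is_chart_def)
  have top: "topspace (subtopology M U) = U"
    using openin_subset[OF UM] by (simp add: Int_absorb1)
  show xU': "x ` U' = W" using W(2) unfolding U'_def by blast
  have "(f \<circ> x) ` U' = f ` W" unfolding xU'[symmetric] by (rule image_comp[symmetric])
  also have "f ` W = Y" using hom by (simp add: homeomorphism_def)
  finally show fY: "(f \<circ> x) ` U' = Y" .
  have "openin (top_of_set (x ` U)) W" using W by (simp add: open_subset)
  from openin_continuous_map_preimage[OF homeomorphic_imp_continuous_map[OF x] this]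
  have "openin (subtopology M U) U'" unfolding top U'_def .
  then have U': "openin M U'" using UM by (rule openin_trans_full)
  have UU': "U \<inter> U' = U'" unfolding U'_def by blast
  have "homeomorphic_map (subtopology (subtopology M U) U') (subtopology (top_of_set (x ` U)) W) x"
  proof (rule homeomorphic_map_subtopologies[OF x])
    show "x ` (topspace (subtopology M U) \<inter> U') = topspace (top_of_set (x ` U)) \<inter> W"
      unfolding top UU' xU' using W(2) by auto
  qed
  moreover have "subtopology (subtopology M U) U' = subtopology M U'"
    by (simp add: subtopology_subtopology UU')
  moreover have "subtopology (top_of_set (x ` U)) W = top_of_set W"
    using W(2) by (simp add: subtopology_subtopology Int_absorb1)
  ultimately have "homeomorphic_map (subtopology M U') (top_of_set W) x" by simp
  then have "homeomorphic_map (subtopology M U') (top_of_set Y) (f \<circ> x)"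
    by (rule homeomorphic_map_compose[OF _ homeomorphic_map_of_homeomorphism[OF hom]])
  then show "is_chart M (U', f \<circ> x)"
    unfolding is_chart_def case_prod_conv fY using U' Y by blast
qed

text \<open>On the overlap the transition maps of the new chart are those of the old one composed with \<open>g\<close>
  on one side and \<open>f\<close> on the other.\<close>

lemma recoordinatized_compatible:
  assumes c: "is_chart M (U, x)" and c2: "is_chart M (U2, x2)" and comp: "compatible (U, x) (U2, x2)"
    and W: "open W" "W \<subseteq> x ` U" and Y: "open Y" and hom: "homeomorphism W Y f g"
    and f: "coord_transformation (C_fin 2) W f" and g: "coord_transformation (C_fin 2) Y g"
  defines "U' \<equiv> {m \<in> U. x m \<in> W}"
  shows "compatible (U', f \<circ> x) (U2, x2)"
proof -
  note c' = recoordinatized_chart[OF c W Y hom, folded U'_def]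
  have U': "U' \<subseteq> U" by (auto simp: U'_def)
  have gf: "g (f w) = w" if "w \<in> W" for w using hom that by (simp add: homeomorphism_def)
  have xW: "x m \<in> W" if "m \<in> U'" for m using that by (simp add: U'_def)
  note inj = chart_inj[OF c] and inj2 = chart_inj[OF c2] and inj' = chart_inj[OF c'(1)]
  define S where "S = U' \<inter> U2"
  have S: "openin M S"
    unfolding S_def using c'(1) c2 by (auto simp: is_chart_def)
  have SU: "S \<subseteq> U" "S \<subseteq> U'" "S \<subseteq> U2" "S \<subseteq> U \<inter> U2" using U' by (auto simp: S_def)
  have o: "open (x ` S)" "open (x2 ` S)" "open ((f \<circ> x) ` S)"
    using chart_image_open[OF c S] chart_image_open[OF c2 S] chart_image_open[OF c'(1) S] SU by auto
  have T: "coord_transformation (C_fin 2) (x ` S) (transition (U, x) (U2, x2))"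
    and T': "coord_transformation (C_fin 2) (x2 ` S) (transition (U2, x2) (U, x))"
    using comp SU(4) unfolding compatible_def fst_conv snd_conv
    by (auto elim!: coord_transformation_subset)
  have "coord_transformation (C_fin 2) ((f \<circ> x) ` S) (transition (U, x) (U2, x2) \<circ> g)"
  proof (rule coord_transformation_2_compose[OF o(3,1) _ T])
    show "coord_transformation (C_fin 2) ((f \<circ> x) ` S) g"
      by (rule coord_transformation_subset[OF g]) (use c'(3) SU(2) in auto)
    show "g ` ((f \<circ> x) ` S) \<subseteq> x ` S"
      using gf xW SU(2) by auto
  qed
  then have "coord_transformation (C_fin 2) ((f \<circ> x) ` S) (transition (U', f \<circ> x) (U2, x2))"
  proof (rule coord_transformation_cong[OF o(3), rotated])
    fix y assume "y \<in> (f \<circ> x) ` S"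
    then obtain m where m: "m \<in> S" "y = (f \<circ> x) m" by blast
    then show "(transition (U, x) (U2, x2) \<circ> g) y = transition (U', f \<circ> x) (U2, x2) y"
      using transition_apply[OF inj, of m] transition_apply[OF inj', of m] gf[of "x m"] xW[of m]
        subsetD[OF SU(1) m(1)] subsetD[OF SU(2) m(1)] by simp
  qed
  moreover have "coord_transformation (C_fin 2) (x2 ` S) (f \<circ> transition (U2, x2) (U, x))"
  proof (rule coord_transformation_2_compose[OF o(2,1) T'])
    show "coord_transformation (C_fin 2) (x ` S) f"
      by (rule coord_transformation_subset[OF f]) (use xW SU(2) in blast)
    show "transition (U2, x2) (U, x) ` x2 ` S \<subseteq> x ` S"
    proof (clarsimp)
      fix m assume "m \<in> S"
      then have "m \<in> U2" using SU(3) by blast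
      then show "transition (U2, x2) (U, x) (x2 m) \<in> x ` S"
        using transition_apply[OF inj2, of m] \<open>m \<in> S\<close> by simp
    qed
  qed
  then have "coord_transformation (C_fin 2) (x2 ` S) (transition (U2, x2) (U', f \<circ> x))"
  proof (rule coord_transformation_cong[OF o(2), rotated])
    fix y assume "y \<in> x2 ` S"
    then obtain m where m: "m \<in> S" "y = x2 m" by blast
    then show "(f \<circ> transition (U2, x2) (U, x)) y = transition (U2, x2) (U', f \<circ> x) y"
      using transition_apply[OF inj2, of m] subsetD[OF SU(3) m(1)] by simp
  qed
  ultimately show ?thesis
    by (simp add: compatible_def S_def)
qed

theorem theorem3:
  fixes M :: "'m topology"
    and \<A> :: "('m, 'n::finite) chart set"
    and conn :: "('m, 'n) chart \<Rightarrow> 'n components"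
    and U :: "'m set" and x :: "'m \<Rightarrow> real^'n" and p :: 'm
    and r :: diff_class and e1 :: 'n
  assumes "CARD('n) \<ge> 2"
    and "class_at_least_2 r"
    and "manifold M \<A>"
    and "affine_connection \<A> conn"
    and "(U, x) \<in> \<A>"
    and "\<And>h i j. of_class r (x ` U) (conn (U, x) h i j)"
    and "p \<in> U"
  shows "\<exists>U' f. openin M U' \<and> p \<in> U' \<and> U' \<subseteq> U \<and>
           coord_transformation r (x ` U') f \<and>
           (U', f \<circ> x) \<in> \<A> \<and>
           (\<forall>h. \<forall>y\<in>(f \<circ> x) ` U'. conn (U', f \<circ> x) h e1 e1 y = 0) \<and>
           pre_semigeodesic e1 ((f \<circ> x) ` U') (conn (U', f \<circ> x)) \<and>
           (\<forall>h i j. of_class (class_minus_2 r) ((f \<circ> x) ` U') (conn (U', f \<circ> x) h i j))"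
proof -
  note r = assms(2) and conn = assms(4) and Ux = assms(5)
  have charts: "\<forall>c\<in>\<A>. is_chart M c" and comp: "\<forall>c\<in>\<A>. \<forall>c'\<in>\<A>. compatible c c'"
    and maximal: "\<forall>c. is_chart M c \<and> (\<forall>c'\<in>\<A>. compatible c c') \<longrightarrow> c \<in> \<A>"
    using assms(3) unfolding manifold_def by fast+
  have c: "is_chart M (U, x)" using charts Ux by blast
  then have V: "open (x ` U)" by (simp add: is_chart_def)
  have "x p \<in> x ` U" using assms(7) by blast
  then obtain W Y f g where W: "open W" "x p \<in> W" "W \<subseteq> x ` U" and Y: "open Y" and hom: "homeomorphism W Y f g"
    and f: "\<And>a. of_class r W (\<lambda>z. f z $ a)" and g: "\<And>a. of_class r Y (\<lambda>y. g y $ a)"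
    and ode: "\<And>y \<gamma>. y \<in> Y \<Longrightarrow> (\<Sum>i\<in>UNIV. \<Sum>j\<in>UNIV.
        conn (U, x) \<gamma> i j (g y) * partial e1 (\<lambda>z. g z $ i) y * partial e1 (\<lambda>z. g z $ j) y) +
        partial e1 (partial e1 (\<lambda>z. g z $ \<gamma>)) y = 0"
    by (rule geodesic_coordinates_exist[where \<Gamma> = "conn (U, x)" and e = e1, OF r V _ assms(6)]) blast+
  define U' where "U' = {m \<in> U. x m \<in> W}"
  note c' = recoordinatized_chart[OF c W(1,3) Y hom, folded U'_def]
  have U': "U' \<subseteq> U" "p \<in> U'" using W(2) assms(7) by (auto simp: U'_def)
  have gf: "g (f w) = w" if "w \<in> W" for w using hom that by (simp add: homeomorphism_def)
  have gW: "g y \<in> W" if "y \<in> Y" for y using hom that by (auto simp: homeomorphism_def)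
  have ct_f: "coord_transformation r W f"
    by (rule coord_transformation_of_homeomorphism[OF r W(1) Y hom f g])
  have ct_g: "coord_transformation r Y g"
    by (rule coord_transformation_of_homeomorphism[OF r Y W(1) homeomorphism_symD[OF hom] g f])
  have compat: "compatible (U', f \<circ> x) c2" if "c2 \<in> \<A>" for c2
  proof (cases c2)
    case (Pair U2 x2)
    have "is_chart M (U2, x2)" "compatible (U, x) (U2, x2)"
      using charts comp Ux that Pair by blast+
    then show ?thesis
      unfolding Pair U'_def
      by (rule recoordinatized_compatible[OF c _ _ W(1,3) Y hom coord_transformation_imp_2[OF r W(1) ct_f]
            coord_transformation_imp_2[OF r Y ct_g]])
  qed
  then have atlas: "(U', f \<circ> x) \<in> \<A>"
    using maximal c'(1) by blast
  note inj = chart_inj[OF c] and inj' = chart_inj[OF c'(1)]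
  let ?T = "transform_components f g (conn (U, x))"
  have conn': "conn (U', f \<circ> x) h i j y = ?T h i j y" if "y \<in> Y" for h i j y
  proof -
    have "y \<in> (f \<circ> x) ` U'" using \<open>y \<in> Y\<close> c'(3) by simp
    then obtain m where m: "m \<in> U'" "y = (f \<circ> x) m" by (rule imageE) simp
    have f_eq: "transition (U, x) (U', f \<circ> x) w = f w" if "w \<in> W" for w
    proof -
      have "w \<in> x ` U'" using that c'(2) by simp
      then obtain m where m: "m \<in> U'" "w = x m" by (rule imageE) simp
      then show ?thesis using transition_apply[OF inj, of m] subsetD[OF U'(1) m(1)] by simp
    qed
    have g_eq: "transition (U', f \<circ> x) (U, x) z = g z" if "z \<in> Y" for z
    proof -
      have "z \<in> (f \<circ> x) ` U'" using that c'(3) by simp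
      then obtain m where m: "m \<in> U'" "z = (f \<circ> x) m" by (rule imageE) simp
      then have "x m \<in> W" by (simp add: U'_def)
      then show ?thesis using transition_apply[OF inj', of m] gf[of "x m"] m by simp
    qed
    have "conn (U', f \<circ> x) h i j (snd (U', f \<circ> x) m) =
        transform_components (transition (U, x) (U', f \<circ> x)) (transition (U', f \<circ> x) (U, x)) (conn (U, x)) h i j (snd (U', f \<circ> x) m)"
    proof -
      have "m \<in> fst (U, x) \<inter> fst (U', f \<circ> x)" using m(1) U'(1) by auto
      with conn Ux atlas show ?thesis unfolding affine_connection_def by blast
    qed
    also have "snd (U', f \<circ> x) m = y" using m by simp
    also have "transform_components (transition (U, x) (U', f \<circ> x)) (transition (U', f \<circ> x) (U, x)) (conn (U, x)) h i j y = ?T h i j y"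
      by (rule transform_components_cong[OF W(1) Y f_eq g_eq \<open>y \<in> Y\<close>]) (use g_eq gW \<open>y \<in> Y\<close> in auto)
    finally show ?thesis .
  qed
  have zero: "conn (U', f \<circ> x) h e1 e1 y = 0" if "y \<in> Y" for h y
    unfolding conn'[OF that] transform_components_def using ode[OF that] by simp
  have conn_class: "of_class (class_minus_2 r) Y (conn (U', f \<circ> x) h i j)" for h i j
  proof -
    have "of_class (class_minus_2 r) Y (?T h i j)"
      by (rule transform_components_of_class[OF r W(1) Y f g of_class_subset[OF assms(6) W(3)] gW])
    then show ?thesis
      using of_class_cong[where f = "conn (U', f \<circ> x) h i j" and g = "?T h i j", OF Y conn'] by simp
  qed
  show ?thesis
  proof (intro exI[of _ U'] exI[of _ f] conjI)
    show "openin M U'" using c'(1) by (simp add: is_chart_def)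
    show "coord_transformation r (x ` U') f" using ct_f c'(2) by simp
    show "pre_semigeodesic e1 ((f \<circ> x) ` U') (conn (U', f \<circ> x))"
      unfolding c'(3) by (rule pre_semigeodesicI) (rule zero)
    show "\<forall>h. \<forall>y\<in>(f \<circ> x) ` U'. conn (U', f \<circ> x) h e1 e1 y = 0"
      unfolding c'(3) using zero by blast
    show "\<forall>h i j. of_class (class_minus_2 r) ((f \<circ> x) ` U') (conn (U', f \<circ> x) h i j)"
      unfolding c'(3) using conn_class by blast
  qed (fact U' atlas)+
qed

end
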